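(* Let $\mathcal D=(D_0,\dots,D_K)$ be a finite chain of sharp localized packages and let $\boldsymbol\zeta_*=(\zeta_{0,*},\dots,\zeta_{K,*})\in\mathcal G_{\mathrm{comp}}$ be one gauge representative, used in all residual channels. Assume: (1) (amplitude) for each $0\le k\le K$, $\|u_{D_k}\|_{L^3}+\|U_{D_k-\zeta_{k,*}}\|_{L^3}\le M_U$, and for each $0\le k\le K-1$, $$\|u_{D_{k+1}}\|_{L^3}+\|\mathcal R^uu_{D_k}\|_{L^3}+\|U_{D_{k+1}-\zeta_{k+1,*}}\|_{L^3}+\|\mathcal R^UU_{D_k-\zeta_{k,*}}\|_{L^3}\le M_U;$$ (2) (source and pressure realization, on the representatives used) $F^{\mathrm{act}}_{D_k-\zeta_{k,*}}=\eta\,u_{D_k}\otimes u_{D_k}$, $F^{\mathrm{mod}}_{D_k-\zeta_{k,*}}=\eta(U_{D_k-\zeta_{k,*}}\otimes U_{D_k-\zeta_{k,*}}+R_{D_k-\zeta_{k,*}})$, and $p^{\mathrm{act}}_{D_k-\zeta_{k,*}}=R_iR_j(F^{\mathrm{act}}_{D_k-\zeta_{k,*},ij})$ for all $k$; (3) (pressure-intertwining budget) for the sources $F=F^{\mathrm{act}}_{D_k-\zeta_{k,*}}$, $0\le k\le K-1$, $$\|R_iR_j(\mathcal R^{\mathrm{src}}F)_{ij}-\mathcal R^{\mathrm{prs}}R_iR_jF_{ij}\|_{Y_{\mathrm{prs}}}\le C_{\mathcal R}\,\mathsf{Leak}^{\mathrm{prs}}_{\mathcal R}(F);$$ (4) (near-minimizer)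 $|\mathcal D-\boldsymbol\zeta_*|^{\sharp,[0,K]}_{\mathrm{comp}}\le\operatorname{dist}^{\sharp,[0,K]}_{\mathrm{comp}}(\mathcal D,\mathcal G_{\mathrm{comp}})+\delta^{[0,K]}_{\mathrm{comp}}$. Then $$\mathsf{Err}^{[0,K]}_{\mathrm{comp}}(\mathcal D;\boldsymbol\zeta_* )\le C^{[0,K]}_{\mathrm{comp}}(M_U)\operatorname{dist}^{\sharp,[0,K]}_{\mathrm{comp}}(\mathcal D,\mathcal G_{\mathrm{comp}})+C^{[0,K]}_{\mathrm{comp}}(M_U)\,\delta^{[0,K]}_{\mathrm{comp}},$$ where $C^{[0,K]}_{\mathrm{comp}}(M_U)$ is a finite constant depending only on $M_U$, $K$, the fixed geometry, cutoffs and reproduction maps, the Calderón–Zygmund constant, $C_{\mathcal R}$, the gate/slack weights, and the norm-domination constants.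
   Context: Geometry. Every window is a copy of $Q_1=B_1\times(-1,0)$. $\eta\in C_c^\infty(B_1)$, $0\le\eta\le1$, $\eta\equiv1$ on $B_{3/4}$; $\chi\in C_c^\infty(B_{3/4})$, $0\le\chi\le1$, $\chi\equiv1$ on $B_{1/2}$; $A_{3/4,1}=B_1\setminus B_{3/4}$; $A_\chi=\operatorname{supp}\nabla\chi\cup\operatorname{supp}\Delta\chi$. $X_{\mathrm{src}}=L^{3/2}(Q_1)^{3\times3}$, $Y_{\mathrm{prs}}=L^{3/2}((-1,0);L^{3/2}(B_{1/2}))$, $Y_{\mathrm{harm}}=L^{3/2}((-1,0);L^{3/2}(B_{3/4}))$. $R_i$ are Riesz transforms on $\mathbb R^3$ (sources extended by $0$), with $\|R_iR_jF_{ij}\|_{Y_{\mathrm{prs}}}\le C_{\mathrm{CZ}}\|F\|_{X_{\mathrm{src}}}$. Packages. A sharp localized package is a tuple $D=(u,U,R,F^{\mathrm{act}},F^{\mathrm{mod}},E_F,p^{\mathrm{act}},p_{\mathrm{harm}},\Pi,\Phi,T,s)$ together with a pressure coordinate $p$ (e.g. $p=p^{\mathrm{act}}+p_{\mathrm{harm}}+$ remainder), where $u,U\in L^3(Q_1)^3$, $\nabla u\in L^2_tL^2_x$, $R,F^{\mathrm{act}},F^{\mathrm{mod}},E_F\in X_{\mathrm{src}}$, $p\in L^{3/2}(Q_1)$, $p_{\mathrm{harm}}\in Y_{\mathrm{harm}}$, and $\Pi,\Phi,T,s$ lie in fixed normed spaces. $\mathcal G_{\mathrm{comp}}$ is a class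 of gauge tuples $\boldsymbol\zeta=(\zeta_0,\dots,\zeta_K)$ with zero velocity component; $D-\zeta$ has the same $u$, while $U,R,E_F,p_{\mathrm{harm}},\dots$ are shifted by subtracting the gauge coordinates. All functionals below with argument $(D;\zeta)$ are evaluated on the coordinates of $D-\zeta$. Pressure-source residual: $\mathsf{Err}^{\mathrm{prs}}_{\mathrm{src}}=\|R_iR_j(\mathcal C_{ij})\|_{Y_{\mathrm{prs}}}+\|C_\eta(u\otimes u)\|_{Y_{\mathrm{prs}}}+\|R_iR_j(E_{F,ij})\|_{Y_{\mathrm{prs}}}$, where $\mathcal C_{ij}=\eta(u_iu_j-U_iU_j-R_{ij})$ and $C_\eta(f)=R_iR_j(\eta f_{ij})-\eta R_iR_j(f_{ij})$. Localization residual: $\mathsf{Err}_{\mathrm{loc}}=\mathsf{Err}^{\mathrm{mom}}_{\mathrm{loc}}+\mathsf{Err}^{\mathrm{flux}}_{\mathrm{loc}}$, where $\mathsf{Err}^{\mathrm{mom}}_{\mathrm{loc}}=\|-2\nabla\chi\cdot\nabla u-u\Delta\chi+p\nabla\chi+(u\otimes u)\nabla\chi\|$ in the sum space $L^2((-1,0);H^{-1}(B_{3/4}))+L^{3/2}((-1,0);W^{-1,3/2}(B_{3/4}))$, and $\mathsf{Err}^{\mathrm{flux}}_{\mathrm{loc}}=|\int|u|^2\Delta(\chi^2)|+|\int|u|^2u\cdot\nabla(\chi^2)|+2|\int p\,u\cdot\nabla(\chi^2)|$ (integrals over $B_{3/4}\times(-1,0)$). Leakages: $\mathsf{Leak}_{\nabla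 u}=\|\nabla u\|_{L^2_tL^2_x(A_\chi)}$, $\mathsf{Leak}_u=\|u\|_{L^3_tL^3_x(A_\chi)}$, $\mathsf{Leak}_p=\|p\|_{L^{3/2}_tL^{3/2}_x(A_\chi)}$. Single-window gate/slack residual: for a finite channel set $\mathfrak A$ with nonnegative functionals $B_a,\tau_a,s_a$ and weights $\omega_a,\lambda_a>0$, put $\mathsf{Gate}_a=(B_a-\tau_a)_+$, $\mathsf{Slack}_a=|B_a+s_a-\tau_a|$, $\mathsf{Err}^{\mathrm{win}}_{\mathrm{gs}}=\sum_a\omega_a\mathsf{Gate}_a+\sum_a\lambda_a\mathsf{Slack}_a$. Reproduction residual of an edge, with fixed bounded maps $\mathcal R^u,\mathcal R^{\mathrm{src}},\mathcal R^{\mathrm{prs}},\mathcal R^{\mathrm{harm}},\mathcal R^U,\mathcal R^R,\mathcal R^E,\mathcal R^\Pi,\mathcal R^\Phi,\mathcal R^T$ between the coordinate spaces of adjacent windows. For a coordinate $X$ let $\mathsf{Rep}_X$ be the norm of $X_{D_{k+1}-\zeta_{k+1}}-\mathcal R X_{D_k-\zeta_k}$ with the corresponding map and norm ($L^3$ for $u,U$; $L^{3/2}$ for $R$; $X_{\mathrm{src}}$ for $E_F,F^{\mathrm{act}},F^{\mathrm{mod}}$, the last two using $\mathcal R^{\mathrm{src}}$; $Y_{\mathrm{prs}}$ for $p^{\mathrm{act}}$, using $\mathcal R^{\mathrm{prs}}$; $Y_{\mathrm{harm}}$ for $p_{\mathrm{harm}}$; the given norms for $\Pi,\Phi,T$).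 Then $\mathsf{Err}_{\mathrm{rep}}=\mathsf{Rep}_u+\mathsf{Rep}_U+\mathsf{Rep}_R+\mathsf{Rep}_E+\mathsf{Rep}_{F^{\mathrm{act}}}+\mathsf{Rep}_{F^{\mathrm{mod}}}+\mathsf{Rep}_{p^{\mathrm{act}}}+\mathsf{Rep}_{\mathrm{harm}}+\mathsf{Rep}_\Pi+\mathsf{Rep}_\Phi+\mathsf{Rep}_T$. Leakages: $\mathsf{Leak}^F_{\mathrm{rep}}=\|\eta(\mathcal R^uu_{D_k})\otimes(\mathcal R^uu_{D_k})-\mathcal R^{\mathrm{src}}F^{\mathrm{act}}_{D_k-\zeta_k}\|_{X_{\mathrm{src}}}$; $\mathsf{Leak}^{F,\mathrm{mod}}_{\mathrm{rep}}=\|\eta[(\mathcal R^UU_{D_k-\zeta_k})\otimes(\mathcal R^UU_{D_k-\zeta_k})+\mathcal R^RR_{D_k-\zeta_k}]-\mathcal R^{\mathrm{src}}F^{\mathrm{mod}}_{D_k-\zeta_k}\|_{X_{\mathrm{src}}}$; and $\mathsf{Leak}^{\mathrm{prs}}_{\mathcal R}(F)\ge0$ is a given coordinate. Chain gate/slack residual of an edge, with scalar maps $\mathcal R^B_a,\mathcal R^\tau_a,\mathcal R^s_a,\mathcal R^g_a$: $\mathsf{Rep}^B_a=|B_a(D_{k+1};\zeta_{k+1})-\mathcal R^B_aB_a(D_k;\zeta_k)|$, similarly $\mathsf{Rep}^\tau_a,\mathsf{Rep}^s_a$ and $\mathsf{Rep}^{\mathrm{gate}}_a$ (for $\mathsf{Gate}_a$,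 with $\mathcal R^g_a$); $\mathsf{Err}^{\mathrm{chain}}_{\mathrm{gs}}=\sum_a\omega_a\mathsf{Rep}^{\mathrm{gate}}_a+\sum_a\lambda_a(\mathsf{Rep}^B_a+\mathsf{Rep}^\tau_a+\mathsf{Rep}^s_a)$. Total residual: $$\mathsf{Err}^{[0,K]}_{\mathrm{comp}}(\mathcal D;\boldsymbol\zeta)=\sum_{k=0}^K\bigl(\mathsf{Err}^{\mathrm{prs}}_{\mathrm{src}}+\mathsf{Err}_{\mathrm{loc}}+\mathsf{Err}^{\mathrm{win}}_{\mathrm{gs}}\bigr)(D_k;\zeta_k)+\sum_{k=0}^{K-1}\bigl(\mathsf{Err}_{\mathrm{rep}}+\mathsf{Err}^{\mathrm{chain}}_{\mathrm{gs}}\bigr)(D_k,D_{k+1};\zeta_k,\zeta_{k+1}).$$ Norms. With a given core norm $\|D\|_{\mathrm{pkg},0}\ge0$, let $\|D\|^\sharp=\|D\|_{\mathrm{pkg},0}+\|u-U\|_{L^3}+\|R\|_{L^{3/2}}+\|E_F\|_{X_{\mathrm{src}}}+\|u\|_{L^3_tL^3_x(A_{3/4,1})}+\|p_{\mathrm{harm}}\|_{Y_{\mathrm{harm}}}$. The window component norm $|D|^{\sharp,\mathrm{comp}}_{\mathrm{win}}$ is a given functional dominating, up to fixed constants, $\|D\|^\sharp+\mathsf{Leak}_{\nabla u}+\mathsf{Leak}_u+\mathsf{Leak}_p$ and $\|D\|^\sharp+\mathsf{Err}^{\mathrm{win}}_{\mathrm{gs}}$. The edge component norm $|(D_k,D_{k+1})|^{\sharp,\mathrm{comp}}_{\mathrm{edge}}$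 dominates, up to fixed constants, the chain reproduction norm $\|D_k\|^\sharp+\|D_{k+1}\|^\sharp+\mathsf{Rep}_u+\mathsf{Rep}_U+\mathsf{Rep}_R+\mathsf{Rep}_E+\mathsf{Rep}_{\mathrm{harm}}+\mathsf{Rep}_\Pi+\mathsf{Rep}_\Phi+\mathsf{Rep}_T+\mathsf{Leak}^F_{\mathrm{rep}}+\mathsf{Leak}^{F,\mathrm{mod}}_{\mathrm{rep}}+\mathsf{Leak}^{\mathrm{prs}}_{\mathcal R}(F^{\mathrm{act}}_{D_k})$ and the same quantity plus $\mathsf{Err}^{\mathrm{win}}_{\mathrm{gs}}$ of both windows plus $\mathsf{Err}^{\mathrm{chain}}_{\mathrm{gs}}$. Finally $|\mathcal D|^{\sharp,[0,K]}_{\mathrm{comp}}=\sum_{k=0}^K|D_k|^{\sharp,\mathrm{comp}}_{\mathrm{win}}+\sum_{k=0}^{K-1}|(D_k,D_{k+1})|^{\sharp,\mathrm{comp}}_{\mathrm{edge}}$, evaluated on shifted coordinates for $\mathcal D-\boldsymbol\zeta$, and $\operatorname{dist}^{\sharp,[0,K]}_{\mathrm{comp}}(\mathcal D,\mathcal G_{\mathrm{comp}})=\inf_{\boldsymbol\zeta\in\mathcal G_{\mathrm{comp}}}|\mathcal D-\boldsymbol\zeta|^{\sharp,[0,K]}_{\mathrm{comp}}$. *)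

theory Defs
  imports "HOL-Analysis.Analysis"
begin

section \<open>Smooth functions and classical derivatives\<close>

primrec Ck :: "nat \<Rightarrow> ('a::euclidean_space \<Rightarrow> 'b::real_normed_vector) \<Rightarrow> bool" where
  "Ck 0 f \<longleftrightarrow> continuous_on UNIV f"
| "Ck (Suc k) f \<longleftrightarrow> (\<forall>x. f differentiable (at x)) \<and>
      (\<forall>b\<in>Basis. Ck k (\<lambda>x. frechet_derivative f (at x) b))"

definition smooth :: "('a::euclidean_space \<Rightarrow> 'b::real_normed_vector) \<Rightarrow> bool" where
  "smooth f \<longleftrightarrow> (\<forall>k. Ck k f)"

definition test_fun :: "'a::euclidean_space set \<Rightarrow> ('a \<Rightarrow> 'b::real_normed_vector) \<Rightarrow> bool" where
  "test_fun S f \<longleftrightarrow> smooth f \<and> (\<exists>C. compact C \<and> C \<subseteq> S \<and> (\<forall>x. x \<notin> C \<longrightarrow> f x = 0))"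

definition pd :: "3 \<Rightarrow> (real^3 \<Rightarrow> real) \<Rightarrow> real^3 \<Rightarrow> real" where
  "pd j f x = frechet_derivative f (at x) (axis j 1)"

definition grad :: "(real^3 \<Rightarrow> real) \<Rightarrow> real^3 \<Rightarrow> real^3" where
  "grad f x = (\<chi> j. pd j f x)"

definition lap :: "(real^3 \<Rightarrow> real) \<Rightarrow> real^3 \<Rightarrow> real" where
  "lap f x = (\<Sum>j\<in>UNIV. pd j (pd j f) x)"

definition jac :: "(real^3 \<Rightarrow> real^3) \<Rightarrow> real^3 \<Rightarrow> real^3^3" where
  "jac \<phi> x = matrix (frechet_derivative \<phi> (at x))"

definition outer :: "real^3 \<Rightarrow> real^3 \<Rightarrow> real^3^3" where
  "outer a b = (\<chi> i j. a $ i * b $ j)"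

section \<open>Lebesgue spaces\<close>

text \<open>Elements of Lebesgue spaces are represented by Borel functions that are relevant only on
  the set \<open>S\<close>; equality in the space is equality almost everywhere on \<open>S\<close>. Values in
  \<open>real^3\<close> and \<open>real^3^3\<close> carry the Euclidean (Frobenius) norm. The real number \<open>Lnorm p S f\<close>
  is meaningful only when \<open>Lsp p S f\<close> holds.\<close>

definition Lsp :: "real \<Rightarrow> 'a::euclidean_space set \<Rightarrow> ('a \<Rightarrow> 'b::euclidean_space) \<Rightarrow> bool" where
  "Lsp p S f \<longleftrightarrow> set_borel_measurable lborel S f \<and>
     set_integrable lborel S (\<lambda>x. norm (f x) powr p)"

definition Lnorm :: "real \<Rightarrow> 'a::euclidean_space set \<Rightarrow> ('a \<Rightarrow> 'b::euclidean_space) \<Rightarrow> real" where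
  "Lnorm p S f = (LINT x:S|lborel. norm (f x) powr p) powr (1 / p)"

definition ae_eq :: "'a::euclidean_space set \<Rightarrow> ('a \<Rightarrow> 'b) \<Rightarrow> ('a \<Rightarrow> 'b) \<Rightarrow> bool" where
  "ae_eq S f g \<longleftrightarrow> (AE x in lborel. x \<in> S \<longrightarrow> f x = g x)"

text \<open>A space-time point is \<open>(x, t)\<close>. The mixed spaces \<open>L\<^sup>p((-1,0); L\<^sup>p(B))\<close> that occur all have
  equal exponents and are identified, isometrically by Fubini, with \<open>L\<^sup>p\<close> of \<open>cyl B\<close>.\<close>

type_synonym 'b field = "(real^3) \<times> real \<Rightarrow> 'b"

abbreviation win_time :: "real set" where "win_time \<equiv> {-1<..<0}"

abbreviation cyl :: "(real^3) set \<Rightarrow> ((real^3) \<times> real) set" where "cyl B \<equiv> B \<times> win_time"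

abbreviation Bl :: "real \<Rightarrow> (real^3) set" where "Bl r \<equiv> ball 0 r"

abbreviation Q1 :: "((real^3) \<times> real) set" where "Q1 \<equiv> cyl (Bl 1)"

abbreviation L3_sp :: "(real^3) field \<Rightarrow> bool" where "L3_sp \<equiv> Lsp 3 Q1"
abbreviation L3_norm :: "(real^3) field \<Rightarrow> real" where "L3_norm \<equiv> Lnorm 3 Q1"
abbreviation Xsrc :: "(real^3^3) field \<Rightarrow> bool" where "Xsrc \<equiv> Lsp (3/2) Q1"
abbreviation Xsrc_norm :: "(real^3^3) field \<Rightarrow> real" where "Xsrc_norm \<equiv> Lnorm (3/2) Q1"
abbreviation Yprs :: "real field \<Rightarrow> bool" where "Yprs \<equiv> Lsp (3/2) (cyl (Bl (1/2)))"
abbreviation Yprs_norm :: "real field \<Rightarrow> real" where "Yprs_norm \<equiv> Lnorm (3/2) (cyl (Bl (1/2)))"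
abbreviation Yharm :: "real field \<Rightarrow> bool" where "Yharm \<equiv> Lsp (3/2) (cyl (Bl (3/4)))"
abbreviation Yharm_norm :: "real field \<Rightarrow> real" where "Yharm_norm \<equiv> Lnorm (3/2) (cyl (Bl (3/4)))"

section \<open>Riesz transforms\<close>

text \<open>The \<open>j\<close>-th Riesz transform on \<open>L\<^sup>3\<^sup>/\<^sup>2(\<real>\<^sup>3)\<close>: the bounded linear operator given on test
  functions by the principal value integral against \<open>c x\<^sub>j / |x|\<^sup>4\<close>, where
  \<open>c = \<Gamma>(2) / \<pi>\<^sup>2\<close>. By density of the test functions it is unique up to null sets.\<close>

definition is_riesz :: "3 \<Rightarrow> ((real^3 \<Rightarrow> real) \<Rightarrow> real^3 \<Rightarrow> real) \<Rightarrow> bool" where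
  "is_riesz j R \<longleftrightarrow>
     (\<forall>f. Lsp (3/2) UNIV f \<longrightarrow> Lsp (3/2) UNIV (R f)) \<and>
     (\<forall>f g a b. Lsp (3/2) UNIV f \<longrightarrow> Lsp (3/2) UNIV g \<longrightarrow>
        ae_eq UNIV (R (\<lambda>x. a * f x + b * g x)) (\<lambda>x. a * R f x + b * R g x)) \<and>
     (\<exists>C. \<forall>f. Lsp (3/2) UNIV f \<longrightarrow> Lnorm (3/2) UNIV (R f) \<le> C * Lnorm (3/2) UNIV f) \<and>
     (\<forall>f. test_fun UNIV f \<longrightarrow>
        (AE x in lborel.
          ((\<lambda>\<epsilon>. 1 / pi\<^sup>2 * (LINT y:{y. \<epsilon> < norm (x - y)}|lborel.
                (x - y) $ j / norm (x - y) ^ 4 * f y)) \<longlongrightarrow> R f x) (at_right 0)))"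

text \<open>The action of the \<open>j\<close>-th Riesz transform in the space variable on space-time functions;
  the jointly measurable representative is part of the requirement.\<close>

definition is_riesz_st :: "3 \<Rightarrow> (real field \<Rightarrow> real field) \<Rightarrow> bool" where
  "is_riesz_st j Rt \<longleftrightarrow> (\<exists>R. is_riesz j R \<and>
     (\<forall>F. Lsp (3/2) (cyl UNIV) F \<longrightarrow>
        Lsp (3/2) (cyl UNIV) (Rt F) \<and>
        (AE t in lborel. t \<in> win_time \<longrightarrow>
           ae_eq UNIV (\<lambda>x. Rt F (x, t)) (R (\<lambda>y. F (y, t))))))"

definition ext0 :: "'a set \<Rightarrow> ('a \<Rightarrow> 'b::zero) \<Rightarrow> 'a \<Rightarrow> 'b" where
  "ext0 S f z = (if z \<in> S then f z else 0)"

definition RR :: "(3 \<Rightarrow> real field \<Rightarrow> real field) \<Rightarrow> (real^3^3) field \<Rightarrow> real field" where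
  "RR Rt F z = (\<Sum>i\<in>UNIV. \<Sum>j\<in>UNIV. Rt i (Rt j (ext0 Q1 (\<lambda>w. F w $ i $ j))) z)"

definition comm :: "(3 \<Rightarrow> real field \<Rightarrow> real field) \<Rightarrow> (real^3 \<Rightarrow> real) \<Rightarrow>
    (real^3^3) field \<Rightarrow> real field" where
  "comm Rt \<eta> f z = RR Rt (\<lambda>w. \<eta> (fst w) *\<^sub>R f w) z - \<eta> (fst z) * RR Rt f z"

section \<open>Negative Sobolev spaces and the sum space\<close>

definition W1norm :: "real \<Rightarrow> (real^3) set \<Rightarrow> (real^3 \<Rightarrow> real^3) \<Rightarrow> real" where
  "W1norm q B \<phi> = (LINT x:B|lborel. norm (\<phi> x) powr q + norm (jac \<phi> x) powr q) powr (1 / q)"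

text \<open>\<open>W\<^sup>-\<^sup>1\<^sup>,\<^sup>p(B)\<close> (vector valued) is the dual of the \<open>W\<^sup>1\<^sup>,\<^sup>q\<close>-closure of the test functions,
  \<open>1/p + 1/q = 1\<close>; its elements are given by their values on test functions.\<close>

definition dual_sp :: "real \<Rightarrow> (real^3) set \<Rightarrow> ((real^3 \<Rightarrow> real^3) \<Rightarrow> real) \<Rightarrow> bool" where
  "dual_sp q B T \<longleftrightarrow>
     (\<forall>\<phi> \<psi> a b. test_fun B \<phi> \<longrightarrow> test_fun B \<psi> \<longrightarrow>
        T (\<lambda>x. a *\<^sub>R \<phi> x + b *\<^sub>R \<psi> x) = a * T \<phi> + b * T \<psi>) \<and>
     (\<exists>C. \<forall>\<phi>. test_fun B \<phi> \<longrightarrow> \<bar>T \<phi>\<bar> \<le> C * W1norm q B \<phi>)"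

definition dual_norm :: "real \<Rightarrow> (real^3) set \<Rightarrow> ((real^3 \<Rightarrow> real^3) \<Rightarrow> real) \<Rightarrow> real" where
  "dual_norm q B T = (SUP \<phi>\<in>{\<phi>. test_fun B \<phi> \<and> W1norm q B \<phi> \<le> 1}. \<bar>T \<phi>\<bar>)"

text \<open>\<open>L\<^sup>p((-1,0); W\<^sup>-\<^sup>1\<^sup>,\<^sup>p(B))\<close> with \<open>q\<close> conjugate to \<open>p\<close>. The predual being separable,
  weak measurability already makes the norm of the values measurable (and, the dual being
  separable as well, coincides with strong measurability).\<close>

definition Ldual_int :: "real \<Rightarrow> real \<Rightarrow> (real^3) set \<Rightarrow>
    (real \<Rightarrow> (real^3 \<Rightarrow> real^3) \<Rightarrow> real) \<Rightarrow> ennreal" where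
  "Ldual_int p q B f = (\<integral>\<^sup>+t\<in>win_time. ennreal (dual_norm q B (f t) powr p) \<partial>lborel)"

definition Ldual_sp :: "real \<Rightarrow> real \<Rightarrow> (real^3) set \<Rightarrow>
    (real \<Rightarrow> (real^3 \<Rightarrow> real^3) \<Rightarrow> real) \<Rightarrow> bool" where
  "Ldual_sp p q B f \<longleftrightarrow>
     (\<forall>\<phi>. test_fun B \<phi> \<longrightarrow> set_borel_measurable lborel win_time (\<lambda>t. f t \<phi>)) \<and>
     (AE t in lborel. t \<in> win_time \<longrightarrow> dual_sp q B (f t)) \<and>
     Ldual_int p q B f < \<infinity>"

definition Ldual_norm :: "real \<Rightarrow> real \<Rightarrow> (real^3) set \<Rightarrow>
    (real \<Rightarrow> (real^3 \<Rightarrow> real^3) \<Rightarrow> real) \<Rightarrow> real" where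
  "Ldual_norm p q B f = enn2real (Ldual_int p q B f) powr (1 / p)"

text \<open>The norm of \<open>g\<close>, acting by integration over \<open>B\<close>, in
  \<open>L\<^sup>2((-1,0); H\<^sup>-\<^sup>1(B)) + L\<^sup>3\<^sup>/\<^sup>2((-1,0); W\<^sup>-\<^sup>1\<^sup>,\<^sup>3\<^sup>/\<^sup>2(B))\<close>.\<close>

definition sum_norm :: "(real^3) set \<Rightarrow> (real^3) field \<Rightarrow> real" where
  "sum_norm B g = Inf {Ldual_norm 2 2 B f1 + Ldual_norm (3/2) 3 B f2 | f1 f2.
     Ldual_sp 2 2 B f1 \<and> Ldual_sp (3/2) 3 B f2 \<and>
     (AE t in lborel. t \<in> win_time \<longrightarrow> (\<forall>\<phi>. test_fun B \<phi> \<longrightarrow>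
        (LINT x:B|lborel. g (x, t) \<bullet> \<phi> x) = f1 t \<phi> + f2 t \<phi>))}"

section \<open>Weak spatial gradient\<close>

text \<open>\<open>G z $ i $ j\<close> is the weak derivative of the \<open>i\<close>-th component in direction \<open>j\<close>.\<close>

definition weak_grad :: "(real^3) field \<Rightarrow> (real^3^3) field \<Rightarrow> bool" where
  "weak_grad u G \<longleftrightarrow> Lsp 2 Q1 G \<and>
     (\<forall>\<phi> :: real field. test_fun Q1 \<phi> \<longrightarrow> (\<forall>i j.
        (LINT z:Q1|lborel. u z $ i * frechet_derivative \<phi> (at z) (axis j 1, 0)) =
        - (LINT z:Q1|lborel. G z $ i $ j * \<phi> z)))"

definition wgrad :: "(real^3) field \<Rightarrow> (real^3^3) field" where
  "wgrad u = (SOME G. weak_grad u G)"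

section \<open>Packages and gauges\<close>

record ('pi, 'phi, 'tt, 's) pkg =
  vel :: "(real^3) field"
  mod_vel :: "(real^3) field"
  stress :: "(real^3^3) field"
  F_act :: "(real^3^3) field"
  F_mod :: "(real^3^3) field"
  E_F :: "(real^3^3) field"
  p_act :: "real field"
  p_harm :: "real field"
  co_Pi :: 'pi
  co_Phi :: 'phi
  co_T :: 'tt
  co_s :: 's
  prs :: "real field"

definition coords_ok :: "('pi, 'phi, 'tt, 's) pkg \<Rightarrow> bool" where
  "coords_ok D \<longleftrightarrow> L3_sp (vel D) \<and> L3_sp (mod_vel D) \<and>
     Xsrc (stress D) \<and> Xsrc (F_act D) \<and> Xsrc (F_mod D) \<and> Xsrc (E_F D) \<and>
     Yprs (p_act D) \<and> Yharm (p_harm D) \<and> Lsp (3/2) Q1 (prs D)"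

definition sharp_pkg :: "('pi, 'phi, 'tt, 's) pkg \<Rightarrow> bool" where
  "sharp_pkg D \<longleftrightarrow> coords_ok D \<and> (\<exists>G. weak_grad (vel D) G)"

definition gauge :: "('pi, 'phi, 'tt, 's) pkg \<Rightarrow> bool" where
  "gauge \<zeta> \<longleftrightarrow> coords_ok \<zeta> \<and> vel \<zeta> = (\<lambda>_. 0)"

definition shift :: "('pi::real_normed_vector, 'phi::real_normed_vector,
    'tt::real_normed_vector, 's::real_normed_vector) pkg \<Rightarrow>
    ('pi, 'phi, 'tt, 's) pkg \<Rightarrow> ('pi, 'phi, 'tt, 's) pkg" where
  "shift D \<zeta> = \<lparr>
     vel = \<lambda>z. vel D z - vel \<zeta> z,
     mod_vel = \<lambda>z. mod_vel D z - mod_vel \<zeta> z,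
     stress = \<lambda>z. stress D z - stress \<zeta> z,
     F_act = \<lambda>z. F_act D z - F_act \<zeta> z,
     F_mod = \<lambda>z. F_mod D z - F_mod \<zeta> z,
     E_F = \<lambda>z. E_F D z - E_F \<zeta> z,
     p_act = \<lambda>z. p_act D z - p_act \<zeta> z,
     p_harm = \<lambda>z. p_harm D z - p_harm \<zeta> z,
     co_Pi = co_Pi D - co_Pi \<zeta>,
     co_Phi = co_Phi D - co_Phi \<zeta>,
     co_T = co_T D - co_T \<zeta>,
     co_s = co_s D - co_s \<zeta>,
     prs = \<lambda>z. prs D z - prs \<zeta> z\<rparr>"

section \<open>Fixed data\<close>

definition cutoffs :: "(real^3 \<Rightarrow> real) \<Rightarrow> (real^3 \<Rightarrow> real) \<Rightarrow> bool" where
  "cutoffs \<eta> \<chi>c \<longleftrightarrow>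
     test_fun (Bl 1) \<eta> \<and> (\<forall>x. 0 \<le> \<eta> x \<and> \<eta> x \<le> 1) \<and> (\<forall>x\<in>Bl (3/4). \<eta> x = 1) \<and>
     test_fun (Bl (3/4)) \<chi>c \<and> (\<forall>x. 0 \<le> \<chi>c x \<and> \<chi>c x \<le> 1) \<and> (\<forall>x\<in>Bl (1/2). \<chi>c x = 1)"

text \<open>Boundedness of a not necessarily linear map; compatibility with almost everywhere equality
  says that the map is defined on the Lebesgue space and not only on representatives.\<close>

definition bdd_Lmap :: "real \<Rightarrow> ((real^3) \<times> real) set \<Rightarrow>
    ('b::euclidean_space field \<Rightarrow> 'b field) \<Rightarrow> bool" where
  "bdd_Lmap p S A \<longleftrightarrow>
     (\<forall>f. Lsp p S f \<longrightarrow> Lsp p S (A f)) \<and>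
     (\<forall>f g. Lsp p S f \<longrightarrow> Lsp p S g \<longrightarrow> ae_eq S f g \<longrightarrow> ae_eq S (A f) (A g)) \<and>
     (\<exists>C. \<forall>f. Lsp p S f \<longrightarrow> Lnorm p S (A f) \<le> C * Lnorm p S f)"

definition bdd_map :: "('a::real_normed_vector \<Rightarrow> 'a) \<Rightarrow> bool" where
  "bdd_map A \<longleftrightarrow> (\<exists>C. \<forall>x. norm (A x) \<le> C * norm x)"

record ('pi, 'phi, 'tt, 'a) repro =
  rp_u :: "(real^3) field \<Rightarrow> (real^3) field"
  rp_src :: "(real^3^3) field \<Rightarrow> (real^3^3) field"
  rp_prs :: "real field \<Rightarrow> real field"
  rp_harm :: "real field \<Rightarrow> real field"
  rp_U :: "(real^3) field \<Rightarrow> (real^3) field"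
  rp_R :: "(real^3^3) field \<Rightarrow> (real^3^3) field"
  rp_E :: "(real^3^3) field \<Rightarrow> (real^3^3) field"
  rp_Pi :: "'pi \<Rightarrow> 'pi"
  rp_Phi :: "'phi \<Rightarrow> 'phi"
  rp_T :: "'tt \<Rightarrow> 'tt"
  rp_chB :: "'a \<Rightarrow> real \<Rightarrow> real"
  rp_chtau :: "'a \<Rightarrow> real \<Rightarrow> real"
  rp_chs :: "'a \<Rightarrow> real \<Rightarrow> real"
  rp_chgate :: "'a \<Rightarrow> real \<Rightarrow> real"

definition bdd_repro :: "('pi::real_normed_vector, 'phi::real_normed_vector,
    'tt::real_normed_vector, 'a) repro \<Rightarrow> bool" where
  "bdd_repro M \<longleftrightarrow> bdd_Lmap 3 Q1 (rp_u M) \<and> bdd_Lmap (3/2) Q1 (rp_src M) \<and>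
     bdd_Lmap (3/2) (cyl (Bl (1/2))) (rp_prs M) \<and>
     bdd_Lmap (3/2) (cyl (Bl (3/4))) (rp_harm M) \<and>
     bdd_Lmap 3 Q1 (rp_U M) \<and> bdd_Lmap (3/2) Q1 (rp_R M) \<and> bdd_Lmap (3/2) Q1 (rp_E M) \<and>
     bdd_map (rp_Pi M) \<and> bdd_map (rp_Phi M) \<and> bdd_map (rp_T M)"

text \<open>\<open>dom_win1\<close>, \<open>dom_win2\<close> are the constants with which the window norm dominates the localization
  and the gate/slack quantity, \<open>dom_edge1\<close>, \<open>dom_edge2\<close> those with which the edge norm dominates
  the chain reproduction norm without and with the gate/slack terms.\<close>

record ('pi, 'phi, 'tt, 'a) fixed_data =
  cut_eta :: "real^3 \<Rightarrow> real"
  cut_chi :: "real^3 \<Rightarrow> real"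
  riesz :: "3 \<Rightarrow> real field \<Rightarrow> real field"
  C_CZ :: real
  maps :: "('pi, 'phi, 'tt, 'a) repro"
  C_R :: real
  channels :: "'a set"
  w_gate :: "'a \<Rightarrow> real"
  w_slack :: "'a \<Rightarrow> real"
  dom_win1 :: real
  dom_win2 :: real
  dom_edge1 :: real
  dom_edge2 :: real

definition data_ok :: "('pi::real_normed_vector, 'phi::real_normed_vector,
    'tt::real_normed_vector, 'a) fixed_data \<Rightarrow> bool" where
  "data_ok S \<longleftrightarrow> cutoffs (cut_eta S) (cut_chi S) \<and>
     (\<forall>j. is_riesz_st j (riesz S j)) \<and>
     (\<forall>F. Xsrc F \<longrightarrow> Yprs_norm (RR (riesz S) F) \<le> C_CZ S * Xsrc_norm F) \<and>
     bdd_repro (maps S) \<and>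
     finite (channels S) \<and> (\<forall>a\<in>channels S. 0 < w_gate S a \<and> 0 < w_slack S a) \<and>
     0 \<le> dom_win1 S \<and> 0 \<le> dom_win2 S \<and> 0 \<le> dom_edge1 S \<and> 0 \<le> dom_edge2 S"

text \<open>Functionals that are given rather than constructed. All of them, and all residuals below, take
  packages that have already been shifted by the gauge.\<close>

record ('pi, 'phi, 'tt, 's, 'a) functionals =
  fn_core :: "('pi, 'phi, 'tt, 's) pkg \<Rightarrow> real"
  fn_win :: "('pi, 'phi, 'tt, 's) pkg \<Rightarrow> real"
  fn_edge :: "('pi, 'phi, 'tt, 's) pkg \<Rightarrow> ('pi, 'phi, 'tt, 's) pkg \<Rightarrow> real"
  fn_leak_prs :: "(real^3^3) field \<Rightarrow> real"
  fn_B :: "'a \<Rightarrow> ('pi, 'phi, 'tt, 's) pkg \<Rightarrow> real"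
  fn_tau :: "'a \<Rightarrow> ('pi, 'phi, 'tt, 's) pkg \<Rightarrow> real"
  fn_s :: "'a \<Rightarrow> ('pi, 'phi, 'tt, 's) pkg \<Rightarrow> real"

section \<open>Window residuals\<close>

definition Err_prs where
  "Err_prs S D =
     Yprs_norm (RR (riesz S) (\<lambda>z. cut_eta S (fst z) *\<^sub>R
        (outer (vel D z) (vel D z) - outer (mod_vel D z) (mod_vel D z) - stress D z))) +
     Yprs_norm (comm (riesz S) (cut_eta S) (\<lambda>z. outer (vel D z) (vel D z))) +
     Yprs_norm (RR (riesz S) (E_F D))"

definition mom_field :: "(real^3 \<Rightarrow> real) \<Rightarrow> ('pi, 'phi, 'tt, 's) pkg \<Rightarrow> (real^3) field" where
  "mom_field \<chi>c D z =
     - 2 *\<^sub>R (wgrad (vel D) z *v grad \<chi>c (fst z)) - lap \<chi>c (fst z) *\<^sub>R vel D z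
     + prs D z *\<^sub>R grad \<chi>c (fst z) + outer (vel D z) (vel D z) *v grad \<chi>c (fst z)"

definition Err_mom where
  "Err_mom S D = sum_norm (Bl (3/4)) (mom_field (cut_chi S) D)"

definition Err_flux where
  "Err_flux S D = (let \<chi>2 = (\<lambda>x. (cut_chi S x)\<^sup>2); Q = cyl (Bl (3/4)) in
     \<bar>LINT z:Q|lborel. (norm (vel D z))\<^sup>2 * lap \<chi>2 (fst z)\<bar> +
     \<bar>LINT z:Q|lborel. (norm (vel D z))\<^sup>2 * (vel D z \<bullet> grad \<chi>2 (fst z))\<bar> +
     2 * \<bar>LINT z:Q|lborel. prs D z * (vel D z \<bullet> grad \<chi>2 (fst z))\<bar>)"

definition Err_loc where "Err_loc S D = Err_mom S D + Err_flux S D"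

definition A_chi :: "(real^3 \<Rightarrow> real) \<Rightarrow> (real^3) set" where
  "A_chi \<chi>c = closure {x. grad \<chi>c x \<noteq> 0} \<union> closure {x. lap \<chi>c x \<noteq> 0}"

definition Leak_gradu where
  "Leak_gradu S D = Lnorm 2 (cyl (A_chi (cut_chi S))) (wgrad (vel D))"

definition Leak_u where
  "Leak_u S D = Lnorm 3 (cyl (A_chi (cut_chi S))) (vel D)"

definition Leak_p where
  "Leak_p S D = Lnorm (3/2) (cyl (A_chi (cut_chi S))) (prs D)"

definition Gate where "Gate Fn a D = max 0 (fn_B Fn a D - fn_tau Fn a D)"

definition Slack where "Slack Fn a D = \<bar>fn_B Fn a D + fn_s Fn a D - fn_tau Fn a D\<bar>"

definition Err_gs_win where
  "Err_gs_win S Fn D = (\<Sum>a\<in>channels S. w_gate S a * Gate Fn a D) +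
     (\<Sum>a\<in>channels S. w_slack S a * Slack Fn a D)"

section \<open>Edge residuals\<close>

definition Rep_u where "Rep_u S D D' = L3_norm (\<lambda>z. vel D' z - rp_u (maps S) (vel D) z)"
definition Rep_U where "Rep_U S D D' = L3_norm (\<lambda>z. mod_vel D' z - rp_U (maps S) (mod_vel D) z)"
definition Rep_R where "Rep_R S D D' = Xsrc_norm (\<lambda>z. stress D' z - rp_R (maps S) (stress D) z)"
definition Rep_E where "Rep_E S D D' = Xsrc_norm (\<lambda>z. E_F D' z - rp_E (maps S) (E_F D) z)"
definition Rep_Fact where "Rep_Fact S D D' = Xsrc_norm (\<lambda>z. F_act D' z - rp_src (maps S) (F_act D) z)"
definition Rep_Fmod where "Rep_Fmod S D D' = Xsrc_norm (\<lambda>z. F_mod D' z - rp_src (maps S) (F_mod D) z)"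
definition Rep_pact where "Rep_pact S D D' = Yprs_norm (\<lambda>z. p_act D' z - rp_prs (maps S) (p_act D) z)"
definition Rep_harm where "Rep_harm S D D' = Yharm_norm (\<lambda>z. p_harm D' z - rp_harm (maps S) (p_harm D) z)"
definition Rep_Pi where "Rep_Pi S D D' = norm (co_Pi D' - rp_Pi (maps S) (co_Pi D))"
definition Rep_Phi where "Rep_Phi S D D' = norm (co_Phi D' - rp_Phi (maps S) (co_Phi D))"
definition Rep_T where "Rep_T S D D' = norm (co_T D' - rp_T (maps S) (co_T D))"

definition Err_rep where
  "Err_rep S D D' = Rep_u S D D' + Rep_U S D D' + Rep_R S D D' + Rep_E S D D' +
     Rep_Fact S D D' + Rep_Fmod S D D' + Rep_pact S D D' + Rep_harm S D D' +
     Rep_Pi S D D' + Rep_Phi S D D' + Rep_T S D D'"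

definition Leak_F where
  "Leak_F S D = Xsrc_norm (\<lambda>z. cut_eta S (fst z) *\<^sub>R
       outer (rp_u (maps S) (vel D) z) (rp_u (maps S) (vel D) z) -
     rp_src (maps S) (F_act D) z)"

definition Leak_Fmod where
  "Leak_Fmod S D = Xsrc_norm (\<lambda>z. cut_eta S (fst z) *\<^sub>R
       (outer (rp_U (maps S) (mod_vel D) z) (rp_U (maps S) (mod_vel D) z) +
        rp_R (maps S) (stress D) z) -
     rp_src (maps S) (F_mod D) z)"

definition Rep_chB where
  "Rep_chB S Fn a D D' = \<bar>fn_B Fn a D' - rp_chB (maps S) a (fn_B Fn a D)\<bar>"

definition Rep_chtau where
  "Rep_chtau S Fn a D D' = \<bar>fn_tau Fn a D' - rp_chtau (maps S) a (fn_tau Fn a D)\<bar>"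

definition Rep_chs where
  "Rep_chs S Fn a D D' = \<bar>fn_s Fn a D' - rp_chs (maps S) a (fn_s Fn a D)\<bar>"

definition Rep_chgate where
  "Rep_chgate S Fn a D D' = \<bar>Gate Fn a D' - rp_chgate (maps S) a (Gate Fn a D)\<bar>"

definition Err_gs_chain where
  "Err_gs_chain S Fn D D' = (\<Sum>a\<in>channels S. w_gate S a * Rep_chgate S Fn a D D') +
     (\<Sum>a\<in>channels S. w_slack S a *
        (Rep_chB S Fn a D D' + Rep_chtau S Fn a D D' + Rep_chs S Fn a D D'))"

section \<open>Norms, distance and total residual\<close>

definition sharp_norm where
  "sharp_norm Fn D = fn_core Fn D + L3_norm (\<lambda>z. vel D z - mod_vel D z) +
     Xsrc_norm (stress D) + Xsrc_norm (E_F D) +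
     Lnorm 3 (cyl (Bl 1 - Bl (3/4))) (vel D) + Yharm_norm (p_harm D)"

definition chain_rep_norm where
  "chain_rep_norm S Fn D D' = sharp_norm Fn D + sharp_norm Fn D' +
     Rep_u S D D' + Rep_U S D D' + Rep_R S D D' + Rep_E S D D' + Rep_harm S D D' +
     Rep_Pi S D D' + Rep_Phi S D D' + Rep_T S D D' +
     Leak_F S D + Leak_Fmod S D + fn_leak_prs Fn (F_act D)"

definition functionals_ok :: "('pi::real_normed_vector, 'phi::real_normed_vector,
    'tt::real_normed_vector, 'a) fixed_data \<Rightarrow>
    ('pi, 'phi, 'tt, 's::real_normed_vector, 'a) functionals \<Rightarrow> bool" where
  "functionals_ok S Fn \<longleftrightarrow>
     (\<forall>D. sharp_pkg D \<longrightarrow> 0 \<le> fn_core Fn D \<and> 0 \<le> fn_win Fn D \<and>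
        (\<forall>a\<in>channels S. 0 \<le> fn_B Fn a D \<and> 0 \<le> fn_tau Fn a D \<and> 0 \<le> fn_s Fn a D)) \<and>
     (\<forall>D D'. sharp_pkg D \<longrightarrow> sharp_pkg D' \<longrightarrow> 0 \<le> fn_edge Fn D D') \<and>
     (\<forall>F. Xsrc F \<longrightarrow> 0 \<le> fn_leak_prs Fn F) \<and>
     (\<forall>D. sharp_pkg D \<longrightarrow>
        sharp_norm Fn D + Leak_gradu S D + Leak_u S D + Leak_p S D
          \<le> dom_win1 S * fn_win Fn D \<and>
        sharp_norm Fn D + Err_gs_win S Fn D \<le> dom_win2 S * fn_win Fn D) \<and>
     (\<forall>D D'. sharp_pkg D \<longrightarrow> sharp_pkg D' \<longrightarrow>
        chain_rep_norm S Fn D D' \<le> dom_edge1 S * fn_edge Fn D D' \<and>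
        chain_rep_norm S Fn D D' + Err_gs_win S Fn D + Err_gs_win S Fn D' +
          Err_gs_chain S Fn D D' \<le> dom_edge2 S * fn_edge Fn D D')"

text \<open>Chains and gauge tuples are functions on \<open>nat\<close> of which only the values at \<open>0, \<dots>, K\<close> matter.\<close>

definition comp_norm where
  "comp_norm Fn K D = (\<Sum>k\<le>K. fn_win Fn (D k)) + (\<Sum>k<K. fn_edge Fn (D k) (D (Suc k)))"

definition shift_chain where "shift_chain D \<zeta> k = shift (D k) (\<zeta> k)"

definition comp_dist where
  "comp_dist Fn K D G = (INF \<zeta>\<in>G. comp_norm Fn K (shift_chain D \<zeta>))"

definition gauge_class :: "nat \<Rightarrow> (nat \<Rightarrow> ('pi, 'phi, 'tt, 's) pkg) set \<Rightarrow> bool" where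
  "gauge_class K G \<longleftrightarrow> (\<forall>\<zeta>\<in>G. \<forall>k\<le>K. gauge (\<zeta> k))"

definition Err_comp where
  "Err_comp S Fn K D =
     (\<Sum>k\<le>K. Err_prs S (D k) + Err_loc S (D k) + Err_gs_win S Fn (D k)) +
     (\<Sum>k<K. Err_rep S (D k) (D (Suc k)) + Err_gs_chain S Fn (D k) (D (Suc k)))"

end

(* Every residual is bounded by a component of the norm that sees the same coordinates, and the
   near-minimizer inequality is used only once, at the end.  The quadratic sources are handled by
   a (x) a - b (x) b = (a - b) (x) a + b (x) (a - b) and Hoelder with exponents 3 and 3, which makes
   them linear in the defect a - b with a factor controlled by the amplitude bound M_U.
   Since eta = 1 on B_{3/4}, on B_{1/2} the commutator C_eta(f) agrees with R_i R_j ((eta - 1) f),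
   whose source lives in the annulus B_1 - B_{3/4}; this needs linearity of the space-time
   Riesz transforms, obtained slicewise by Fubini.  The localization terms are supported where
   the derivatives of chi live, and in the sum space the viscous term goes to the L^2 H^{-1} part
   and everything else to the L^{3/2} W^{-1,3/2} part.  The defects of F^act and F^mod split into
   the reproduction defects of u, U, R plus the source leakage, and that of p^act follows by
   applying R_i R_j and the intertwining budget. *)
theory Submission
  imports Defs
begin

section \<open>Lebesgue spaces over a measure\<close>

text \<open>A Riesz transform is prescribed on almost every time slice only and up to null sets, so
  neither linearity nor independence of the representative holds pointwise. Identities between
  images are therefore \<open>ae_eq\<close> statements, and a norm is carried along one only after
  both sides are known to lie in the space. The amplitude bound controls \<open>u\<close> and
  \<open>U\<close>, not their defects or leakages. Hence every product keeps one factor that the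
  component norm sees, and the others are spent on powers of \<open>M\<close> or on the size of the
  cutoff region. The chain reproduction norm lists no defect of \<open>F_act\<close>,
  \<open>F_mod\<close> or \<open>p_act\<close>; these three have to be traded for the defects of
  \<open>u\<close>, \<open>U\<close>, \<open>R\<close> and the leakages. \<open>C_CZ\<close> and
  \<open>C_R\<close> carry no sign, so they enter the constants through absolute values. The factors
  \<open>1 + M\<close>, \<open>(1 + M)\<^sup>2\<close> and \<open>2 + M\<close> are coarse majorants
  of several coefficients, chosen so that one number multiplies a whole norm.\<close>

definition Lp :: "real \<Rightarrow> 'a measure \<Rightarrow> ('a \<Rightarrow> 'b::euclidean_space) \<Rightarrow> bool" where
  "Lp p M f \<longleftrightarrow> f \<in> borel_measurable M \<and> integrable M (\<lambda>x. norm (f x) powr p)"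

text \<open>An arbitrary measure lets one set of inequalities serve \<open>lborel\<close> itself, on
  which the Riesz transforms act, and every restriction to a window, an annulus or the region where
  the derivatives of the cutoff live.\<close>

definition pnorm :: "real \<Rightarrow> 'a measure \<Rightarrow> ('a \<Rightarrow> 'b::euclidean_space) \<Rightarrow> real" where
  "pnorm p M f = (\<integral>x. norm (f x) powr p \<partial>M) powr (1 / p)"

lemma Lp_measurable [measurable_dest]: "Lp p M f \<Longrightarrow> f \<in> borel_measurable M"
  by (simp add: Lp_def)

lemma pnorm_nonneg [simp]: "0 \<le> pnorm p M f"
  by (simp add: pnorm_def)

lemma pnorm_powr: "0 < p \<Longrightarrow> pnorm p M f powr p = (\<integral>x. norm (f x) powr p \<partial>M)"
  by (simp add: pnorm_def powr_powr)

text \<open>Raise the pointwise bound to the power \<open>p\<close>, integrate, take the root. The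
  value types of \<open>f\<close> and \<open>g\<close> may differ because the bound is used to pass
  between scalars, vectors and matrices: matrix entries, cutoff multiples, matrix-vector
  products.\<close>

lemma Lp_dominated:
  fixes f :: "'a \<Rightarrow> 'b::euclidean_space" and g :: "'a \<Rightarrow> 'c::euclidean_space"
  assumes f: "Lp p M f" and g: "g \<in> borel_measurable M" and p: "0 < p" and C: "0 \<le> C"
    and le: "AE x in M. norm (g x) \<le> C * norm (f x)"
  shows "Lp p M g" and "pnorm p M g \<le> C * pnorm p M f"
proof -
  have if': "integrable M (\<lambda>x. C powr p * norm (f x) powr p)"
    using f by (simp add: Lp_def)
  have le': "AE x in M. norm (g x) powr p \<le> C powr p * norm (f x) powr p"
    using le
  proof eventually_elim
    case (elim x)
    then have "norm (g x) powr p \<le> (C * norm (f x)) powr p"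
      using p by (intro powr_mono2) auto
    then show ?case using C by (simp add: powr_mult)
  qed
  have ig: "integrable M (\<lambda>x. norm (g x) powr p)"
    by (rule Bochner_Integration.integrable_bound[OF if']) (use g le' in auto)
  then show "Lp p M g" using g by (simp add: Lp_def)
  have "(\<integral>x. norm (g x) powr p \<partial>M) \<le> (\<integral>x. C powr p * norm (f x) powr p \<partial>M)"
    by (intro integral_mono_AE ig if' le')
  then have "pnorm p M g \<le> (C powr p * (\<integral>x. norm (f x) powr p \<partial>M)) powr (1/p)"
    unfolding pnorm_def using p by (intro powr_mono2) auto
  also have "\<dots> = C * pnorm p M f"
    using C p by (simp add: powr_mult powr_powr pnorm_def)
  finally show "pnorm p M g \<le> C * pnorm p M f" .
qed

lemma pnorm_cong_AE:
  assumes "f \<in> borel_measurable M" "g \<in> borel_measurable M" "AE x in M. norm (f x) = norm (g x)"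
  shows "pnorm p M f = pnorm p M g"
proof -
  have "(\<integral>x. norm (f x) powr p \<partial>M) = (\<integral>x. norm (g x) powr p \<partial>M)"
    by (intro integral_cong_AE) (use assms in auto)
  then show ?thesis by (simp add: pnorm_def)
qed

lemma pnorm_eq_0_AE:
  assumes "Lp p M f" "0 < p" "pnorm p M f = 0"
  shows "AE x in M. f x = 0"
proof -
  have "(\<integral>x. norm (f x) powr p \<partial>M) = 0"
    using assms(2,3) by (auto simp: pnorm_def)
  then have "AE x in M. norm (f x) powr p = 0"
    by (subst (asm) integral_nonneg_eq_0_iff_AE) (use assms in \<open>auto simp: Lp_def\<close>)
  then show ?thesis by eventually_elim auto
qed

text \<open>Convexity of the power is applied to two positive points. If \<open>a\<close> or
  \<open>b\<close> vanishes, the claim becomes (t c)^p \<le> t c^p, which is t^p \<le> t on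
  [0, 1].\<close>

lemma convex_powr_sum:
  fixes a b s :: real
  assumes "1 \<le> p" "0 \<le> a" "0 \<le> b" "0 \<le> s" "s \<le> 1"
  shows "(s * a + (1 - s) * b) powr p \<le> s * a powr p + (1 - s) * b powr p"
proof -
  have *: "(t * c) powr p \<le> t * c powr p" if "0 \<le> t" "t \<le> 1" "0 \<le> c" for t c
    using that powr_le_one_le[of t p] assms(1)
    by (cases "t = 0") (auto simp: powr_mult intro!: mult_right_mono)
  show ?thesis
  proof (cases "a = 0 \<or> b = 0")
    case True
    then show ?thesis using *[of s a] *[of "1 - s" b] assms by auto
  next
    case False
    then show ?thesis
      using convex_onD[OF powr_convex[OF assms(1)], of "1 - s" a b] assms by (simp add: algebra_simps)
  qed
qed

text \<open>Minkowski's inequality from convexity of the \<open>p\<close>-th power. The functions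
  are normalised by strictly positive upper bounds \<open>a\<close>, \<open>b\<close> of their norms
  rather than by the norms, so that no division by zero occurs; the bounds are then let down to the
  norms.\<close>

lemma Lp_add:
  fixes f g :: "'a \<Rightarrow> 'b::euclidean_space"
  assumes f: "Lp p M f" and g: "Lp p M g" and p: "1 \<le> p"
  shows "Lp p M (\<lambda>x. f x + g x)" and "pnorm p M (\<lambda>x. f x + g x) \<le> pnorm p M f + pnorm p M g"
proof -
  note [measurable] = Lp_measurable[OF f] Lp_measurable[OF g]
  have key: "Lp p M (\<lambda>x. f x + g x) \<and> pnorm p M (\<lambda>x. f x + g x) \<le> a + b"
    if ab: "0 < a" "0 < b" "pnorm p M f \<le> a" "pnorm p M g \<le> b" for a b
  proof -
    \<comment> \<open>With this weight, |f| + |g| is \<open>a + b\<close> times the convex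
      combination of |f|/a and |g|/b.\<close>
    define s where "s = a / (a + b)"
    have s: "0 \<le> s" "s \<le> 1" "1 - s = b / (a + b)" using ab by (auto simp: s_def field_simps)
    have pw: "norm (f x + g x) powr p \<le>
        (a + b) powr p * (s * (norm (f x) powr p / a powr p) + (1 - s) * (norm (g x) powr p / b powr p))" for x
    proof -
      have "norm (f x + g x) \<le> (a + b) * (s * (norm (f x) / a) + (1 - s) * (norm (g x) / b))"
      proof -
        have "(a + b) * (s * (norm (f x) / a)) = norm (f x)" "(a + b) * ((1 - s) * (norm (g x) / b)) = norm (g x)"
          unfolding s(3) using ab by (simp_all add: s_def)
        then show ?thesis using norm_triangle_ineq[of "f x" "g x"] by (simp add: distrib_left)
      qed
      then have "norm (f x + g x) powr p \<le> ((a + b) * (s * (norm (f x) / a) + (1 - s) * (norm (g x) / b))) powr p"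
        using p by (intro powr_mono2) auto
      also have "\<dots> = (a + b) powr p * (s * (norm (f x) / a) + (1 - s) * (norm (g x) / b)) powr p"
        using ab s by (intro powr_mult) 
      also have "\<dots> \<le> (a + b) powr p * (s * (norm (f x) / a) powr p + (1 - s) * (norm (g x) / b) powr p)"
        using ab s p by (intro mult_left_mono convex_powr_sum) auto
      finally show ?thesis using ab by (simp add: powr_divide)
    qed
    let ?h = "\<lambda>x. (a + b) powr p * (s * (norm (f x) powr p / a powr p) + (1 - s) * (norm (g x) powr p / b powr p))"
    have ih: "integrable M ?h" using f g by (simp add: Lp_def)
    have i: "integrable M (\<lambda>x. norm (f x + g x) powr p)"
    proof (rule Bochner_Integration.integrable_bound[OF ih])
      show "AE x in M. norm (norm (f x + g x) powr p) \<le> norm (?h x)"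
        using order_trans[OF pw abs_ge_self] by (intro AE_I2) simp
    qed simp
    have fle: "(\<integral>x. norm (f x) powr p \<partial>M) / a powr p \<le> 1"
      using powr_mono2[OF _ _ ab(3), of p] p ab by (simp add: pnorm_powr)
    have gle: "(\<integral>x. norm (g x) powr p \<partial>M) / b powr p \<le> 1"
      using powr_mono2[OF _ _ ab(4), of p] p ab by (simp add: pnorm_powr)
    have "(\<integral>x. norm (f x + g x) powr p \<partial>M) \<le> (\<integral>x. ?h x \<partial>M)"
      by (intro integral_mono i ih pw)
    also have "\<dots> = (a + b) powr p * (s * ((\<integral>x. norm (f x) powr p \<partial>M) / a powr p) +
        (1 - s) * ((\<integral>x. norm (g x) powr p \<partial>M) / b powr p))"
      using f g by (simp add: Lp_def)
    also have "\<dots> \<le> (a + b) powr p * (s * 1 + (1 - s) * 1)"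
      using s by (intro mult_left_mono add_mono fle gle) auto
    finally have "(\<integral>x. norm (f x + g x) powr p \<partial>M) \<le> (a + b) powr p" by simp
    then have "pnorm p M (\<lambda>x. f x + g x) \<le> ((a + b) powr p) powr (1/p)"
      unfolding pnorm_def using p by (intro powr_mono2) auto
    then show ?thesis using i ab p by (simp add: Lp_def powr_powr)
  qed
  show "Lp p M (\<lambda>x. f x + g x)"
    using key[of "pnorm p M f + 1" "pnorm p M g + 1"] by (simp add: add_nonneg_pos)
  show "pnorm p M (\<lambda>x. f x + g x) \<le> pnorm p M f + pnorm p M g"
  proof (rule field_le_epsilon)
    fix e :: real assume "0 < e"
    then show "pnorm p M (\<lambda>x. f x + g x) \<le> pnorm p M f + pnorm p M g + e"
      using key[of "pnorm p M f + e/2" "pnorm p M g + e/2"] by (simp add: add_nonneg_pos)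
  qed
qed

lemma Lp_scaleR:
  assumes "Lp p M f" "0 < p"
  shows "Lp p M (\<lambda>x. c *\<^sub>R f x)" "pnorm p M (\<lambda>x. c *\<^sub>R f x) \<le> \<bar>c\<bar> * pnorm p M f"
  using Lp_dominated[OF assms(1), of "\<lambda>x. c *\<^sub>R f x" "\<bar>c\<bar>"] assms Lp_measurable[OF assms(1)] by auto

lemma Lp_diff:
  assumes f: "Lp p M f" and g: "Lp p M g" and p: "1 \<le> p"
  shows "Lp p M (\<lambda>x. f x - g x)" and "pnorm p M (\<lambda>x. f x - g x) \<le> pnorm p M f + pnorm p M g"
  using Lp_add[OF f Lp_scaleR(1)[OF g, of "-1"] p] Lp_scaleR(2)[OF g, of "-1"] p by auto

text \<open>Young's inequality for |f|/a and |g|/b, again with strictly positive upper bounds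
  \<open>a\<close>, \<open>b\<close> in place of the norms.\<close>

lemma Holder_Lp:
  fixes f :: "'a \<Rightarrow> 'b::euclidean_space" and g :: "'a \<Rightarrow> 'c::euclidean_space"
  assumes f: "Lp p M f" and g: "Lp q M g" and pq: "1 < p" "1 < q" "1/p + 1/q = 1"
  shows "integrable M (\<lambda>x. norm (f x) * norm (g x))"
    and "(\<integral>x. norm (f x) * norm (g x) \<partial>M) \<le> pnorm p M f * pnorm q M g"
proof -
  note [measurable] = Lp_measurable[OF f] Lp_measurable[OF g]
  have key: "integrable M (\<lambda>x. norm (f x) * norm (g x)) \<and> (\<integral>x. norm (f x) * norm (g x) \<partial>M) \<le> a * b"
    if ab: "0 < a" "0 < b" "pnorm p M f \<le> a" "pnorm q M g \<le> b" for a b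
  proof -
    let ?h = "\<lambda>x. a * b * (norm (f x) powr p / a powr p / p + norm (g x) powr q / b powr q / q)"
    have pw: "norm (f x) * norm (g x) \<le> ?h x" for x
    proof -
      have "norm (f x) / a * (norm (g x) / b) \<le> (norm (f x) / a) powr p / p + (norm (g x) / b) powr q / q"
        using ab pq by (intro Youngs_inequality) auto
      then have "a * b * (norm (f x) / a * (norm (g x) / b)) \<le> a * b * ((norm (f x) / a) powr p / p + (norm (g x) / b) powr q / q)"
        using ab by (intro mult_left_mono) auto
      then show ?thesis using ab by (simp add: powr_divide)
    qed
    have ih: "integrable M ?h" using f g by (simp add: Lp_def)
    have i: "integrable M (\<lambda>x. norm (f x) * norm (g x))"
      by (rule Bochner_Integration.integrable_bound[OF ih]) (auto intro!: AE_I2 order_trans[OF pw])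
    have fle: "(\<integral>x. norm (f x) powr p \<partial>M) / a powr p \<le> 1"
      using powr_mono2[OF _ _ ab(3), of p] pq ab by (simp add: pnorm_powr)
    have gle: "(\<integral>x. norm (g x) powr q \<partial>M) / b powr q \<le> 1"
      using powr_mono2[OF _ _ ab(4), of q] pq ab by (simp add: pnorm_powr)
    have "(\<integral>x. norm (f x) * norm (g x) \<partial>M) \<le> (\<integral>x. ?h x \<partial>M)"
      by (intro integral_mono i ih pw)
    also have "\<dots> = a * b * ((\<integral>x. norm (f x) powr p \<partial>M) / a powr p / p +
        (\<integral>x. norm (g x) powr q \<partial>M) / b powr q / q)"
      using f g by (simp add: Lp_def)
    also have "\<dots> \<le> a * b * (1 / p + 1 / q)"
      using ab pq by (intro mult_left_mono add_mono divide_right_mono fle gle) auto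
    finally show ?thesis using i pq by simp
  qed
  show "integrable M (\<lambda>x. norm (f x) * norm (g x))"
    using key[of "pnorm p M f + 1" "pnorm q M g + 1"] by (simp add: add_nonneg_pos)
  \<comment> \<open>The bounds enter as a product here, so the slack \<open>e\<close> is removed by
    continuity instead of being split additively.\<close>
  have "((\<lambda>e. (pnorm p M f + e) * (pnorm q M g + e)) \<longlongrightarrow> (pnorm p M f + 0) * (pnorm q M g + 0)) (at_right 0)"
    by (intro tendsto_intros)
  moreover have "eventually (\<lambda>e. (\<integral>x. norm (f x) * norm (g x) \<partial>M) \<le> (pnorm p M f + e) * (pnorm q M g + e)) (at_right 0)"
    unfolding eventually_at_right_field using key 
    by (intro exI[of _ 1]) (simp add: add_nonneg_pos)
  ultimately show "(\<integral>x. norm (f x) * norm (g x) \<partial>M) \<le> pnorm p M f * pnorm q M g"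
    using tendsto_lowerbound by fastforce
qed

text \<open>Hoelder with exponents 2 and 2, applied to |f|^p and |g|^p. For \<open>p = 3/2\<close>
  this sends two \<open>L^3\<close> factors to \<open>L^{3/2}\<close>. The product is represented by
  any measurable \<open>h\<close> it dominates, which covers tensors, squares, and a single factor
  multiplied by the constant 1.\<close>

lemma Lp_mult:
  fixes f :: "'a \<Rightarrow> 'b::euclidean_space" and g :: "'a \<Rightarrow> 'c::euclidean_space"
    and h :: "'a \<Rightarrow> 'd::euclidean_space"
  assumes f: "Lp (2 * p) M f" and g: "Lp (2 * p) M g" and p: "0 < p"
    and h: "h \<in> borel_measurable M" and le: "AE x in M. norm (h x) \<le> norm (f x) * norm (g x)"
  shows "Lp p M h" and "pnorm p M h \<le> pnorm (2 * p) M f * pnorm (2 * p) M g"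
proof -
  note [measurable] = Lp_measurable[OF f] Lp_measurable[OF g]
  let ?F = "\<lambda>x. norm (f x) powr p" and ?G = "\<lambda>x. norm (g x) powr p"
  have F: "Lp 2 M ?F" and G: "Lp 2 M ?G"
    using f g by (auto simp: Lp_def powr_powr mult.commute)
  note H = Holder_Lp[OF F G, simplified]
  have L: "Lp p M (\<lambda>x. norm (f x) * norm (g x))"
    using H(1) by (simp add: Lp_def powr_mult)
  have "pnorm p M (\<lambda>x. norm (f x) * norm (g x)) = (\<integral>x. ?F x * ?G x \<partial>M) powr (1/p)"
    by (simp add: pnorm_def powr_mult)
  also have "\<dots> \<le> (pnorm 2 M ?F * pnorm 2 M ?G) powr (1/p)"
    using H(2) p by (intro powr_mono2) auto
  also have "\<dots> = pnorm (2 * p) M f * pnorm (2 * p) M g"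
    using p by (simp add: pnorm_def powr_powr powr_mult mult.commute)
  finally have 1: "pnorm p M (\<lambda>x. norm (f x) * norm (g x)) \<le> pnorm (2 * p) M f * pnorm (2 * p) M g" .
  note D = Lp_dominated[OF L h p, of 1]
  show "Lp p M h" using D(1) le by simp
  show "pnorm p M h \<le> pnorm (2 * p) M f * pnorm (2 * p) M g" using D(2) le 1 by simp
qed

section \<open>Translation between spaces on a set and spaces over a restricted measure\<close>

lemma Lsp_iff:
  assumes "S \<in> sets borel"
  shows "Lsp p S f \<longleftrightarrow> Lp p (restrict_space lborel S) f"
  using assms by (simp add: Lsp_def Lp_def set_borel_measurable_def set_integrable_def
      borel_measurable_restrict_space_iff integrable_restrict_space)

lemma Lnorm_eq:
  assumes "S \<in> sets borel"
  shows "Lnorm p S f = pnorm p (restrict_space lborel S) f"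
  using assms by (simp add: Lnorm_def pnorm_def set_lebesgue_integral_def integral_restrict_space)

lemma ae_eq_iff:
  assumes "S \<in> sets borel"
  shows "ae_eq S f g \<longleftrightarrow> (AE x in restrict_space lborel S. f x = g x)"
  using assms by (simp add: ae_eq_def AE_restrict_space_iff)

section \<open>Linearity of the space-time Riesz transforms\<close>

lemma Lsp_UNIV: "Lsp p UNIV f \<longleftrightarrow> Lp p lborel f"
  by (simp add: Lsp_def Lp_def set_borel_measurable_def set_integrable_def)

lemma Lnorm_UNIV: "Lnorm p UNIV f = pnorm p lborel f"
  by (simp add: Lnorm_def pnorm_def set_lebesgue_integral_def)

lemma ae_eq_UNIV: "ae_eq UNIV f g \<longleftrightarrow> (AE x in lborel. f x = g x)"
  by (simp add: ae_eq_def)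

lemma ae_eq_trans: "ae_eq S f g \<Longrightarrow> ae_eq S g h \<Longrightarrow> ae_eq S f h"
  unfolding ae_eq_def by (elim eventually_elim2) auto

lemma ae_eq_sym: "ae_eq S f g \<Longrightarrow> ae_eq S g f"
  unfolding ae_eq_def by (erule eventually_mono) auto

lemma ae_eq_subset: "ae_eq S f g \<Longrightarrow> T \<subseteq> S \<Longrightarrow> ae_eq T f g"
  unfolding ae_eq_def by (erule eventually_mono) auto

lemma ae_eq_lincomb:
  fixes f g :: "'a::euclidean_space \<Rightarrow> real"
  shows "ae_eq S f f' \<Longrightarrow> ae_eq S g g' \<Longrightarrow> ae_eq S (\<lambda>x. a * f x + b * g x) (\<lambda>x. a * f' x + b * g' x)"
  unfolding ae_eq_def by (elim eventually_elim2) auto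

lemma ae_eq_sum:
  assumes "finite I" "\<And>i. i \<in> I \<Longrightarrow> ae_eq S (f i) (g i)"
  shows "ae_eq S (\<lambda>x. \<Sum>i\<in>I. f i x) (\<lambda>x. \<Sum>i\<in>I. g i x)"
proof -
  have "AE x in lborel. \<forall>i\<in>I. x \<in> S \<longrightarrow> f i x = g i x"
    using assms by (intro AE_finite_allI) (auto simp: ae_eq_def)
  then show ?thesis unfolding ae_eq_def by eventually_elim auto
qed

lemma riesz_lincomb:
  assumes "is_riesz j R" "Lsp (3/2) UNIV f" "Lsp (3/2) UNIV g"
  shows "ae_eq UNIV (R (\<lambda>x. a * f x + b * g x)) (\<lambda>x. a * R f x + b * R g x)"
  using assms unfolding is_riesz_def by blast

lemma riesz_Lsp: "is_riesz j R \<Longrightarrow> Lsp (3/2) UNIV f \<Longrightarrow> Lsp (3/2) UNIV (R f)"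
  unfolding is_riesz_def by blast

text \<open>\<open>is_riesz\<close> acts on representatives and does not state that null sets are
  ignored. This follows by feeding \<open>f - g\<close>, which has norm 0, into the bound and then
  using linearity.\<close>

lemma riesz_cong:
  assumes R: "is_riesz j R" and f: "Lsp (3/2) UNIV f" and g: "Lsp (3/2) UNIV g"
    and eq: "ae_eq UNIV f g"
  shows "ae_eq UNIV (R f) (R g)"
proof -
  let ?d = "\<lambda>x. 1 * f x + (-1) * g x"
  obtain C where C: "\<And>f. Lsp (3/2) UNIV f \<Longrightarrow> Lnorm (3/2) UNIV (R f) \<le> C * Lnorm (3/2) UNIV f"
    using R unfolding is_riesz_def by blast
  have d: "Lsp (3/2) UNIV ?d"
    using Lp_diff(1)[of "3/2" lborel f g] f g by (simp add: Lsp_UNIV)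
  have "pnorm (3/2) lborel ?d = pnorm (3/2) lborel (\<lambda>_::real^3. 0 :: real)"
  proof (rule pnorm_cong_AE)
    show "?d \<in> borel_measurable lborel" using d by (simp add: Lsp_UNIV Lp_def)
    show "AE x in lborel. norm (?d x) = norm (0 :: real)"
      using eq unfolding ae_eq_UNIV by eventually_elim simp
  qed simp
  then have "pnorm (3/2) lborel ?d = 0" by (simp add: pnorm_def)
  then have "pnorm (3/2) lborel (R ?d) = 0"
    using C[OF d] pnorm_nonneg[of "3/2" lborel "R ?d"] unfolding Lnorm_UNIV by (intro antisym) simp_all
  then have "AE x in lborel. R ?d x = 0"
    using riesz_Lsp[OF R d] by (intro pnorm_eq_0_AE[of "3/2"]) (auto simp: Lsp_UNIV)
  with riesz_lincomb[OF R f g, of 1 "-1"] show ?thesis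
    unfolding ae_eq_UNIV by eventually_elim simp
qed

section \<open>Fubini: time slices of functions, spaces and almost everywhere identities\<close>

lemma borel_measurable_slice:
  fixes h :: "'a::euclidean_space \<times> 'b::euclidean_space \<Rightarrow> 'c::topological_space"
  assumes "h \<in> borel_measurable lborel"
  shows "(\<lambda>x. h (x, t)) \<in> borel_measurable lborel"
proof -
  have "(\<lambda>x. (x, t)) \<in> borel_measurable borel"
    by (intro borel_measurable_continuous_onI continuous_intros)
  then show "(\<lambda>x. h (x, t)) \<in> borel_measurable lborel"
    using assms by (auto dest: measurable_compose[where N = borel and g = h])
qed

text \<open>Time is the second component of a point, but it must be quantified outermost, because
  the Riesz transforms act on space functions at almost every fixed time.\<close>

lemma AE_lborel_prod_swap:
  fixes P :: "'a::euclidean_space \<times> 'b::euclidean_space \<Rightarrow> bool"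
  assumes P: "{z. P z} \<in> sets borel"
  shows "(AE z in lborel. P z) \<longleftrightarrow> (AE t in lborel. AE x in lborel. P (x, t))"
proof -
  have P': "{x \<in> space (lborel \<Otimes>\<^sub>M lborel). P (fst x, snd x)} \<in> sets (lborel \<Otimes>\<^sub>M lborel)"
    unfolding lborel_prod using P by simp_all
  have "(AE z in lborel. P z) \<longleftrightarrow> (AE z in lborel \<Otimes>\<^sub>M lborel. P z)"
    by (simp only: lborel_prod)
  also have "\<dots> \<longleftrightarrow> (AE x in lborel. AE t in lborel. P (x, t))"
    using lborel_pair.AE_pair_iff[OF P'] by simp
  also have "\<dots> \<longleftrightarrow> (AE t in lborel. AE x in lborel. P (x, t))"
    using lborel_pair.AE_commute[OF P'] by simp
  finally show ?thesis .
qed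

lemma AE_integrable_slice:
  fixes h :: "'a::euclidean_space \<times> 'b::euclidean_space \<Rightarrow> real"
  assumes "integrable lborel h"
  shows "AE t in lborel. integrable lborel (\<lambda>x. h (x, t))"
proof -
  have "integrable (lborel \<Otimes>\<^sub>M lborel) (\<lambda>(t, x). h (x, t))"
    using lborel_pair.integrable_product_swap[of h] assms by (simp add: lborel_prod)
  from lborel_pair.AE_integrable_fst[OF this] show ?thesis by simp
qed

lemma set_borel_measurable_slice:
  fixes F :: "'a::euclidean_space \<times> 'b::euclidean_space \<Rightarrow> 'c::euclidean_space"
  assumes "set_borel_measurable lborel (A \<times> T) F" "t \<in> T"
  shows "set_borel_measurable lborel A (\<lambda>x. F (x, t))"
  using borel_measurable_slice[of "\<lambda>z. indicat_real (A \<times> T) z *\<^sub>R F z" t] assms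
  by (simp add: set_borel_measurable_def indicator_times)

lemma Lsp_slice:
  fixes F :: "'a::euclidean_space \<times> 'b::euclidean_space \<Rightarrow> 'c::euclidean_space"
  assumes "Lsp p (A \<times> T) F"
  shows "AE t in lborel. t \<in> T \<longrightarrow> Lsp p A (\<lambda>x. F (x, t))"
proof -
  have "AE t in lborel. integrable lborel (\<lambda>x. indicat_real (A \<times> T) (x, t) *\<^sub>R norm (F (x, t)) powr p)"
    using assms by (intro AE_integrable_slice) (simp add: Lsp_def set_integrable_def)
  then show ?thesis
  proof eventually_elim
    case (elim t)
    show ?case
    proof
      assume "t \<in> T"
      then show "Lsp p A (\<lambda>x. F (x, t))"
        using elim assms set_borel_measurable_slice[of A T F t]
        by (simp add: Lsp_def set_integrable_def indicator_times)
    qed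
  qed
qed

lemma ae_eq_slice_iff:
  fixes F G :: "'a::euclidean_space \<times> 'b::euclidean_space \<Rightarrow> 'c::euclidean_space"
  assumes "set_borel_measurable lborel (A \<times> T) F" "set_borel_measurable lborel (A \<times> T) G"
  shows "ae_eq (A \<times> T) F G \<longleftrightarrow>
    (AE t in lborel. t \<in> T \<longrightarrow> ae_eq A (\<lambda>x. F (x, t)) (\<lambda>x. G (x, t)))"
proof -
  \<comment> \<open>The zero set of \<open>h\<close> is exactly where the conditional equality
    holds, and it is Borel even though \<open>F\<close> and \<open>G\<close> are measurable only
    after multiplication by the indicator.\<close>
  define h where "h z = norm (indicat_real (A \<times> T) z *\<^sub>R F z - indicat_real (A \<times> T) z *\<^sub>R G z)" for z
  have "h \<in> borel_measurable borel"
    using assms unfolding h_def set_borel_measurable_def by simp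
  then have m: "{z. h z = 0} \<in> sets borel" by simp
  have iff: "h z = 0 \<longleftrightarrow> (z \<in> A \<times> T \<longrightarrow> F z = G z)" for z
    by (auto simp: h_def indicator_def)
  have "ae_eq (A \<times> T) F G \<longleftrightarrow> (AE t in lborel. AE x in lborel. (x, t) \<in> A \<times> T \<longrightarrow> F (x, t) = G (x, t))"
    unfolding ae_eq_def using AE_lborel_prod_swap[OF m] by (simp only: iff)
  also have "\<dots> \<longleftrightarrow> (AE t in lborel. t \<in> T \<longrightarrow> ae_eq A (\<lambda>x. F (x, t)) (\<lambda>x. G (x, t)))"
    unfolding ae_eq_def by (intro AE_cong) auto
  finally show ?thesis .
qed

lemma Lsp_lincomb:
  fixes f g :: "'a::euclidean_space \<Rightarrow> real"
  assumes "S \<in> sets borel" "Lsp p S f" "Lsp p S g" "1 \<le> p"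
  shows "Lsp p S (\<lambda>x. a * f x + b * g x)"
  using Lp_add(1)[OF Lp_scaleR(1) Lp_scaleR(1), of p _ f g a b] assms by (simp add: Lsp_iff)

lemma cyl_borel [measurable]: "A \<in> sets borel \<Longrightarrow> cyl A \<in> sets borel"
  by (intro borel_Times) auto

lemma riesz_st_Lsp:
  "is_riesz_st j Rt \<Longrightarrow> Lsp (3/2) (cyl UNIV) F \<Longrightarrow> Lsp (3/2) (cyl UNIV) (Rt F)"
  unfolding is_riesz_st_def by blast

text \<open>On almost every slice, \<open>riesz_cong\<close> replaces \<open>H\<close> by the linear
  combination and \<open>riesz_lincomb\<close> expands it. Allowing \<open>H\<close> to agree with
  the combination only almost everywhere makes the lemma composable: its conclusion is a premise of
  the same form for the next transform.\<close>

lemma riesz_st_lincomb: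
  assumes R: "is_riesz_st j Rt" and F: "Lsp (3/2) (cyl UNIV) F" and G: "Lsp (3/2) (cyl UNIV) G"
    and H: "Lsp (3/2) (cyl UNIV) H"
    and eq: "ae_eq (cyl UNIV) H (\<lambda>z. a * F z + b * G z)"
  shows "ae_eq (cyl UNIV) (Rt H) (\<lambda>z. a * Rt F z + b * Rt G z)"
proof -
  obtain R where Rj: "is_riesz j R" and Rt: "\<And>F. Lsp (3/2) (cyl UNIV) F \<Longrightarrow>
      (AE t in lborel. t \<in> win_time \<longrightarrow> ae_eq UNIV (\<lambda>x. Rt F (x, t)) (R (\<lambda>y. F (y, t))))"
    using R unfolding is_riesz_st_def by blast
  let ?L = "\<lambda>z. a * F z + b * G z"
  have cU: "cyl UNIV \<in> sets borel" by simp
  have L: "Lsp (3/2) (cyl UNIV) ?L" by (rule Lsp_lincomb[OF cU F G]) simp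
  have L': "Lsp (3/2) (cyl UNIV) (\<lambda>z. a * Rt F z + b * Rt G z)"
    by (rule Lsp_lincomb[OF cU riesz_st_Lsp[OF R F] riesz_st_Lsp[OF R G]]) simp
  have eqt: "AE t in lborel. t \<in> win_time \<longrightarrow> ae_eq UNIV (\<lambda>x. H (x, t)) (\<lambda>x. ?L (x, t))"
    using eq ae_eq_slice_iff[of UNIV win_time H ?L] H L by (auto simp: Lsp_def)
  have "AE t in lborel. t \<in> win_time \<longrightarrow>
      ae_eq UNIV (\<lambda>x. Rt H (x, t)) (\<lambda>x. a * Rt F (x, t) + b * Rt G (x, t))"
    using Rt[OF H] Rt[OF F] Rt[OF G] Lsp_slice[OF F] Lsp_slice[OF G] Lsp_slice[OF H] Lsp_slice[OF L] eqt
  proof eventually_elim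
    case (elim t)
    show ?case
    proof
      assume t: "t \<in> win_time"
      have "ae_eq UNIV (\<lambda>x. Rt H (x, t)) (R (\<lambda>y. H (y, t)))" using elim t by blast
      also have "ae_eq UNIV \<dots> (R (\<lambda>y. ?L (y, t)))"
        using elim t by (intro riesz_cong[OF Rj]) auto
      also (ae_eq_trans) have "ae_eq UNIV \<dots> (\<lambda>x. a * R (\<lambda>y. F (y, t)) x + b * R (\<lambda>y. G (y, t)) x)"
        using elim t by (intro riesz_lincomb[OF Rj]) auto
      also (ae_eq_trans) have "ae_eq UNIV \<dots> (\<lambda>x. a * Rt F (x, t) + b * Rt G (x, t))"
        using elim t by (intro ae_eq_lincomb) (auto intro: ae_eq_sym)
      finally (ae_eq_trans) show "ae_eq UNIV (\<lambda>x. Rt H (x, t)) (\<lambda>x. a * Rt F (x, t) + b * Rt G (x, t))" .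
    qed
  qed
  then show ?thesis
    using ae_eq_slice_iff[of UNIV win_time "Rt H"] L' riesz_st_Lsp[OF R H] by (auto simp: Lsp_def)
qed

section \<open>The double Riesz operator on matrix sources extended by zero\<close>

lemma Lsp_ext0:
  assumes "Lsp p S f" "S \<subseteq> T"
  shows "Lsp p T (ext0 S f)"
proof -
  have "indicat_real T x *\<^sub>R ext0 S f x = indicat_real S x *\<^sub>R f x"
    "indicat_real T x *\<^sub>R norm (ext0 S f x) powr p = indicat_real S x *\<^sub>R norm (f x) powr p" for x
    using assms(2) by (auto simp: ext0_def indicator_def)
  then show ?thesis using assms(1) by (simp add: Lsp_def set_borel_measurable_def set_integrable_def)
qed

lemma norm_entry_le: "norm ((A :: real^'n^'m) $ i $ j) \<le> norm A"
  using order_trans[OF Finite_Cartesian_Product.norm_nth_le Finite_Cartesian_Product.norm_nth_le] .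

lemma borel_measurable_vec_nth [measurable (raw)]:
  fixes f :: "'a \<Rightarrow> 'b::euclidean_space ^ 'n"
  assumes "f \<in> borel_measurable M" shows "(\<lambda>x. f x $ i) \<in> borel_measurable M"
  by (rule borel_measurable_continuous_on[OF _ assms, of "\<lambda>x. x $ i"]) (intro continuous_intros)

lemma Lsp_entry:
  fixes F :: "'a::euclidean_space \<Rightarrow> real^'n^'m"
  assumes "S \<in> sets borel" "Lsp p S F" "0 < p"
  shows "Lsp p S (\<lambda>z. F z $ i $ j)"
  using assms Lp_dominated(1)[of p "restrict_space lborel S" F "\<lambda>z. F z $ i $ j" 1]
  by (simp add: Lsp_iff norm_entry_le[simplified real_norm_def] Lp_measurable)

lemma RR_entry_Lsp:
  assumes "Xsrc F"
  shows "Lsp (3/2) (cyl UNIV) (ext0 Q1 (\<lambda>w. F w $ i $ j))"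
  by (intro Lsp_ext0 Lsp_entry assms) auto

lemma Lsp_sum:
  fixes f :: "'i \<Rightarrow> 'a::euclidean_space \<Rightarrow> 'b::euclidean_space"
  assumes "S \<in> sets borel" "1 \<le> p" "finite I" "\<And>i. i \<in> I \<Longrightarrow> Lsp p S (f i)"
  shows "Lsp p S (\<lambda>x. \<Sum>i\<in>I. f i x)"
  using assms(3,4)
proof (induction I rule: finite_induct)
  case empty
  then show ?case by (simp add: Lsp_def set_borel_measurable_def set_integrable_def)
next
  case (insert i I)
  then show ?case using assms(1,2) by (auto simp: Lsp_iff intro!: Lp_add(1))
qed

lemma RR_Lsp:
  assumes "\<And>j. is_riesz_st j (Rt j)" "Xsrc F"
  shows "Lsp (3/2) (cyl UNIV) (RR Rt F)"
proof -
  have "Lsp (3/2) (cyl UNIV) (Rt i (Rt j (ext0 Q1 (\<lambda>w. F w $ i $ j))))" for i j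
    by (rule riesz_st_Lsp[OF assms(1) riesz_st_Lsp[OF assms(1) RR_entry_Lsp[OF assms(2)]]])
  then show ?thesis unfolding RR_def by (intro Lsp_sum) auto
qed

text \<open>Entrywise, \<open>riesz_st_lincomb\<close> is applied twice, for the inner and the outer
  transform, with coefficients 1 and -1; the finite sum over entries preserves the almost everywhere
  identity.\<close>

lemma RR_diff:
  assumes R: "\<And>j. is_riesz_st j (Rt j)" and F: "Xsrc F" and G: "Xsrc G" and H: "Xsrc H"
    and eq: "ae_eq Q1 H (\<lambda>z. F z - G z)"
  shows "ae_eq (cyl UNIV) (RR Rt H) (\<lambda>z. RR Rt F z - RR Rt G z)"
proof -
  have "ae_eq (cyl UNIV) (ext0 Q1 (\<lambda>w. H w $ i $ j))
      (\<lambda>z. 1 * ext0 Q1 (\<lambda>w. F w $ i $ j) z + (-1) * ext0 Q1 (\<lambda>w. G w $ i $ j) z)" for i j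
    using eq unfolding ae_eq_def by eventually_elim (simp add: ext0_def)
  then have "ae_eq (cyl UNIV) (Rt i (Rt j (ext0 Q1 (\<lambda>w. H w $ i $ j))))
      (\<lambda>z. 1 * Rt i (Rt j (ext0 Q1 (\<lambda>w. F w $ i $ j))) z + (-1) * Rt i (Rt j (ext0 Q1 (\<lambda>w. G w $ i $ j))) z)" for i j
    by (rule riesz_st_lincomb[OF R riesz_st_Lsp[OF R RR_entry_Lsp[OF F]] riesz_st_Lsp[OF R RR_entry_Lsp[OF G]]
          riesz_st_Lsp[OF R RR_entry_Lsp[OF H]]
          riesz_st_lincomb[OF R RR_entry_Lsp[OF F] RR_entry_Lsp[OF G] RR_entry_Lsp[OF H]]])
  then have "ae_eq (cyl UNIV) (RR Rt H)
     (\<lambda>z. \<Sum>i\<in>UNIV. \<Sum>j\<in>UNIV. 1 * Rt i (Rt j (ext0 Q1 (\<lambda>w. F w $ i $ j))) z + (-1) * Rt i (Rt j (ext0 Q1 (\<lambda>w. G w $ i $ j))) z)"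
    unfolding RR_def by (intro ae_eq_sum) auto
  then show ?thesis by (simp add: RR_def sum_subtractf)
qed

section \<open>Negative Sobolev norms of integrable fields\<close>

lemma Lsp_subset:
  fixes f :: "'a::euclidean_space \<Rightarrow> 'b::euclidean_space"
  assumes f: "Lsp p T f" and "S \<subseteq> T" "S \<in> sets borel" "T \<in> sets borel"
  shows "Lsp p S f" and "0 < p \<Longrightarrow> Lnorm p S f \<le> Lnorm p T f"
proof -
  have m: "set_borel_measurable lborel S f"
    using f assms by (auto simp: Lsp_def intro: set_borel_measurable_subset)
  have i: "set_integrable lborel S (\<lambda>x. norm (f x) powr p)"
    using f assms by (auto simp: Lsp_def intro: set_integrable_subset)
  show "Lsp p S f" using m i by (simp add: Lsp_def)
  assume p: "0 < p"
  have "(LINT x:S|lborel. norm (f x) powr p) \<le> (LINT x:T|lborel. norm (f x) powr p)"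
    using i f assms(2) unfolding Lsp_def set_lebesgue_integral_def set_integrable_def
    by (intro integral_mono) (auto simp: indicator_def)
  then show "Lnorm p S f \<le> Lnorm p T f"
    unfolding Lnorm_def using p
    by (intro powr_mono2) (auto simp: set_lebesgue_integral_def intro!: integral_nonneg_AE)
qed

section \<open>Integrability of test functions and their derivatives\<close>

lemma Lp_bounded_compact_support:
  fixes g :: "'a::euclidean_space \<Rightarrow> 'b::euclidean_space"
  assumes "g \<in> borel_measurable borel" "compact C" "\<And>x. x \<notin> C \<Longrightarrow> g x = 0" "\<And>x. norm (g x) \<le> b" "0 < p"
  shows "Lp p lborel g"
proof (rule Lp_dominated(1))
  have "norm (indicat_real C x) powr p = indicat_real C x" for x
    by (simp add: indicator_def)
  then show "Lp p lborel (indicat_real C)"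
    using assms(2) emeasure_compact_finite[of C] by (simp add: Lp_def borel_compact borel_measurable_indicator)
  show "0 \<le> \<bar>b\<bar>" by simp
  show "AE x in lborel. norm (g x) \<le> \<bar>b\<bar> * norm (indicat_real C x)"
    using assms(3,4) by (intro AE_I2) (metis abs_ge_self abs_zero indicator_simps(1) indicator_simps(2) mult.right_neutral mult_zero_right norm_one norm_zero order_trans order_refl)
qed (use assms in simp_all)

lemma bounded_compact_support:
  fixes g :: "'a::euclidean_space \<Rightarrow> 'b::real_normed_vector"
  assumes "continuous_on UNIV g" "compact C" "\<And>x. x \<notin> C \<Longrightarrow> g x = 0"
  obtains b where "0 \<le> b" "\<And>x. norm (g x) \<le> b"
proof -
  have "bounded (g ` C)"
    using assms by (intro compact_imp_bounded compact_continuous_image) (auto intro: continuous_on_subset)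
  then obtain b where b: "0 < b" "\<And>y. y \<in> g ` C \<Longrightarrow> norm y \<le> b" unfolding bounded_pos by blast
  have "norm (g x) \<le> b" for x
    using b assms(3)[of x] by (cases "x \<in> C") auto
  then show thesis using that[of b] b by simp
qed

lemma Lp_continuous_compact_support:
  fixes g :: "'a::euclidean_space \<Rightarrow> 'b::euclidean_space"
  assumes "continuous_on UNIV g" "compact C" "\<And>x. x \<notin> C \<Longrightarrow> g x = 0" "0 < p"
  shows "Lp p lborel g"
proof -
  obtain b where "\<And>x. norm (g x) \<le> b" using bounded_compact_support[OF assms(1-3)] by metis
  then show ?thesis
    using assms by (intro Lp_bounded_compact_support[of g C b]) (auto intro: borel_measurable_continuous_onI)
qed

lemma frechet_derivative_outside_support:
  assumes "closed C" "\<And>x. x \<notin> C \<Longrightarrow> f x = 0" "x \<notin> C"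
  shows "frechet_derivative f (at x) = (\<lambda>_. 0)"
proof -
  have "(f has_derivative (\<lambda>_. 0)) (at x)"
    by (rule has_derivative_transform_within_open[of "\<lambda>_. 0" _ x UNIV "- C"]) (use assms in auto)
  then show ?thesis using frechet_derivative_at by metis
qed

lemma axis_one_Basis: "axis j (1::real) \<in> (Basis :: (real^'n) set)"
  by (simp add: axis_in_Basis_iff)

lemma Ck_continuous: "Ck k f \<Longrightarrow> continuous_on UNIV f"
  by (cases k) (auto simp: continuous_on_eq_continuous_at intro: differentiable_imp_continuous_within)

lemma test_funD:
  assumes "test_fun S f"
  obtains C where "compact C" "C \<subseteq> S" "\<And>x. x \<notin> C \<Longrightarrow> f x = 0"
    "continuous_on UNIV f" "\<And>x. f differentiable (at x)"
    "\<And>b. b \<in> Basis \<Longrightarrow> continuous_on UNIV (\<lambda>x. frechet_derivative f (at x) b)"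
proof -
  have "Ck (Suc 0) f" using assms by (simp only: test_fun_def smooth_def)
  then show ?thesis using assms that Ck_continuous[of "Suc 0" f] unfolding test_fun_def by auto
qed

lemma Ck_pd: "Ck (Suc k) f \<Longrightarrow> Ck k (pd j f)"
  by (simp add: pd_def[abs_def] axis_one_Basis)

lemma jac_eq: "jac \<phi> x = (\<chi> i j. frechet_derivative \<phi> (at x) (axis j 1) $ i)"
  by (simp add: jac_def matrix_def)

lemma test_fun_Lp:
  fixes \<phi> :: "real^3 \<Rightarrow> real^3"
  assumes "test_fun B \<phi>" "0 < q"
  shows "Lp q lborel \<phi>" "Lp q lborel (jac \<phi>)"
proof -
  obtain C where C: "compact C" "C \<subseteq> B" "\<And>x. x \<notin> C \<Longrightarrow> \<phi> x = 0"
    "continuous_on UNIV \<phi>" "\<And>b. b \<in> Basis \<Longrightarrow> continuous_on UNIV (\<lambda>x. frechet_derivative \<phi> (at x) b)"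
    using test_funD[OF assms(1)] by metis
  show "Lp q lborel \<phi>" by (rule Lp_continuous_compact_support[OF C(4,1,3) assms(2)])
  have "continuous_on UNIV (jac \<phi>)"
    unfolding jac_eq[abs_def] by (intro continuous_intros C(5) axis_one_Basis)
  moreover have "jac \<phi> x = 0" if "x \<notin> C" for x
    using frechet_derivative_outside_support[of C \<phi> x] C that
    by (simp add: jac_eq compact_imp_closed vec_eq_iff)
  ultimately show "Lp q lborel (jac \<phi>)"
    using C assms(2) by (intro Lp_continuous_compact_support[of "jac \<phi>" C]) auto
qed

lemma test_fun_Lsp:
  fixes \<phi> :: "real^3 \<Rightarrow> real^3"
  assumes "test_fun B \<phi>" "0 < q" "B \<in> sets borel"
  shows "Lsp q B \<phi>" "Lnorm q B \<phi> \<le> W1norm q B \<phi>"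
proof -
  have 1: "Lsp q B \<phi>" "Lsp q B (jac \<phi>)"
    using test_fun_Lp[OF assms(1,2)] assms(3) by (auto simp flip: Lsp_UNIV intro: Lsp_subset)
  then show "Lsp q B \<phi>" by simp
  have "(LINT x:B|lborel. norm (\<phi> x) powr q) \<le> (LINT x:B|lborel. norm (\<phi> x) powr q + norm (jac \<phi> x) powr q)"
    using 1 by (intro set_integral_mono set_integral_add) (auto simp: Lsp_def)
  then show "Lnorm q B \<phi> \<le> W1norm q B \<phi>"
    unfolding Lnorm_def W1norm_def using assms(2)
    by (intro powr_mono2) (auto simp: set_lebesgue_integral_def intro!: integral_nonneg_AE)
qed

lemma Lnorm_nonneg [simp]: "0 \<le> Lnorm p S f"
  by (simp add: Lnorm_def)

lemma Lsp_Holder: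
  fixes f g :: "'a::euclidean_space \<Rightarrow> 'b::euclidean_space"
  assumes f: "Lsp p S f" and g: "Lsp q S g" and pq: "1 < p" "1 < q" "1/p + 1/q = 1" and S: "S \<in> sets borel"
  shows "set_integrable lborel S (\<lambda>x. f x \<bullet> g x)"
    "\<bar>LINT x:S|lborel. f x \<bullet> g x\<bar> \<le> Lnorm p S f * Lnorm q S g"
proof -
  let ?M = "restrict_space lborel S"
  note H = Holder_Lp[OF f[unfolded Lsp_iff[OF S]] g[unfolded Lsp_iff[OF S]] pq]
  have [measurable]: "f \<in> borel_measurable ?M" "g \<in> borel_measurable ?M"
    using f g by (auto simp: Lsp_iff[OF S] Lp_def)
  have i: "integrable ?M (\<lambda>x. f x \<bullet> g x)"
    by (rule Bochner_Integration.integrable_bound[OF H(1)]) (auto intro: Cauchy_Schwarz_ineq2)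
  then show "set_integrable lborel S (\<lambda>x. f x \<bullet> g x)"
    using S by (simp add: set_integrable_def integrable_restrict_space)
  have "(LINT x:S|lborel. f x \<bullet> g x) = (\<integral>x. f x \<bullet> g x \<partial>?M)"
    using S by (simp add: set_lebesgue_integral_def integral_restrict_space)
  moreover have "\<bar>\<integral>x. f x \<bullet> g x \<partial>?M\<bar> \<le> (\<integral>x. norm (f x) * norm (g x) \<partial>?M)"
    by (rule order_trans[OF integral_abs_bound integral_mono]) (use i H(1) in \<open>auto intro: Cauchy_Schwarz_ineq2\<close>)
  ultimately show "\<bar>LINT x:S|lborel. f x \<bullet> g x\<bar> \<le> Lnorm p S f * Lnorm q S g"
    using H(2) by (simp add: Lnorm_eq[OF S])
qed

text \<open>Hoelder against the test function, followed by the passage from its \<open>L^q\<close>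
  norm to the larger \<open>W1norm\<close>. The dual norm is a real supremum, so its bounds also
  require a nonempty and bounded family.\<close>

lemma dual_of_Lsp:
  fixes g :: "real^3 \<Rightarrow> real^3"
  assumes g: "Lsp p B g" and pq: "1 < p" "1 < q" "1/p + 1/q = 1" and B: "B \<in> sets borel"
  defines "T \<equiv> \<lambda>\<phi>. LINT x:B|lborel. g x \<bullet> \<phi> x"
  shows "dual_sp q B T" "dual_norm q B T \<le> Lnorm p B g" "0 \<le> dual_norm q B T"
proof -
  have i: "set_integrable lborel B (\<lambda>x. g x \<bullet> \<phi> x)" if "test_fun B \<phi>" for \<phi>
    using Lsp_Holder(1)[OF g test_fun_Lsp(1)[OF that _ B] pq B] pq by simp
  have le: "\<bar>T \<phi>\<bar> \<le> Lnorm p B g * W1norm q B \<phi>" if "test_fun B \<phi>" for \<phi>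
  proof -
    have "\<bar>T \<phi>\<bar> \<le> Lnorm p B g * Lnorm q B \<phi>"
      unfolding T_def using Lsp_Holder(2)[OF g test_fun_Lsp(1)[OF that _ B] pq B] pq by simp
    also have "\<dots> \<le> Lnorm p B g * W1norm q B \<phi>"
      using test_fun_Lsp(2)[OF that _ B, of q] pq by (intro mult_left_mono) auto
    finally show ?thesis .
  qed
  have "T (\<lambda>x. a *\<^sub>R \<phi> x + b *\<^sub>R \<psi> x) = a * T \<phi> + b * T \<psi>" if "test_fun B \<phi>" "test_fun B \<psi>" for \<phi> \<psi> a b
    using i[OF that(1)] i[OF that(2)] unfolding T_def by (simp add: inner_add_right)
  then show "dual_sp q B T"
    unfolding dual_sp_def using le by blast
  let ?F = "{\<phi>. test_fun B \<phi> \<and> W1norm q B \<phi> \<le> 1}"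
  have Ck0: "Ck k (\<lambda>_::real^3. 0 :: real^3)" for k
    by (induction k) auto
  \<comment> \<open>The zero test function makes the family nonempty and later witnesses that the
    supremum is nonnegative.\<close>
  have z: "(\<lambda>_. 0) \<in> ?F"
  proof -
    have "jac (\<lambda>_. 0) x = 0" for x by (simp add: jac_eq vec_eq_iff)
    then show ?thesis using Ck0 pq by (auto simp: test_fun_def smooth_def W1norm_def intro!: exI[of _ "{}"])
  qed
  have le1: "\<bar>T \<phi>\<bar> \<le> Lnorm p B g" if "\<phi> \<in> ?F" for \<phi>
    using le[of \<phi>] that mult_left_mono[of "W1norm q B \<phi>" 1 "Lnorm p B g"] by auto
  show "dual_norm q B T \<le> Lnorm p B g"
    unfolding dual_norm_def using z le1 by (intro cSUP_least) auto
  have "\<bar>T (\<lambda>_. 0)\<bar> \<le> dual_norm q B T"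
    unfolding dual_norm_def using z le1 by (intro cSUP_upper bdd_aboveI2) auto
  then show "0 \<le> dual_norm q B T" by linarith
qed

text \<open>On almost every slice the dual norm is at most the spatial \<open>L^p\<close> norm,
  whose \<open>p\<close>-th power is a spatial integral; Tonelli assembles these into the space-time
  norm.\<close>

lemma Ldual_of_Lsp:
  fixes g :: "(real^3) field"
  assumes g: "Lsp p (cyl B) g" and pq: "1 < p" "1 < q" "1/p + 1/q = 1" and B: "B \<in> sets borel"
  defines "f \<equiv> \<lambda>t \<phi>. LINT x:B|lborel. g (x, t) \<bullet> \<phi> x"
  shows "Ldual_sp p q B f" "Ldual_norm p q B f \<le> Lnorm p (cyl B) g"
proof -
  note cB = cyl_borel[OF B]
  let ?g = "\<lambda>z. indicat_real (cyl B) z *\<^sub>R g z"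
  have gm: "?g \<in> borel_measurable borel"
    using g by (simp add: Lsp_def set_borel_measurable_def)
  have meas: "set_borel_measurable lborel win_time (\<lambda>t. f t \<phi>)" if "test_fun B \<phi>" for \<phi>
  proof -
    have \<phi>m: "\<phi> \<in> borel_measurable borel"
      using test_funD[OF that] by (metis borel_measurable_continuous_onI)
    \<comment> \<open>Time is put first because measurability of a parametric integral is stated for
      integration over the second component; the indicator inside \<open>?g\<close> makes it Borel
      on the whole space.\<close>
    have "(\<lambda>(t, x). ?g (x, t) \<bullet> \<phi> x) \<in> borel_measurable (lborel \<Otimes>\<^sub>M lborel)"
    proof -
      have "(\<lambda>z. (snd z, fst z)) \<in> (borel :: (real \<times> (real^3)) measure) \<rightarrow>\<^sub>M borel"
        by (intro borel_measurable_continuous_onI continuous_intros)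
      from measurable_compose[OF this gm]
      have "(\<lambda>z. ?g (snd z, fst z)) \<in> borel_measurable borel" .
      moreover have "(\<lambda>z::real \<times> (real^3). \<phi> (snd z)) \<in> borel_measurable borel"
        by (rule measurable_compose[OF _ \<phi>m]) (intro borel_measurable_continuous_onI continuous_intros)
      ultimately have "(\<lambda>z. ?g (snd z, fst z) \<bullet> \<phi> (snd z)) \<in> borel_measurable (borel :: (real \<times> (real^3)) measure)"
        by (rule borel_measurable_inner)
      then show ?thesis unfolding lborel_prod by (simp add: case_prod_beta')
    qed
    then have "(\<lambda>t. \<integral>x. ?g (x, t) \<bullet> \<phi> x \<partial>lborel) \<in> borel_measurable lborel"
      by (rule sigma_finite_measure.borel_measurable_lebesgue_integral[OF lborel.sigma_finite_measure_axioms])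
    moreover have "(\<integral>x. ?g (x, t) \<bullet> \<phi> x \<partial>lborel) = indicat_real win_time t *\<^sub>R f t \<phi>" for t
      unfolding f_def set_lebesgue_integral_def by (cases "t \<in> win_time") (auto simp: indicator_times)
    ultimately show ?thesis by (simp add: set_borel_measurable_def)
  qed
  have slice: "AE t in lborel. t \<in> win_time \<longrightarrow> Lsp p B (\<lambda>x. g (x, t))"
    using Lsp_slice[OF g] .
  have d: "AE t in lborel. t \<in> win_time \<longrightarrow> dual_sp q B (f t)"
    using slice by eventually_elim (auto simp: f_def intro: dual_of_Lsp(1)[OF _ pq B])
  define H where "H z = indicat_real (cyl B) z *\<^sub>R norm (g z) powr p" for z
  have H: "integrable lborel H" using g by (simp add: Lsp_def set_integrable_def H_def[abs_def])
  have H0: "0 \<le> H z" for z by (simp add: H_def)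
  have "Ldual_int p q B f \<le> (\<integral>\<^sup>+t. \<integral>\<^sup>+x. ennreal (H (x, t)) \<partial>lborel \<partial>lborel)"
    unfolding Ldual_int_def
  \<comment> \<open>Monotonicity of the nonnegative integral accepts any integrands, so the
    comparison can be made although the dual norm has not been shown measurable in
    \<open>t\<close>.\<close>
  proof (rule nn_integral_mono_AE)
    show "AE t in lborel. ennreal (dual_norm q B (f t) powr p) * indicator win_time t
        \<le> (\<integral>\<^sup>+x. ennreal (H (x, t)) \<partial>lborel)"
      using slice AE_integrable_slice[OF H]
    proof eventually_elim
      case (elim t)
      show ?case
      proof (cases "t \<in> win_time")
        case True
        have L: "Lsp p B (\<lambda>x. g (x, t))" using elim True by blast
        have "dual_norm q B (f t) powr p \<le> Lnorm p B (\<lambda>x. g (x, t)) powr p"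
          unfolding f_def using dual_of_Lsp(2,3)[OF L pq B] pq by (intro powr_mono2) auto
        also have "\<dots> = (\<integral>x. H (x, t) \<partial>lborel)"
          using pq True unfolding Lnorm_def
          by (simp add: powr_powr set_lebesgue_integral_def H_def indicator_times)
        finally have "ennreal (dual_norm q B (f t) powr p) \<le> ennreal (\<integral>x. H (x, t) \<partial>lborel)"
          by (rule ennreal_leI)
        also have "\<dots> = (\<integral>\<^sup>+x. ennreal (H (x, t)) \<partial>lborel)"
          using elim H0 by (intro nn_integral_eq_integral[symmetric]) auto
        finally show ?thesis using True by simp
      qed simp
    qed
  qed
  also have "\<dots> = (\<integral>\<^sup>+z. ennreal (H z) \<partial>(lborel \<Otimes>\<^sub>M lborel))"
    using borel_measurable_integrable[OF H] by (intro lborel_pair.nn_integral_snd) (simp add: lborel_prod)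
  also have "\<dots> = ennreal (\<integral>z. H z \<partial>lborel)"
    unfolding lborel_prod using H H0 by (intro nn_integral_eq_integral) auto
  finally have int: "Ldual_int p q B f \<le> ennreal (\<integral>z. H z \<partial>lborel)" .
  then have fin: "Ldual_int p q B f < \<infinity>"
    using le_less_trans by fastforce
  show "Ldual_sp p q B f" unfolding Ldual_sp_def using meas d fin by blast
  have "enn2real (Ldual_int p q B f) \<le> (\<integral>z. H z \<partial>lborel)"
    using enn2real_mono[OF int] Bochner_Integration.integral_nonneg[of lborel H] H0 by simp
  then have "Ldual_norm p q B f \<le> (\<integral>z. H z \<partial>lborel) powr (1/p)"
    unfolding Ldual_norm_def using pq by (intro powr_mono2) auto
  then show "Ldual_norm p q B f \<le> Lnorm p (cyl B) g"
    by (simp add: Lnorm_def set_lebesgue_integral_def H_def)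
qed

text \<open>The functionals of integration against \<open>g1\<close> and \<open>g2\<close> form one
  admissible decomposition, and the infimum is bounded below by 0. Test functions lie in
  \<open>L^2\<close> and \<open>L^3\<close>, the exponents conjugate to 2 and 3/2, so the integral
  against \<open>g\<close> splits on almost every slice.\<close>

lemma sum_norm_le:
  fixes g1 g2 :: "(real^3) field"
  assumes g1: "Lsp 2 (cyl B) g1" and g2: "Lsp (3/2) (cyl B) g2" and B: "B \<in> sets borel"
    and eq: "\<And>z. z \<in> cyl B \<Longrightarrow> g z = g1 z + g2 z"
  shows "sum_norm B g \<le> Lnorm 2 (cyl B) g1 + Lnorm (3/2) (cyl B) g2"
proof -
  let ?f1 = "\<lambda>t \<phi>. LINT x:B|lborel. g1 (x, t) \<bullet> \<phi> x"
  let ?f2 = "\<lambda>t \<phi>. LINT x:B|lborel. g2 (x, t) \<bullet> \<phi> x"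
  have "AE t in lborel. t \<in> win_time \<longrightarrow> (\<forall>\<phi>. test_fun B \<phi> \<longrightarrow>
        (LINT x:B|lborel. g (x, t) \<bullet> \<phi> x) = ?f1 t \<phi> + ?f2 t \<phi>)"
    using Lsp_slice[OF g1] Lsp_slice[OF g2]
  proof eventually_elim
    case (elim t)
    show ?case
    proof (intro impI allI)
      fix \<phi> :: "real^3 \<Rightarrow> real^3" assume t: "t \<in> win_time" and \<phi>: "test_fun B \<phi>"
      have i: "set_integrable lborel B (\<lambda>x. g1 (x, t) \<bullet> \<phi> x)" "set_integrable lborel B (\<lambda>x. g2 (x, t) \<bullet> \<phi> x)"
        using elim t Lsp_Holder(1)[OF _ test_fun_Lsp(1)[OF \<phi> _ B, of 2] _ _ _ B, of 2]
          Lsp_Holder(1)[OF _ test_fun_Lsp(1)[OF \<phi> _ B, of 3] _ _ _ B, of "3/2"] by auto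
      have "(LINT x:B|lborel. g (x, t) \<bullet> \<phi> x) = (LINT x:B|lborel. g1 (x, t) \<bullet> \<phi> x + g2 (x, t) \<bullet> \<phi> x)"
        using B eq t by (intro set_lebesgue_integral_cong) (auto simp: inner_add_left)
      also have "\<dots> = ?f1 t \<phi> + ?f2 t \<phi>" by (rule set_integral_add(2)[OF i])
      finally show "(LINT x:B|lborel. g (x, t) \<bullet> \<phi> x) = ?f1 t \<phi> + ?f2 t \<phi>" .
    qed
  qed
  moreover have "Ldual_sp 2 2 B ?f1" "Ldual_sp (3/2) 3 B ?f2"
    using Ldual_of_Lsp(1)[OF g1 _ _ _ B, of 2] Ldual_of_Lsp(1)[OF g2 _ _ _ B, of 3] by auto
  ultimately have "sum_norm B g \<le> Ldual_norm 2 2 B ?f1 + Ldual_norm (3/2) 3 B ?f2"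
    unfolding sum_norm_def
    by (intro cInf_lower) (auto intro!: bdd_belowI[of _ 0] simp: Ldual_norm_def)
  also have "\<dots> \<le> Lnorm 2 (cyl B) g1 + Lnorm (3/2) (cyl B) g2"
    using Ldual_of_Lsp(2)[OF g1 _ _ _ B, of 2] Ldual_of_Lsp(2)[OF g2 _ _ _ B, of 3]
    by (intro add_mono) auto
  finally show ?thesis .
qed

section \<open>The pressure-source residual\<close>

lemma Lsp_diff:
  assumes "S \<in> sets borel" "1 \<le> p" "Lsp p S f" "Lsp p S g"
  shows "Lsp p S (\<lambda>x. f x - g x)" "Lnorm p S (\<lambda>x. f x - g x) \<le> Lnorm p S f + Lnorm p S g"
  using Lp_diff[of p "restrict_space lborel S" f g] assms by (auto simp: Lsp_iff Lnorm_eq)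

lemma Lsp_add:
  assumes "S \<in> sets borel" "1 \<le> p" "Lsp p S f" "Lsp p S g"
  shows "Lsp p S (\<lambda>x. f x + g x)" "Lnorm p S (\<lambda>x. f x + g x) \<le> Lnorm p S f + Lnorm p S g"
  using Lp_add[of p "restrict_space lborel S" f g] assms by (auto simp: Lsp_iff Lnorm_eq)

lemma Lnorm_cong_ae:
  assumes "S \<in> sets borel" "Lsp p S f" "Lsp p S g" "ae_eq S f g"
  shows "Lnorm p S f = Lnorm p S g"
  unfolding Lnorm_eq[OF assms(1)]
proof (rule pnorm_cong_AE)
  show "AE x in restrict_space lborel S. norm (f x) = norm (g x)"
    using assms(4) unfolding ae_eq_iff[OF assms(1)] by eventually_elim simp
qed (use assms in \<open>auto simp: Lsp_iff Lp_def\<close>)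

lemma Lnorm_cong:
  assumes "S \<in> sets borel" "\<And>x. x \<in> S \<Longrightarrow> f x = g x"
  shows "Lnorm p S f = Lnorm p S g"
  unfolding Lnorm_def using assms
  by (intro arg_cong2[where f = "(powr)"] set_lebesgue_integral_cong) auto

text \<open>Used to exchange a full cylinder for the annulus, where \<open>\<eta> - 1\<close> can be
  nonzero, or for the region carrying the derivatives of the cutoff.\<close>

lemma Lsp_support:
  assumes "S \<subseteq> T" "\<And>x. x \<in> T - S \<Longrightarrow> f x = 0"
  shows "Lsp p T f \<longleftrightarrow> Lsp p S f" "Lnorm p T f = Lnorm p S f"
proof -
  have *: "indicat_real T x *\<^sub>R f x = indicat_real S x *\<^sub>R f x"
    "indicat_real T x *\<^sub>R norm (f x) powr p = indicat_real S x *\<^sub>R norm (f x) powr p" for x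
    using assms by (auto simp: indicator_def)
  show "Lsp p T f \<longleftrightarrow> Lsp p S f" "Lnorm p T f = Lnorm p S f"
    unfolding Lsp_def Lnorm_def set_borel_measurable_def set_integrable_def set_lebesgue_integral_def *
    by simp_all
qed

section \<open>Norms and measurability of tensor products, matrix actions and cutoff
  multiples\<close>

lemma norm_outer: "norm (outer a b) = norm a * norm b"
proof -
  have "norm (outer a b $ i) = \<bar>a $ i\<bar> * norm b" for i
  proof -
    have "outer a b $ i = a $ i *\<^sub>R b" by (simp add: outer_def vec_eq_iff)
    then show ?thesis by simp
  qed
  then have "norm (outer a b) = L2_set (\<lambda>i. \<bar>a $ i\<bar> * norm b) UNIV" by (simp add: norm_vec_def)
  also have "\<dots> = L2_set (\<lambda>i. \<bar>a $ i\<bar>) UNIV * norm b" by (simp add: L2_set_left_distrib)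
  finally show ?thesis by (simp add: norm_vec_def)
qed

lemma norm_matrix_vector_le: "norm (A *v x) \<le> norm (A :: real^3^3) * norm x"
proof -
  have "norm ((A *v x) $ i) \<le> norm (A $ i) * norm x" for i
  proof -
    have "(A *v x) $ i = A $ i \<bullet> x" by (simp add: matrix_vector_mult_def inner_vec_def)
    then show ?thesis by (simp add: Cauchy_Schwarz_ineq2)
  qed
  then have "norm (A *v x) \<le> L2_set (\<lambda>i. norm (A $ i) * norm x) UNIV"
    unfolding norm_vec_def[of "A *v x"] by (intro L2_set_mono) auto
  also have "\<dots> = norm A * norm x" by (simp add: L2_set_left_distrib norm_vec_def)
  finally show ?thesis .
qed

lemma norm_outer_diff_le: "norm (outer a a - outer b b) \<le> (norm a + norm b) * norm (a - b)"
proof -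
  have "outer a a - outer b b = outer (a - b) a + outer b (a - b)"
    by (simp add: outer_def vec_eq_iff algebra_simps)
  then have "norm (outer a a - outer b b) \<le> norm (outer (a - b) a) + norm (outer b (a - b))"
    by (simp add: norm_triangle_ineq)
  then show ?thesis by (simp add: norm_outer algebra_simps)
qed

lemma borel_measurable_outer [measurable]:
  assumes "f \<in> borel_measurable M" "g \<in> borel_measurable M"
  shows "(\<lambda>x. outer (f x) (g x)) \<in> borel_measurable M"
  unfolding outer_def
  by (rule borel_measurable_continuous_Pair[OF assms]) (intro continuous_intros)

lemma borel_measurable_matrix_vector [measurable]:
  fixes f :: "'a \<Rightarrow> real^3^3"
  assumes "f \<in> borel_measurable M" "g \<in> borel_measurable M"
  shows "(\<lambda>x. f x *v g x) \<in> borel_measurable M"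
  unfolding matrix_vector_mult_def
  by (rule borel_measurable_continuous_Pair[OF assms]) (intro continuous_intros)

lemma borel_measurable_fst_cyl:
  fixes h :: "real^3 \<Rightarrow> 'b::topological_space"
  assumes "h \<in> borel_measurable borel"
  shows "(\<lambda>z. h (fst z)) \<in> borel_measurable (restrict_space (lborel :: ((real^3) \<times> real) measure) S)"
proof -
  have "(fst :: (real^3) \<times> real \<Rightarrow> _) \<in> borel_measurable borel"
    by (intro borel_measurable_continuous_onI continuous_intros)
  from measurable_compose[OF this assms] show ?thesis
    by (intro measurable_restrict_space1) simp
qed

text \<open>Only the absolute value of the factor is bounded, so that the lemma covers
  \<open>\<eta> - 1\<close> as well as \<open>\<eta>\<close>.\<close>

lemma Lsp_cutoff:
  fixes F :: "'b::euclidean_space field" and \<eta> :: "real^3 \<Rightarrow> real"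
  assumes S: "S \<in> sets borel" and F: "Lsp p S F" and p: "0 < p"
    and \<eta>: "\<eta> \<in> borel_measurable borel" "\<And>x. \<bar>\<eta> x\<bar> \<le> 1"
  shows "Lsp p S (\<lambda>z. \<eta> (fst z) *\<^sub>R F z)" "Lnorm p S (\<lambda>z. \<eta> (fst z) *\<^sub>R F z) \<le> Lnorm p S F"
proof -
  have 1: "(\<lambda>z. \<eta> (fst z) *\<^sub>R F z) \<in> borel_measurable (restrict_space lborel S)"
    using F borel_measurable_fst_cyl[OF \<eta>(1)] by (intro borel_measurable_scaleR) (auto simp: Lsp_iff[OF S] Lp_def)
  have 2: "AE z in restrict_space lborel S. norm (\<eta> (fst z) *\<^sub>R F z) \<le> 1 * norm (F z)"
    using \<eta>(2) by (intro AE_I2) (simp add: mult_left_le_one_le)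
  show "Lsp p S (\<lambda>z. \<eta> (fst z) *\<^sub>R F z)" "Lnorm p S (\<lambda>z. \<eta> (fst z) *\<^sub>R F z) \<le> Lnorm p S F"
    using Lp_dominated[OF F[unfolded Lsp_iff[OF S]] 1 p _ 2] by (auto simp: Lsp_iff[OF S] Lnorm_eq[OF S])
qed

lemma Lsp_outer:
  assumes S: "S \<in> sets borel" and u: "Lsp 3 S u"
  shows "Lsp (3/2) S (\<lambda>z. outer (u z) (u z))" "Lnorm (3/2) S (\<lambda>z. outer (u z) (u z)) \<le> Lnorm 3 S u * Lnorm 3 S u"
proof -
  have m: "(\<lambda>z. outer (u z) (u z)) \<in> borel_measurable (restrict_space lborel S)"
    using u by (intro borel_measurable_outer) (auto simp: Lsp_iff[OF S] Lp_def)
  have u': "Lp (2 * (3/2)) (restrict_space lborel S) u" using u by (simp add: Lsp_iff[OF S])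
  show "Lsp (3/2) S (\<lambda>z. outer (u z) (u z))" "Lnorm (3/2) S (\<lambda>z. outer (u z) (u z)) \<le> Lnorm 3 S u * Lnorm 3 S u"
    using Lp_mult[OF u' u' _ m] by (auto simp: norm_outer Lsp_iff[OF S] Lnorm_eq[OF S])
qed

lemma Lsp_outer_diff:
  assumes S: "S \<in> sets borel" and u: "Lsp 3 S u" and v: "Lsp 3 S v"
  shows "Lsp (3/2) S (\<lambda>z. outer (u z) (u z) - outer (v z) (v z))"
    "Lnorm (3/2) S (\<lambda>z. outer (u z) (u z) - outer (v z) (v z))
      \<le> (Lnorm 3 S u + Lnorm 3 S v) * Lnorm 3 S (\<lambda>z. u z - v z)"
proof -
  let ?M = "restrict_space lborel S"
  let ?h = "\<lambda>z. outer (u z) (u z) - outer (v z) (v z)"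
  let ?s = "\<lambda>z. norm (u z) + norm (v z)"
  have u': "Lp 3 ?M u" and v': "Lp 3 ?M v" using u v by (simp_all add: Lsp_iff[OF S])
  have [measurable]: "u \<in> borel_measurable ?M" "v \<in> borel_measurable ?M"
    using u' v' by (auto simp: Lp_def)
  have h: "?h \<in> borel_measurable ?M"
    by (intro borel_measurable_diff borel_measurable_outer) auto
  have nu: "Lp 3 ?M (\<lambda>z. norm (u z))" "Lp 3 ?M (\<lambda>z. norm (v z))"
    using u' v' by (auto simp: Lp_def)
  note s = Lp_add[OF nu]
  have d: "Lp 3 ?M (\<lambda>z. u z - v z)" using Lp_diff(1)[OF u' v'] by simp
  have pn: "pnorm 3 ?M (\<lambda>z. norm (u z)) = pnorm 3 ?M u" "pnorm 3 ?M (\<lambda>z. norm (v z)) = pnorm 3 ?M v"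
    by (simp_all add: pnorm_def)
  have le: "AE z in ?M. norm (?h z) \<le> norm (?s z) * norm (u z - v z)"
    using norm_outer_diff_le by (intro AE_I2) simp
  have m: "Lp (3/2) ?M ?h" "pnorm (3/2) ?M ?h \<le> pnorm 3 ?M ?s * pnorm 3 ?M (\<lambda>z. u z - v z)"
    using Lp_mult[of "3/2" ?M ?s "\<lambda>z. u z - v z" ?h] s(1) d h le by auto
  have "pnorm 3 ?M ?s * pnorm 3 ?M (\<lambda>z. u z - v z)
      \<le> (pnorm 3 ?M u + pnorm 3 ?M v) * pnorm 3 ?M (\<lambda>z. u z - v z)"
    using s(2) pn by (intro mult_right_mono) auto
  with m show "Lsp (3/2) S ?h"
    "Lnorm (3/2) S ?h \<le> (Lnorm 3 S u + Lnorm 3 S v) * Lnorm 3 S (\<lambda>z. u z - v z)"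
    by (auto simp: Lsp_iff[OF S] Lnorm_eq[OF S])
qed

lemma RR_norm_le:
  assumes "data_ok S" "Xsrc F"
  shows "Yprs_norm (RR (riesz S) F) \<le> \<bar>C_CZ S\<bar> * Xsrc_norm F"
proof -
  have "Yprs_norm (RR (riesz S) F) \<le> C_CZ S * Xsrc_norm F"
    using assms unfolding data_ok_def by blast
  also have "\<dots> \<le> \<bar>C_CZ S\<bar> * Xsrc_norm F" by (intro mult_right_mono) auto
  finally show ?thesis .
qed

lemma data_ok_eta:
  assumes "data_ok S"
  shows "cut_eta S \<in> borel_measurable borel" "0 \<le> cut_eta S x" "cut_eta S x \<le> 1"
    "x \<in> Bl (3/4) \<Longrightarrow> cut_eta S x = 1"
proof -
  have "test_fun (Bl 1) (cut_eta S)" using assms unfolding data_ok_def cutoffs_def by blast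
  then have "continuous_on UNIV (cut_eta S)" by (metis test_funD)
  then show "cut_eta S \<in> borel_measurable borel" by (rule borel_measurable_continuous_onI)
qed (use assms in \<open>auto simp: data_ok_def cutoffs_def\<close>)

lemma Yprs_comm_le:
  assumes S: "data_ok S" and u: "L3_sp u"
  shows "Yprs_norm (comm (riesz S) (cut_eta S) (\<lambda>z. outer (u z) (u z)))
    \<le> \<bar>C_CZ S\<bar> * (L3_norm u * Lnorm 3 (cyl (Bl 1 - Bl (3/4))) u)"
proof -
  let ?f = "\<lambda>z. outer (u z) (u z)" and ?\<eta> = "cut_eta S"
  let ?A = "cyl (Bl 1 - Bl (3/4))" and ?B = "cyl (Bl (1/2))"
  let ?d = "\<lambda>z. (?\<eta> (fst z) - 1) *\<^sub>R ?f z"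
  have Q: "Q1 \<in> sets borel" and A: "?A \<in> sets borel" and B: "?B \<in> sets borel" by simp_all
  have \<eta>: "\<bar>?\<eta> x\<bar> \<le> 1" "\<bar>?\<eta> x - 1\<bar> \<le> 1" for x using data_ok_eta(2,3)[OF S, of x] by auto
  have \<eta>m: "?\<eta> \<in> borel_measurable borel" "(\<lambda>x. ?\<eta> x - 1) \<in> borel_measurable borel"
    using data_ok_eta(1)[OF S] by auto
  have f: "Xsrc ?f" using Lsp_outer(1)[OF Q u] .
  have \<eta>f: "Xsrc (\<lambda>z. ?\<eta> (fst z) *\<^sub>R ?f z)" using Lsp_cutoff(1)[OF Q f _ \<eta>m(1) \<eta>(1)] by simp
  have d: "Xsrc ?d" using Lsp_cutoff(1)[OF Q f _ \<eta>m(2) \<eta>(2)] by simp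
  have R: "\<And>j. is_riesz_st j (riesz S j)" using S unfolding data_ok_def by blast
  have AQ: "?A \<subseteq> Q1" by auto
  have "Yprs_norm (comm (riesz S) ?\<eta> ?f) =
      Yprs_norm (\<lambda>z. RR (riesz S) (\<lambda>w. ?\<eta> (fst w) *\<^sub>R ?f w) z - RR (riesz S) ?f z)"
    using data_ok_eta(4)[OF S] by (intro Lnorm_cong) (auto simp: comm_def)
  also have "\<dots> = Yprs_norm (RR (riesz S) ?d)"
  proof (rule Lnorm_cong_ae[OF B])
    have "ae_eq (cyl UNIV) (RR (riesz S) ?d)
       (\<lambda>z. RR (riesz S) (\<lambda>w. ?\<eta> (fst w) *\<^sub>R ?f w) z - RR (riesz S) ?f z)"
      by (rule RR_diff[OF R \<eta>f f d]) (simp add: ae_eq_def algebra_simps)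
    then show "ae_eq ?B (\<lambda>z. RR (riesz S) (\<lambda>w. ?\<eta> (fst w) *\<^sub>R ?f w) z - RR (riesz S) ?f z) (RR (riesz S) ?d)"
      by (rule ae_eq_sym[OF ae_eq_subset]) auto
    have sub: "Yprs (RR (riesz S) F)" if "Xsrc F" for F
      by (rule Lsp_subset(1)[OF RR_Lsp[OF R that] _ B]) auto
    show "Yprs (RR (riesz S) ?d)"
      "Yprs (\<lambda>z. RR (riesz S) (\<lambda>w. ?\<eta> (fst w) *\<^sub>R ?f w) z - RR (riesz S) ?f z)"
      using sub[OF d] Lsp_diff(1)[OF B _ sub[OF \<eta>f] sub[OF f]] by auto
  qed
  also have "\<dots> \<le> \<bar>C_CZ S\<bar> * Xsrc_norm ?d" by (rule RR_norm_le[OF S d])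
  also have "Xsrc_norm ?d = Lnorm (3/2) ?A ?d"
    using AQ data_ok_eta(4)[OF S] by (intro Lsp_support(2)) auto
  also have "Lnorm (3/2) ?A ?d \<le> Lnorm (3/2) ?A ?f"
    using Lsp_cutoff(2)[OF A _ _ \<eta>m(2) \<eta>(2), of "3/2" ?f] Lsp_subset(1)[OF f AQ A Q] by simp
  also have "\<dots> \<le> Lnorm 3 ?A u * Lnorm 3 ?A u"
    by (rule Lsp_outer(2)[OF A Lsp_subset(1)[OF u AQ A Q]])
  \<comment> \<open>One annular factor is enlarged to the whole window, where the amplitude bound
    applies; the other stays, being a summand of \<open>sharp_norm\<close>.\<close>
  also have "\<dots> \<le> L3_norm u * Lnorm 3 ?A u"
    using Lsp_subset(2)[OF u AQ A Q] by (intro mult_right_mono) auto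
  finally show ?thesis by (simp add: mult_left_mono)
qed

text \<open>The coefficient is \<open>M\<close> for the velocity defect and the annular norm, and 1
  for \<open>stress\<close> and \<open>E_F\<close>; \<open>1 + M\<close> dominates both.\<close>

lemma Err_prs_le:
  assumes S: "data_ok S" and D: "coords_ok D" and M: "L3_norm (vel D) + L3_norm (mod_vel D) \<le> M"
  shows "Err_prs S D \<le> \<bar>C_CZ S\<bar> * (1 + M) * (L3_norm (\<lambda>z. vel D z - mod_vel D z) +
     Xsrc_norm (stress D) + Xsrc_norm (E_F D) + Lnorm 3 (cyl (Bl 1 - Bl (3/4))) (vel D))"
proof -
  let ?u = "vel D" and ?U = "mod_vel D" and ?R = "stress D" and ?\<eta> = "cut_eta S"
  have Q: "Q1 \<in> sets borel" by simp
  have u: "L3_sp ?u" and U: "L3_sp ?U" and R: "Xsrc ?R" and E: "Xsrc (E_F D)"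
    using D by (auto simp: coords_ok_def)
  have M0: "L3_norm ?u \<le> M" "0 \<le> M"
    using M Lnorm_nonneg[of 3 Q1 ?u] Lnorm_nonneg[of 3 Q1 ?U] by linarith+
  let ?g = "\<lambda>z. outer (?u z) (?u z) - outer (?U z) (?U z) - ?R z"
  note g = Lsp_diff[OF Q _ Lsp_outer_diff(1)[OF Q u U] R]
  have \<eta>: "\<bar>?\<eta> x\<bar> \<le> 1" for x using data_ok_eta(2,3)[OF S, of x] by auto
  have c: "Xsrc (\<lambda>z. ?\<eta> (fst z) *\<^sub>R ?g z)" "Xsrc_norm (\<lambda>z. ?\<eta> (fst z) *\<^sub>R ?g z) \<le> Xsrc_norm ?g"
    using Lsp_cutoff[OF Q _ _ data_ok_eta(1)[OF S] \<eta>, of "3/2" ?g] g(1) by auto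
  let ?d = "L3_norm (\<lambda>z. ?u z - ?U z)" and ?a = "Lnorm 3 (cyl (Bl 1 - Bl (3/4))) ?u"
  have "Xsrc_norm ?g \<le> (L3_norm ?u + L3_norm ?U) * ?d + Xsrc_norm ?R"
    using g(2) Lsp_outer_diff(2)[OF Q u U] by simp
  also have "\<dots> \<le> M * ?d + Xsrc_norm ?R" using M by (intro add_mono mult_right_mono) auto
  finally have "Yprs_norm (RR (riesz S) (\<lambda>z. ?\<eta> (fst z) *\<^sub>R ?g z)) \<le> \<bar>C_CZ S\<bar> * (M * ?d + Xsrc_norm ?R)"
    using c(2) order_trans[OF RR_norm_le[OF S c(1)]] by (simp add: mult_left_mono)
  moreover have "Yprs_norm (comm (riesz S) ?\<eta> (\<lambda>z. outer (?u z) (?u z))) \<le> \<bar>C_CZ S\<bar> * (M * ?a)"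
    using M0(1) by (intro order_trans[OF Yprs_comm_le[OF S u]] mult_left_mono mult_right_mono) auto
  moreover have "Yprs_norm (RR (riesz S) (E_F D)) \<le> \<bar>C_CZ S\<bar> * Xsrc_norm (E_F D)"
    by (rule RR_norm_le[OF S E])
  ultimately have "Err_prs S D \<le> \<bar>C_CZ S\<bar> * (M * ?d + Xsrc_norm ?R + M * ?a + Xsrc_norm (E_F D))"
    unfolding Err_prs_def by (simp add: algebra_simps)
  also have "\<dots> \<le> \<bar>C_CZ S\<bar> * ((1 + M) * (?d + Xsrc_norm ?R + Xsrc_norm (E_F D) + ?a))"
  proof (intro mult_left_mono)
    have "0 \<le> ?d + ?a + M * (Xsrc_norm ?R + Xsrc_norm (E_F D))" using M0 by simp
    then show "M * ?d + Xsrc_norm ?R + M * ?a + Xsrc_norm (E_F D)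
        \<le> (1 + M) * (?d + Xsrc_norm ?R + Xsrc_norm (E_F D) + ?a)" by (simp add: algebra_simps)
  qed simp
  finally show ?thesis by (simp add: mult.assoc)
qed

section \<open>The localization residual\<close>

lemma pd_mult:
  assumes "f differentiable (at x)" "g differentiable (at x)"
  shows "pd j (\<lambda>x. f x * g x) x = f x * pd j g x + pd j f x * g x"
proof -
  have "((\<lambda>x. f x * g x) has_derivative
      (\<lambda>h. f x * frechet_derivative g (at x) h + frechet_derivative f (at x) h * g x)) (at x)"
    using assms by (intro has_derivative_mult) (simp_all add: frechet_derivative_works[symmetric])
  from frechet_derivative_at[OF this] show ?thesis
    unfolding pd_def by (metis (lifting))
qed

lemma closed_A_chi: "closed (A_chi \<psi>)"
  unfolding A_chi_def by (intro closed_Un closed_closure)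

lemma outside_A_chi:
  assumes "x \<notin> A_chi \<psi>" shows "grad \<psi> x = 0" "lap \<psi> x = 0"
  using assms closure_subset[of "{x. grad \<psi> x \<noteq> 0}"] closure_subset[of "{x. lap \<psi> x \<noteq> 0}"]
  by (auto simp: A_chi_def)

text \<open>The flux terms differentiate \<psi>^2, while \<open>A_chi\<close> is defined through
  \<psi>. The bridge is grad(\<psi>^2) = 2 \<psi> grad \<psi> and lap(\<psi>^2) = 2 (\<psi> lap
  \<psi> + |grad \<psi>|^2): both vanish where grad \<psi> and lap \<psi> do. All bounds come from
  continuity and compact support.\<close>

lemma cutoff_derivatives:
  assumes "test_fun B \<psi>"
  obtains c where "0 \<le> c" "A_chi \<psi> \<subseteq> B" "bounded (A_chi \<psi>)"
    "continuous_on UNIV (grad \<psi>)" "continuous_on UNIV (lap \<psi>)"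
    "\<And>x. norm (grad \<psi> x) \<le> c" "\<And>x. \<bar>lap \<psi> x\<bar> \<le> c"
    "\<And>x. norm (grad (\<lambda>x. (\<psi> x)\<^sup>2) x) \<le> c" "\<And>x. \<bar>lap (\<lambda>x. (\<psi> x)\<^sup>2) x\<bar> \<le> c"
    "\<And>x. x \<notin> A_chi \<psi> \<Longrightarrow> grad (\<lambda>x. (\<psi> x)\<^sup>2) x = 0"
    "\<And>x. x \<notin> A_chi \<psi> \<Longrightarrow> lap (\<lambda>x. (\<psi> x)\<^sup>2) x = 0"
proof -
  obtain C where C: "compact C" "C \<subseteq> B" "\<And>x. x \<notin> C \<Longrightarrow> \<psi> x = 0" and cont: "continuous_on UNIV \<psi>"
    and diff: "\<And>x. \<psi> differentiable (at x)"
    using test_funD[OF assms] by metis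
  have "Ck (Suc (Suc 0)) \<psi>" using assms by (simp only: test_fun_def smooth_def)
  then have C1: "Ck (Suc 0) (pd j \<psi>)" for j by (rule Ck_pd)
  have pc: "continuous_on UNIV (pd j \<psi>)" for j by (rule Ck_continuous[OF C1])
  have pdiff: "pd j \<psi> differentiable (at x)" for j x using C1 by simp
  have ppc: "continuous_on UNIV (pd i (pd j \<psi>))" for i j by (rule Ck_continuous[OF Ck_pd[OF C1]])
  have p0: "pd j \<psi> x = 0" if "x \<notin> C" for x j
    using frechet_derivative_outside_support[OF compact_imp_closed[OF C(1)] C(3) that] by (simp add: pd_def)
  have pp0: "pd i (pd j \<psi>) x = 0" if "x \<notin> C" for x i j
    using frechet_derivative_outside_support[of C "pd j \<psi>", OF compact_imp_closed[OF C(1)] p0 that] by (simp add: pd_def)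
  have gc: "continuous_on UNIV (grad \<psi>)" and lc: "continuous_on UNIV (lap \<psi>)"
    unfolding grad_def[abs_def] lap_def[abs_def] by (intro continuous_intros pc ppc)+
  have g0: "grad \<psi> x = 0" and l0: "lap \<psi> x = 0" if "x \<notin> C" for x
    using p0[OF that] pp0[OF that] by (simp_all add: grad_def lap_def vec_eq_iff)
  have AC: "A_chi \<psi> \<subseteq> C"
    unfolding A_chi_def using g0 l0 compact_imp_closed[OF C(1)]
    by (intro Un_least closure_minimal) auto
  have pd2: "pd j (\<lambda>x. (\<psi> x)\<^sup>2) = (\<lambda>x. 2 * (\<psi> x * pd j \<psi> x))" for j
    using pd_mult[OF diff diff] by (intro ext) (simp add: power2_eq_square)
  have grad2: "grad (\<lambda>x. (\<psi> x)\<^sup>2) x = (2 * \<psi> x) *\<^sub>R grad \<psi> x" for x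
    by (simp add: grad_def pd2 vec_eq_iff)
  have "pd j (pd j (\<lambda>x. (\<psi> x)\<^sup>2)) x = 2 * (\<psi> x * pd j (pd j \<psi>) x + pd j \<psi> x * pd j \<psi> x)" for j x
  proof -
    have c2: "pd j (\<lambda>_. 2) x = 0" by (simp add: pd_def)
    show ?thesis
      unfolding pd2 using pd_mult[of "\<lambda>_. 2" x "\<lambda>x. \<psi> x * pd j \<psi> x" j] pd_mult[OF diff[of x] pdiff[of j x], of j]
      by (simp add: c2 diff pdiff differentiable_mult)
  qed
  then have lap2: "lap (\<lambda>x. (\<psi> x)\<^sup>2) x = 2 * (\<psi> x * lap \<psi> x + grad \<psi> x \<bullet> grad \<psi> x)" for x
    by (simp add: lap_def grad_def inner_vec_def sum.distrib sum_distrib_left distrib_left)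
  have g2c: "continuous_on UNIV (grad (\<lambda>x. (\<psi> x)\<^sup>2))" and l2c: "continuous_on UNIV (lap (\<lambda>x. (\<psi> x)\<^sup>2))"
    unfolding grad2[abs_def] lap2[abs_def] by (intro continuous_intros gc lc cont)+
  obtain c1 where c1: "0 \<le> c1" "\<And>x. norm (grad \<psi> x) \<le> c1"
    using bounded_compact_support[OF gc C(1) g0] by metis
  obtain c2 where c2: "0 \<le> c2" "\<And>x. norm (lap \<psi> x) \<le> c2"
    using bounded_compact_support[OF lc C(1) l0] by metis
  obtain c3 where c3: "0 \<le> c3" "\<And>x. norm (grad (\<lambda>x. (\<psi> x)\<^sup>2) x) \<le> c3"
    using bounded_compact_support[OF g2c C(1)] g0 by (metis grad2 scaleR_zero_right)
  obtain c4 where c4: "0 \<le> c4" "\<And>x. norm (lap (\<lambda>x. (\<psi> x)\<^sup>2) x) \<le> c4"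
    using bounded_compact_support[OF l2c C(1)] g0 l0 by (metis lap2 add.right_neutral inner_zero_left mult_zero_right)
  show thesis
  proof (rule that[of "c1 + c2 + c3 + c4"])
    show "norm (grad \<psi> x) \<le> c1 + c2 + c3 + c4" "\<bar>lap \<psi> x\<bar> \<le> c1 + c2 + c3 + c4"
      "norm (grad (\<lambda>x. (\<psi> x)\<^sup>2) x) \<le> c1 + c2 + c3 + c4"
      "\<bar>lap (\<lambda>x. (\<psi> x)\<^sup>2) x\<bar> \<le> c1 + c2 + c3 + c4" for x
      using c1(1) c2(1) c3(1) c4(1) c1(2)[of x] c2(2)[of x] c3(2)[of x] c4(2)[of x]
      unfolding real_norm_def by linarith+
    show "grad (\<lambda>x. (\<psi> x)\<^sup>2) x = 0" "lap (\<lambda>x. (\<psi> x)\<^sup>2) x = 0" if "x \<notin> A_chi \<psi>" for x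
      using outside_A_chi[OF that] by (simp_all add: grad2 lap2)
    show "bounded (A_chi \<psi>)" using AC C(1) by (meson bounded_subset compact_imp_bounded)
  qed (use c1 c2 c3 c4 AC C gc lc in auto)
qed

lemma abs_set_integral_le:
  fixes h :: "'a::euclidean_space \<Rightarrow> real"
  assumes S: "S \<in> sets borel" "S \<subseteq> T" and k: "integrable (restrict_space lborel S) k"
    and le: "\<And>z. z \<in> S \<Longrightarrow> \<bar>h z\<bar> \<le> k z" and z: "\<And>z. z \<in> T - S \<Longrightarrow> h z = 0"
  shows "\<bar>LINT z:T|lborel. h z\<bar> \<le> (\<integral>z. k z \<partial>restrict_space lborel S)"
proof -
  let ?M = "restrict_space lborel S"
  have "indicat_real T z *\<^sub>R h z = indicat_real S z *\<^sub>R h z" for z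
    using S z by (auto simp: indicator_def)
  then have "(LINT z:T|lborel. h z) = (\<integral>z. h z \<partial>?M)"
    using S by (simp only: set_lebesgue_integral_def) (simp add: integral_restrict_space)
  also have "\<bar>\<dots>\<bar> \<le> (\<integral>z. \<bar>h z\<bar> \<partial>?M)" by (rule integral_abs_bound)
  also have "\<dots> \<le> (\<integral>z. k z \<partial>?M)"
    using le by (intro integral_mono' k) (auto simp: space_restrict_space intro: order_trans[OF abs_ge_zero])
  finally show ?thesis .
qed

lemma Lp_one_bounded:
  fixes S :: "'a::euclidean_space set"
  assumes "S \<in> sets borel" "bounded S"
  shows "Lp p (restrict_space lborel S) (\<lambda>_. 1 :: real)"
proof -
  have "emeasure (restrict_space lborel S) (space (restrict_space lborel S)) < \<infinity>"
    using assms emeasure_bounded_finite[of S]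
    by (simp add: emeasure_restrict_space space_restrict_space)
  then have "finite_measure (restrict_space lborel S)" by (intro finite_measureI) auto
  then show ?thesis by (simp add: Lp_def finite_measure.integrable_const)
qed

text \<open>Each integral is taken by Hoelder with exponents 3/2 and 3 on the cylinder over
  \<open>A_chi\<close>. The cubic term gives up two factors to \<open>M\<^sup>2\<close>, the
  pressure term gives up its velocity factor and keeps \<open>Leak_p\<close>.\<close>

lemma Err_flux_le:
  assumes \<psi>: "test_fun (Bl (3/4)) (cut_chi S)" and c: "0 \<le> c"
    "\<And>x. norm (grad (\<lambda>x. (cut_chi S x)\<^sup>2) x) \<le> c" "\<And>x. \<bar>lap (\<lambda>x. (cut_chi S x)\<^sup>2) x\<bar> \<le> c"
    "\<And>x. x \<notin> A_chi (cut_chi S) \<Longrightarrow> grad (\<lambda>x. (cut_chi S x)\<^sup>2) x = 0"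
    "\<And>x. x \<notin> A_chi (cut_chi S) \<Longrightarrow> lap (\<lambda>x. (cut_chi S x)\<^sup>2) x = 0"
    and A: "A_chi (cut_chi S) \<subseteq> Bl (3/4)"
    and D: "coords_ok D" and M: "L3_norm (vel D) \<le> M"
  shows "Err_flux S D \<le> c * ((Lnorm 3 (cyl (A_chi (cut_chi S))) (\<lambda>_. 1 :: real) * M + M\<^sup>2) * Leak_u S D
     + 2 * M * Leak_p S D)"
proof -
  let ?A = "A_chi (cut_chi S)"
  let ?S = "cyl ?A" and ?Q = "cyl (Bl (3/4))"
  let ?M = "restrict_space lborel ?S"
  let ?u = "vel D" and ?p = "prs D" and ?\<psi>2 = "\<lambda>x. (cut_chi S x)\<^sup>2"
  have S: "?S \<in> sets borel" using closed_A_chi by (intro cyl_borel) (simp add: borel_closed)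
  have SQ: "?S \<subseteq> ?Q" and SQ1: "?S \<subseteq> Q1" using A by auto
  have Q1: "Q1 \<in> sets borel" by simp
  have bS: "bounded ?S" using A by (intro bounded_Times) (auto intro: bounded_subset[OF bounded_ball])
  have uS: "Lsp 3 ?S ?u" and uM: "Lnorm 3 ?S ?u \<le> M" and pS: "Lsp (3/2) ?S ?p"
    using D M Lsp_subset[OF _ SQ1 S Q1, of 3 ?u] Lsp_subset(1)[OF _ SQ1 S Q1, of "3/2" ?p]
    by (auto simp: coords_ok_def)
  have u: "Lp 3 ?M ?u" and p: "Lp (3/2) ?M ?p" using uS pS by (simp_all add: Lsp_iff[OF S])
  have [measurable]: "?u \<in> borel_measurable ?M" using u by (rule Lp_measurable)
  have one: "Lp 3 ?M (\<lambda>_. 1 :: real)" by (rule Lp_one_bounded[OF S bS])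
  define L k where "L = pnorm 3 ?M ?u" and "k = pnorm 3 ?M (\<lambda>_. 1 :: real)"
  have L: "0 \<le> L" "L \<le> M" using uM by (auto simp: L_def Lnorm_eq[OF S])
  have k: "0 \<le> k" by (simp add: k_def)
  have M0: "0 \<le> M" using L by linarith
  \<comment> \<open>Multiplying by the constant 1 in \<open>L^3\<close> lowers the exponent of
    \<open>u\<close> from 3 to 3/2; the price \<open>k\<close> is finite because the region is
    bounded.\<close>
  have u32: "Lp (3/2) ?M (\<lambda>z. norm (?u z))" "pnorm (3/2) ?M (\<lambda>z. norm (?u z)) \<le> L * k"
    using Lp_mult[of "3/2" ?M ?u "\<lambda>_. 1 :: real" "\<lambda>z. norm (?u z)"] u one by (auto simp: L_def k_def)
  have uu: "Lp (3/2) ?M (\<lambda>z. (norm (?u z))\<^sup>2)" "pnorm (3/2) ?M (\<lambda>z. (norm (?u z))\<^sup>2) \<le> L * L"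
    using Lp_mult[of "3/2" ?M ?u ?u "\<lambda>z. (norm (?u z))\<^sup>2"] u by (auto simp: L_def power2_eq_square)
  have nA: "fst z \<notin> ?A" if "z \<in> ?Q - ?S" for z using that by (cases z) auto
  note H1 = Holder_Lp[OF u32(1) u] and H2 = Holder_Lp[OF uu(1) u] and H3 = Holder_Lp[OF p u]
  have "\<bar>LINT z:?Q|lborel. (norm (?u z))\<^sup>2 * lap ?\<psi>2 (fst z)\<bar> \<le> (\<integral>z. c * (norm (norm (?u z)) * norm (?u z)) \<partial>?M)"
  proof (rule abs_set_integral_le[OF S SQ])
    show "\<bar>(norm (?u z))\<^sup>2 * lap ?\<psi>2 (fst z)\<bar> \<le> c * (norm (norm (?u z)) * norm (?u z))" for z
      using mult_right_mono[OF c(3)[of "fst z"], of "(norm (?u z))\<^sup>2"]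
      by (simp add: abs_mult power2_eq_square mult.commute)
  qed (use H1(1) c(5)[OF nA] in simp_all)
  also have "\<dots> \<le> c * (L * k * L)"
    using H1(2) c(1) mult_right_mono[OF u32(2) L(1)] by (simp add: mult_left_mono L_def)
  also have "\<dots> \<le> c * (k * M * L)"
    using c(1) k mult_right_mono[OF mult_left_mono[OF L(2) k] L(1)]
    by (intro mult_left_mono) (simp_all add: mult.commute)
  finally have T1: "\<bar>LINT z:?Q|lborel. (norm (?u z))\<^sup>2 * lap ?\<psi>2 (fst z)\<bar> \<le> c * (k * M * L)" .
  have gr: "\<bar>v \<bullet> grad ?\<psi>2 x\<bar> \<le> c * norm v" for v x
    using order_trans[OF Cauchy_Schwarz_ineq2 mult_left_mono[OF c(2)[of x] norm_ge_zero[of v]]]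
    by (simp add: mult.commute)
  have "\<bar>LINT z:?Q|lborel. (norm (?u z))\<^sup>2 * (?u z \<bullet> grad ?\<psi>2 (fst z))\<bar>
      \<le> (\<integral>z. c * (norm ((norm (?u z))\<^sup>2) * norm (?u z)) \<partial>?M)"
  proof (rule abs_set_integral_le[OF S SQ])
    show "\<bar>(norm (?u z))\<^sup>2 * (?u z \<bullet> grad ?\<psi>2 (fst z))\<bar> \<le> c * (norm ((norm (?u z))\<^sup>2) * norm (?u z))" for z
      using mult_left_mono[OF gr[of "?u z" "fst z"], of "(norm (?u z))\<^sup>2"]
      by (simp add: abs_mult mult.left_commute)
  qed (use H2(1) c(4)[OF nA] in simp_all)
  also have "\<dots> \<le> c * (L * L * L)"
    using H2(2) c(1) mult_right_mono[OF uu(2) L(1)] by (simp add: mult_left_mono L_def)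
  also have "\<dots> \<le> c * (M\<^sup>2 * L)"
    using c(1) L M0 by (intro mult_left_mono mult_right_mono) (auto simp: power2_eq_square intro: mult_mono)
  finally have T2: "\<bar>LINT z:?Q|lborel. (norm (?u z))\<^sup>2 * (?u z \<bullet> grad ?\<psi>2 (fst z))\<bar> \<le> c * (M\<^sup>2 * L)" .
  have "\<bar>LINT z:?Q|lborel. ?p z * (?u z \<bullet> grad ?\<psi>2 (fst z))\<bar> \<le> (\<integral>z. c * (norm (?p z) * norm (?u z)) \<partial>?M)"
  proof (rule abs_set_integral_le[OF S SQ])
    show "\<bar>?p z * (?u z \<bullet> grad ?\<psi>2 (fst z))\<bar> \<le> c * (norm (?p z) * norm (?u z))" for z
      using mult_left_mono[OF gr[of "?u z" "fst z"], of "\<bar>?p z\<bar>"]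
      by (simp add: abs_mult mult.left_commute)
  qed (use H3(1) c(4)[OF nA] in simp_all)
  also have "\<dots> \<le> c * (pnorm (3/2) ?M ?p * L)"
    using H3(2) c(1) by (simp add: mult_left_mono L_def)
  also have "\<dots> \<le> c * (M * pnorm (3/2) ?M ?p)"
    using c(1) L by (intro mult_left_mono) (auto simp: mult.commute[of M] intro: mult_left_mono)
  finally have T3: "\<bar>LINT z:?Q|lborel. ?p z * (?u z \<bullet> grad ?\<psi>2 (fst z))\<bar> \<le> c * (M * pnorm (3/2) ?M ?p)" .
  show ?thesis
    using T1 T2 T3 unfolding Err_flux_def Let_def Leak_u_def Leak_p_def Lnorm_eq[OF S] L_def[symmetric] k_def[symmetric]
    by (simp add: algebra_simps)
qed

text \<open>Both parts of the decomposition vanish off the cylinder over \<open>A_chi\<close>, so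
  their norms are leakage norms. In the \<open>L^{3/2}\<close> part, the Laplacian term needs the
  lowering of \<open>u\<close> to exponent 3/2, and the quadratic term spends one factor on
  \<open>M\<close>.\<close>

lemma Err_mom_le:
  assumes c: "0 \<le> c"
    "\<And>x. norm (grad (cut_chi S) x) \<le> c" "\<And>x. \<bar>lap (cut_chi S) x\<bar> \<le> c"
    "continuous_on UNIV (grad (cut_chi S))" "continuous_on UNIV (lap (cut_chi S))"
    and A: "A_chi (cut_chi S) \<subseteq> Bl (3/4)"
    and D: "sharp_pkg D" and M: "L3_norm (vel D) \<le> M"
  shows "Err_mom S D \<le> c * (2 * Leak_gradu S D +
     (Lnorm 3 (cyl (A_chi (cut_chi S))) (\<lambda>_. 1 :: real) + M) * Leak_u S D + Leak_p S D)"
proof -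
  let ?\<psi> = "cut_chi S"
  let ?A = "A_chi ?\<psi>"
  let ?S = "cyl ?A" and ?Q = "cyl (Bl (3/4))"
  let ?M = "restrict_space lborel ?S"
  let ?u = "vel D" and ?p = "prs D" and ?G = "wgrad (vel D)"
  have S: "?S \<in> sets borel" using closed_A_chi by (intro cyl_borel) (simp add: borel_closed)
  have SQ: "?S \<subseteq> ?Q" and SQ1: "?S \<subseteq> Q1" using A by auto
  have Q1: "Q1 \<in> sets borel" by simp
  have bS: "bounded ?S" using A by (intro bounded_Times) (auto intro: bounded_subset[OF bounded_ball])
  \<comment> \<open>\<open>wgrad\<close> is a choice; membership in \<open>sharp_pkg\<close>
    supplies the existence that makes the chosen field a weak gradient.\<close>
  have "weak_grad ?u ?G"
    using D someI_ex[of "weak_grad ?u"] unfolding sharp_pkg_def wgrad_def by blast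
  then have G1: "Lsp 2 Q1 ?G" by (simp add: weak_grad_def)
  have uS: "Lsp 3 ?S ?u" and uM: "Lnorm 3 ?S ?u \<le> M" and pS: "Lsp (3/2) ?S ?p"
    using D M Lsp_subset[OF _ SQ1 S Q1, of 3 ?u] Lsp_subset(1)[OF _ SQ1 S Q1, of "3/2" ?p]
    by (auto simp: sharp_pkg_def coords_ok_def)
  have u: "Lp 3 ?M ?u" and p: "Lp (3/2) ?M ?p" and G: "Lp 2 ?M ?G"
    using uS pS Lsp_subset(1)[OF G1 SQ1 S Q1] by (simp_all add: Lsp_iff[OF S])
  have one: "Lp 3 ?M (\<lambda>_. 1 :: real)" by (rule Lp_one_bounded[OF S bS])
  define L k where "L = pnorm 3 ?M ?u" and "k = pnorm 3 ?M (\<lambda>_. 1 :: real)"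
  have L: "0 \<le> L" "L \<le> M" using uM by (auto simp: L_def Lnorm_eq[OF S])
  note m = Lp_measurable[OF u] Lp_measurable[OF p] Lp_measurable[OF G]
    borel_measurable_fst_cyl[OF borel_measurable_continuous_onI[OF c(4)], of ?S]
    borel_measurable_fst_cyl[OF borel_measurable_continuous_onI[OF c(5)], of ?S]
  let ?g1 = "\<lambda>z. - 2 *\<^sub>R (?G z *v grad ?\<psi> (fst z))"
  let ?a = "\<lambda>z. lap ?\<psi> (fst z) *\<^sub>R ?u z"
  let ?b = "\<lambda>z. ?p z *\<^sub>R grad ?\<psi> (fst z)"
  let ?o = "\<lambda>z. outer (?u z) (?u z)"
  let ?e = "\<lambda>z. ?o z *v grad ?\<psi> (fst z)"
  let ?g2 = "\<lambda>z. ?b z + ?e z - ?a z"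
  have mv: "norm (X *v grad ?\<psi> x) \<le> c * norm X" for X :: "real^3^3" and x
    using order_trans[OF norm_matrix_vector_le mult_left_mono[OF c(2)[of x] norm_ge_zero[of X]]]
    by (simp add: mult.commute)
  have c2: "0 \<le> 2 * c" using c(1) by simp
  have g1: "Lp 2 ?M ?g1" "pnorm 2 ?M ?g1 \<le> 2 * c * pnorm 2 ?M ?G"
  proof -
    have meas: "?g1 \<in> borel_measurable ?M"
      using m by (intro borel_measurable_scaleR borel_measurable_matrix_vector) auto
    have le: "AE z in ?M. norm (?g1 z) \<le> 2 * c * norm (?G z)"
      using mv by (intro AE_I2) (simp add: mult.assoc)
    show "Lp 2 ?M ?g1" "pnorm 2 ?M ?g1 \<le> 2 * c * pnorm 2 ?M ?G"
      by (rule Lp_dominated[OF G meas _ c2 le]; simp)+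
  qed
  have u32: "Lp (3/2) ?M ?u" "pnorm (3/2) ?M ?u \<le> L * k"
    using Lp_mult[of "3/2" ?M ?u "\<lambda>_. 1 :: real" ?u] u one m(1) by (auto simp: L_def k_def)
  have a: "Lp (3/2) ?M ?a" "pnorm (3/2) ?M ?a \<le> c * pnorm (3/2) ?M ?u"
  proof -
    have meas: "?a \<in> borel_measurable ?M" using m by (intro borel_measurable_scaleR) auto
    have le: "AE z in ?M. norm (?a z) \<le> c * norm (?u z)"
      using c(3) by (intro AE_I2) (simp add: mult_right_mono)
    show "Lp (3/2) ?M ?a" "pnorm (3/2) ?M ?a \<le> c * pnorm (3/2) ?M ?u"
      by (rule Lp_dominated[OF u32(1) meas _ c(1) le]; simp)+
  qed
  have b: "Lp (3/2) ?M ?b" "pnorm (3/2) ?M ?b \<le> c * pnorm (3/2) ?M ?p"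
  proof -
    have meas: "?b \<in> borel_measurable ?M" using m by (intro borel_measurable_scaleR) auto
    have le: "AE z in ?M. norm (?b z) \<le> c * norm (?p z)"
      using c(2) by (intro AE_I2) (simp add: mult_left_mono mult.commute[of c])
    show "Lp (3/2) ?M ?b" "pnorm (3/2) ?M ?b \<le> c * pnorm (3/2) ?M ?p"
      by (rule Lp_dominated[OF p meas _ c(1) le]; simp)+
  qed
  have o: "Lp (3/2) ?M ?o" "pnorm (3/2) ?M ?o \<le> L * L"
    using Lsp_outer[OF S uS] by (auto simp: Lsp_iff[OF S] Lnorm_eq[OF S] L_def)
  have e: "Lp (3/2) ?M ?e" "pnorm (3/2) ?M ?e \<le> c * pnorm (3/2) ?M ?o"
  proof -
    have meas: "?e \<in> borel_measurable ?M"
      using m Lp_measurable[OF o(1)] by (intro borel_measurable_matrix_vector) auto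
    have le: "AE z in ?M. norm (?e z) \<le> c * norm (?o z)"
      using mv by (intro AE_I2)
    show "Lp (3/2) ?M ?e" "pnorm (3/2) ?M ?e \<le> c * pnorm (3/2) ?M ?o"
      by (rule Lp_dominated[OF o(1) meas _ c(1) le]; simp)+
  qed
  have be: "Lp (3/2) ?M (\<lambda>z. ?b z + ?e z)" "pnorm (3/2) ?M (\<lambda>z. ?b z + ?e z) \<le> pnorm (3/2) ?M ?b + pnorm (3/2) ?M ?e"
    using Lp_add[OF b(1) e(1)] by auto
  have g2: "Lp (3/2) ?M ?g2" "pnorm (3/2) ?M ?g2 \<le> pnorm (3/2) ?M ?b + pnorm (3/2) ?M ?e + pnorm (3/2) ?M ?a"
    using Lp_diff[OF be(1) a(1)] be(2) by auto
  have zero: "?g1 z = 0" "?g2 z = 0" if "z \<in> ?Q - ?S" for z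
  proof -
    have "fst z \<notin> ?A" using that by auto
    then show "?g1 z = 0" "?g2 z = 0" using outside_A_chi by auto
  qed
  have "Err_mom S D \<le> Lnorm 2 ?Q ?g1 + Lnorm (3/2) ?Q ?g2"
    unfolding Err_mom_def
  proof (rule sum_norm_le)
    show "Lsp 2 ?Q ?g1" "Lsp (3/2) ?Q ?g2"
      using g1(1) g2(1) Lsp_support(1)[OF SQ zero(1)] Lsp_support(1)[OF SQ zero(2)] by (simp_all add: Lsp_iff[OF S])
  qed (auto simp: mom_field_def)
  also have "\<dots> = pnorm 2 ?M ?g1 + pnorm (3/2) ?M ?g2"
    using Lsp_support(2)[OF SQ zero(1)] Lsp_support(2)[OF SQ zero(2)] by (simp add: Lnorm_eq[OF S])
  also have "\<dots> \<le> 2 * c * pnorm 2 ?M ?G + (c * pnorm (3/2) ?M ?p + c * (M * L) + c * (k * L))"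
  proof -
    have "c * pnorm (3/2) ?M ?o \<le> c * (M * L)"
      using o(2) c(1) L order_trans[OF o(2) mult_right_mono[OF L(2) L(1)]] by (intro mult_left_mono) auto
    moreover have "c * pnorm (3/2) ?M ?u \<le> c * (k * L)"
      using u32(2) c(1) by (intro mult_left_mono) (auto simp: mult.commute)
    ultimately show ?thesis using g1(2) g2(2) a(2) b(2) e(2) by linarith
  qed
  finally show ?thesis
    unfolding Leak_gradu_def Leak_u_def Leak_p_def Lnorm_eq[OF S] L_def[symmetric] k_def[symmetric]
    by (simp add: algebra_simps)
qed

text \<open>The constant is obtained before the package and \<open>M\<close>: it comes only from the
  derivative bounds of the cutoff and the size of its transition region.\<close>

lemma Err_loc_le:
  fixes S :: "('pi::real_normed_vector, 'phi::real_normed_vector, 'tt::real_normed_vector, 'a) fixed_data"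
  assumes "data_ok S"
  obtains c where "0 \<le> c" "\<And>(D :: ('pi, 'phi, 'tt, 's::real_normed_vector) pkg) M.
    sharp_pkg D \<Longrightarrow> L3_norm (vel D) \<le> M \<Longrightarrow>
    Err_loc S D \<le> c * (1 + M)\<^sup>2 * (Leak_gradu S D + Leak_u S D + Leak_p S D)"
proof -
  have \<psi>: "test_fun (Bl (3/4)) (cut_chi S)"
    using assms unfolding data_ok_def cutoffs_def by blast
  obtain c where c: "0 \<le> c" "A_chi (cut_chi S) \<subseteq> Bl (3/4)"
    "continuous_on UNIV (grad (cut_chi S))" "continuous_on UNIV (lap (cut_chi S))"
    "\<And>x. norm (grad (cut_chi S) x) \<le> c" "\<And>x. \<bar>lap (cut_chi S) x\<bar> \<le> c"
    "\<And>x. norm (grad (\<lambda>x. (cut_chi S x)\<^sup>2) x) \<le> c" "\<And>x. \<bar>lap (\<lambda>x. (cut_chi S x)\<^sup>2) x\<bar> \<le> c"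
    "\<And>x. x \<notin> A_chi (cut_chi S) \<Longrightarrow> grad (\<lambda>x. (cut_chi S x)\<^sup>2) x = 0"
    "\<And>x. x \<notin> A_chi (cut_chi S) \<Longrightarrow> lap (\<lambda>x. (cut_chi S x)\<^sup>2) x = 0"
    using cutoff_derivatives[OF \<psi>] by metis
  define k where "k = Lnorm 3 (cyl (A_chi (cut_chi S))) (\<lambda>_. 1 :: real)"
  have k: "0 \<le> k" by (simp add: k_def)
  show thesis
  proof (rule that)
    \<comment> \<open>\<open>(2 + k) * (1 + M)\<^sup>2\<close> dominates the three leakage
      coefficients 2, \<open>k + M + k * M + M\<^sup>2\<close> and \<open>1 + 2 * M\<close>.\<close>
    show "0 \<le> c * (2 + k)" using c(1) k by simp
    fix D :: "('pi, 'phi, 'tt, 's) pkg" and M assume D: "sharp_pkg D" and M: "L3_norm (vel D) \<le> M"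
    have M0: "0 \<le> M" using M Lnorm_nonneg order_trans by blast
    let ?G = "Leak_gradu S D" and ?U = "Leak_u S D" and ?P = "Leak_p S D"
    have co: "coords_ok D" using D by (simp add: sharp_pkg_def)
    have nn: "0 \<le> ?G" "0 \<le> ?U" "0 \<le> ?P" by (simp_all add: Leak_gradu_def Leak_u_def Leak_p_def)
    have "Err_loc S D \<le> c * (2 * ?G + (k + M) * ?U + ?P) + c * ((k * M + M\<^sup>2) * ?U + 2 * M * ?P)"
      unfolding Err_loc_def k_def
      by (intro add_mono Err_mom_le[OF c(1,5,6,3,4,2) D M] Err_flux_le[OF \<psi> c(1,7-10,2) co M])
    also have "\<dots> = c * (2 * ?G + (k + M + k * M + M\<^sup>2) * ?U + (1 + 2 * M) * ?P)"
      by (simp add: algebra_simps)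
    also have "\<dots> \<le> c * (((2 + k) * (1 + M)\<^sup>2) * ?G + ((2 + k) * (1 + M)\<^sup>2) * ?U + ((2 + k) * (1 + M)\<^sup>2) * ?P)"
    proof -
      have e: "(2 + k) * (1 + M)\<^sup>2 = 2 + 4 * M + 2 * M\<^sup>2 + k + 2 * (k * M) + k * M\<^sup>2"
        by (simp add: power2_eq_square algebra_simps)
      have "0 \<le> k * M" "0 \<le> M\<^sup>2" "0 \<le> k * M\<^sup>2" using k M0 by simp_all
      then have "2 \<le> (2 + k) * (1 + M)\<^sup>2" "k + M + k * M + M\<^sup>2 \<le> (2 + k) * (1 + M)\<^sup>2"
        "1 + 2 * M \<le> (2 + k) * (1 + M)\<^sup>2"
        unfolding e using k M0 by linarith+
      then show ?thesis using nn c(1) by (intro mult_left_mono add_mono mult_right_mono) auto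
    qed
    finally show "Err_loc S D \<le> c * (2 + k) * (1 + M)\<^sup>2 * (?G + ?U + ?P)"
      by (simp add: algebra_simps)
  qed
qed

section \<open>Reproduction residuals and the total estimate\<close>

text \<open>Telescoping: F - G = \<eta>(a \<otimes> a - b \<otimes> b) + \<eta>(r - r') + (\<eta>(b
  \<otimes> b + r') - G). Here \<open>a\<close>, \<open>r\<close> belong to the new window,
  \<open>b\<close>, \<open>r'\<close> are images of the old one, and the last bracket is a leakage.
  One statement serves \<open>F_mod\<close> and, with \<open>r\<close> and \<open>r'\<close> zero,
  \<open>F_act\<close>.\<close>

lemma source_realization_defect:
  assumes S: "data_ok S" and F: "Xsrc F" and G: "Xsrc G" and a: "L3_sp a" and b: "L3_sp b"
    and r: "Xsrc r" and r': "Xsrc r'"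
    and eq: "ae_eq Q1 F (\<lambda>z. cut_eta S (fst z) *\<^sub>R (outer (a z) (a z) + r z))"
  shows "Xsrc_norm (\<lambda>z. F z - G z) \<le> (L3_norm a + L3_norm b) * L3_norm (\<lambda>z. a z - b z) +
    Xsrc_norm (\<lambda>z. r z - r' z) +
    Xsrc_norm (\<lambda>z. cut_eta S (fst z) *\<^sub>R (outer (b z) (b z) + r' z) - G z)"
proof -
  let ?\<eta> = "cut_eta S"
  let ?o = "\<lambda>z. outer (a z) (a z) - outer (b z) (b z)" and ?d = "\<lambda>z. r z - r' z"
  let ?w = "\<lambda>z. outer (b z) (b z) + r' z"
  have Q: "Q1 \<in> sets borel" by simp
  have \<eta>: "\<bar>?\<eta> x\<bar> \<le> 1" for x using data_ok_eta(2,3)[OF S, of x] by auto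
  note cut = Lsp_cutoff[OF Q _ _ data_ok_eta(1)[OF S] \<eta>, where p = "3/2"]
  note o = Lsp_outer_diff[OF Q a b]
  have d: "Xsrc ?d" using Lsp_diff(1)[OF Q _ r r'] by simp
  have w: "Xsrc ?w" using Lsp_add(1)[OF Q _ Lsp_outer(1)[OF Q b] r'] by simp
  let ?O = "\<lambda>z. ?\<eta> (fst z) *\<^sub>R ?o z" and ?D = "\<lambda>z. ?\<eta> (fst z) *\<^sub>R ?d z"
    and ?W = "\<lambda>z. ?\<eta> (fst z) *\<^sub>R ?w z - G z"
  have O: "Xsrc ?O" "Xsrc_norm ?O \<le> Xsrc_norm ?o" using cut[OF o(1)] by auto
  have D: "Xsrc ?D" "Xsrc_norm ?D \<le> Xsrc_norm ?d" using cut[OF d] by auto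
  have W: "Xsrc ?W" using Lsp_diff(1)[OF Q _ cut(1)[OF w] G] by simp
  have OD: "Xsrc (\<lambda>z. ?O z + ?D z)" "Xsrc_norm (\<lambda>z. ?O z + ?D z) \<le> Xsrc_norm ?O + Xsrc_norm ?D"
    using Lsp_add[OF Q _ O(1) D(1)] by auto
  have ODW: "Xsrc (\<lambda>z. ?O z + ?D z + ?W z)"
    "Xsrc_norm (\<lambda>z. ?O z + ?D z + ?W z) \<le> Xsrc_norm (\<lambda>z. ?O z + ?D z) + Xsrc_norm ?W"
    using Lsp_add[OF Q _ OD(1) W] by auto
  have "Xsrc_norm (\<lambda>z. F z - G z) = Xsrc_norm (\<lambda>z. ?O z + ?D z + ?W z)"
  proof (rule Lnorm_cong_ae[OF Q _ ODW(1)])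
    show "Xsrc (\<lambda>z. F z - G z)" using Lsp_diff(1)[OF Q _ F G] by simp
    show "ae_eq Q1 (\<lambda>z. F z - G z) (\<lambda>z. ?O z + ?D z + ?W z)"
      using eq unfolding ae_eq_def by eventually_elim (simp add: algebra_simps)
  qed
  then show ?thesis using ODW(2) OD(2) O(2) D(2) o(2) by linarith
qed

lemma bdd_LmapD:
  assumes "bdd_Lmap p S A"
  shows "Lsp p S f \<Longrightarrow> Lsp p S (A f)"
    "Lsp p S f \<Longrightarrow> Lsp p S g \<Longrightarrow> ae_eq S f g \<Longrightarrow> ae_eq S (A f) (A g)"
  using assms unfolding bdd_Lmap_def by blast+

text \<open>Insert the Riesz image of the reproduced source: the difference becomes
  \<open>RR\<close> of the source defect, controlled by the Calderon-Zygmund bound, plus the failure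
  of the reproduction maps to intertwine with \<open>RR\<close>.\<close>

lemma Rep_pact_le:
  assumes S: "data_ok S" and D: "coords_ok D" and D': "coords_ok D'"
    and p: "ae_eq (cyl (Bl (1/2))) (p_act D) (RR (riesz S) (F_act D))"
    and p': "ae_eq (cyl (Bl (1/2))) (p_act D') (RR (riesz S) (F_act D'))"
  shows "Rep_pact S D D' \<le> \<bar>C_CZ S\<bar> * Rep_Fact S D D' +
    Yprs_norm (\<lambda>z. RR (riesz S) (rp_src (maps S) (F_act D)) z -
         rp_prs (maps S) (RR (riesz S) (F_act D)) z)"
proof -
  let ?B = "cyl (Bl (1/2))" and ?RR = "RR (riesz S)"
  let ?F = "F_act D" and ?F' = "F_act D'" and ?G = "rp_src (maps S) (F_act D)" and ?P = "rp_prs (maps S)"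
  have B: "?B \<in> sets borel" and Q: "Q1 \<in> sets borel" by simp_all
  have R: "\<And>j. is_riesz_st j (riesz S j)" using S unfolding data_ok_def by blast
  have Y: "Yprs (?RR X)" if "Xsrc X" for X
    by (rule Lsp_subset(1)[OF RR_Lsp[OF R that] _ B]) auto
  have src: "bdd_Lmap (3/2) Q1 (rp_src (maps S))" and prs: "bdd_Lmap (3/2) ?B ?P"
    using S unfolding data_ok_def bdd_repro_def by blast+
  have F: "Xsrc ?F" and F': "Xsrc ?F'" and pD: "Yprs (p_act D)" and pD': "Yprs (p_act D')"
    using D D' by (auto simp: coords_ok_def)
  have G: "Xsrc ?G" by (rule bdd_LmapD(1)[OF src F])
  have d: "Xsrc (\<lambda>z. ?F' z - ?G z)" using Lsp_diff(1)[OF Q _ F' G] by simp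
  have PF: "Yprs (?P (?RR ?F))" by (rule bdd_LmapD(1)[OF prs Y[OF F]])
  have t: "Yprs (\<lambda>z. ?RR ?G z - ?P (?RR ?F) z)" using Lsp_diff(1)[OF B _ Y[OF G] PF] by simp
  have s: "Yprs (\<lambda>z. ?RR (\<lambda>z. ?F' z - ?G z) z + (?RR ?G z - ?P (?RR ?F) z))"
    "Yprs_norm (\<lambda>z. ?RR (\<lambda>z. ?F' z - ?G z) z + (?RR ?G z - ?P (?RR ?F) z))
      \<le> Yprs_norm (?RR (\<lambda>z. ?F' z - ?G z)) + Yprs_norm (\<lambda>z. ?RR ?G z - ?P (?RR ?F) z)"
    using Lsp_add[OF B _ Y[OF d] t] by auto
  have "Rep_pact S D D' = Yprs_norm (\<lambda>z. ?RR (\<lambda>z. ?F' z - ?G z) z + (?RR ?G z - ?P (?RR ?F) z))"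
    unfolding Rep_pact_def
  proof (rule Lnorm_cong_ae[OF B _ s(1)])
    show "Yprs (\<lambda>z. p_act D' z - ?P (p_act D) z)"
      using Lsp_diff(1)[OF B _ pD' bdd_LmapD(1)[OF prs pD]] by simp
    \<comment> \<open>The pressure is realized only almost everywhere, so replacing it inside
      \<open>rp_prs\<close> uses that this map respects almost everywhere equality.\<close>
    have "ae_eq ?B (?P (p_act D)) (?P (?RR ?F))"
      by (rule bdd_LmapD(2)[OF prs pD Y[OF F] p])
    moreover have "ae_eq (cyl UNIV) (?RR (\<lambda>z. ?F' z - ?G z)) (\<lambda>z. ?RR ?F' z - ?RR ?G z)"
      by (rule RR_diff[OF R F' G d]) (simp add: ae_eq_def)
    then have "ae_eq ?B (?RR (\<lambda>z. ?F' z - ?G z)) (\<lambda>z. ?RR ?F' z - ?RR ?G z)"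
      by (rule ae_eq_subset) auto
    ultimately show "ae_eq ?B (\<lambda>z. p_act D' z - ?P (p_act D) z)
        (\<lambda>z. ?RR (\<lambda>z. ?F' z - ?G z) z + (?RR ?G z - ?P (?RR ?F) z))"
      using p' unfolding ae_eq_def by eventually_elim auto
  qed
  then show ?thesis using s(2) RR_norm_le[OF S d] unfolding Rep_Fact_def by linarith
qed

lemma Err_rep_le:
  assumes S: "data_ok S" and D: "coords_ok D" and D': "coords_ok D'"
    and M: "L3_norm (vel D') + L3_norm (rp_u (maps S) (vel D)) +
       L3_norm (mod_vel D') + L3_norm (rp_U (maps S) (mod_vel D)) \<le> M"
    and Fact: "ae_eq Q1 (F_act D') (\<lambda>z. cut_eta S (fst z) *\<^sub>R outer (vel D' z) (vel D' z))"
    and Fmod: "ae_eq Q1 (F_mod D') (\<lambda>z. cut_eta S (fst z) *\<^sub>R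
          (outer (mod_vel D' z) (mod_vel D' z) + stress D' z))"
    and p: "ae_eq (cyl (Bl (1/2))) (p_act D) (RR (riesz S) (F_act D))"
    and p': "ae_eq (cyl (Bl (1/2))) (p_act D') (RR (riesz S) (F_act D'))"
    and budget: "Yprs_norm (\<lambda>z. RR (riesz S) (rp_src (maps S) (F_act D)) z -
         rp_prs (maps S) (RR (riesz S) (F_act D)) z) \<le> C_R S * l" and l: "0 \<le> l"
  shows "Err_rep S D D' \<le> (1 + \<bar>C_CZ S\<bar> + \<bar>C_R S\<bar>) * (2 + M) *
    (Rep_u S D D' + Rep_U S D D' + Rep_R S D D' + Rep_E S D D' + Rep_harm S D D' +
     Rep_Pi S D D' + Rep_Phi S D D' + Rep_T S D D' + Leak_F S D + Leak_Fmod S D + l)"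
proof -
  have Q: "Q1 \<in> sets borel" by simp
  have u: "bdd_Lmap 3 Q1 (rp_u (maps S))" and U: "bdd_Lmap 3 Q1 (rp_U (maps S))"
    and R: "bdd_Lmap (3/2) Q1 (rp_R (maps S))" and src: "bdd_Lmap (3/2) Q1 (rp_src (maps S))"
    using S unfolding data_ok_def bdd_repro_def by blast+
  note D = D[unfolded coords_ok_def] and D' = D'[unfolded coords_ok_def]
  have coords: "L3_sp (vel D')" "L3_sp (mod_vel D')" "Xsrc (F_act D')" "Xsrc (F_mod D')" "Xsrc (stress D')"
    using D' by blast+
  have images: "L3_sp (rp_u (maps S) (vel D))" "L3_sp (rp_U (maps S) (mod_vel D))"
    "Xsrc (rp_src (maps S) (F_act D))" "Xsrc (rp_src (maps S) (F_mod D))" "Xsrc (rp_R (maps S) (stress D))"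
    using D bdd_LmapD(1)[OF u] bdd_LmapD(1)[OF U] bdd_LmapD(1)[OF R] bdd_LmapD(1)[OF src] by blast+
  have zero: "Xsrc (\<lambda>_. 0)" "Xsrc_norm (\<lambda>_. 0) = 0"
    by (simp_all add: Lsp_def Lnorm_def set_borel_measurable_def set_integrable_def)
  have M1: "L3_norm (vel D') + L3_norm (rp_u (maps S) (vel D)) \<le> M"
    "L3_norm (mod_vel D') + L3_norm (rp_U (maps S) (mod_vel D)) \<le> M"
    using M Lnorm_nonneg[of 3 Q1 "vel D'"] Lnorm_nonneg[of 3 Q1 "rp_u (maps S) (vel D)"]
      Lnorm_nonneg[of 3 Q1 "mod_vel D'"] Lnorm_nonneg[of 3 Q1 "rp_U (maps S) (mod_vel D)"] by linarith+
  have M0: "0 \<le> M"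
    using M1(1) Lnorm_nonneg[of 3 Q1 "vel D'"] Lnorm_nonneg[of 3 Q1 "rp_u (maps S) (vel D)"] by linarith
  define u0 U0 R0 E0 h0 P0 Ph0 T0 where vals: "u0 = Rep_u S D D'" "U0 = Rep_U S D D'" "R0 = Rep_R S D D'"
    "E0 = Rep_E S D D'" "h0 = Rep_harm S D D'" "P0 = Rep_Pi S D D'" "Ph0 = Rep_Phi S D D'" "T0 = Rep_T S D D'"
  define Fa Fm where Fs: "Fa = Leak_F S D" "Fm = Leak_Fmod S D"
  have nn: "0 \<le> u0" "0 \<le> U0" "0 \<le> R0" "0 \<le> E0" "0 \<le> h0" "0 \<le> P0" "0 \<le> Ph0" "0 \<le> T0" "0 \<le> Fa" "0 \<le> Fm"
    by (simp_all add: vals Fs Rep_u_def Rep_U_def Rep_R_def Rep_E_def Rep_harm_def Rep_Pi_def Rep_Phi_def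
        Rep_T_def Leak_F_def Leak_Fmod_def)
  have "Rep_Fact S D D' \<le> (L3_norm (vel D') + L3_norm (rp_u (maps S) (vel D))) * u0 + Fa"
    using source_realization_defect[OF S coords(3) images(3) coords(1) images(1) zero(1) zero(1)] Fact
    by (simp add: Rep_Fact_def vals Fs Rep_u_def Leak_F_def zero(2))
  also have "\<dots> \<le> M * u0 + Fa" using M1 nn by (simp add: mult_right_mono)
  finally have A: "Rep_Fact S D D' \<le> M * u0 + Fa" .
  have "Rep_Fmod S D D' \<le> (L3_norm (mod_vel D') + L3_norm (rp_U (maps S) (mod_vel D))) * U0 + R0 + Fm"
    using source_realization_defect[OF S coords(4) images(4) coords(2) images(2) coords(5) images(5) Fmod]
    by (simp add: Rep_Fmod_def vals Fs Rep_U_def Rep_R_def Leak_Fmod_def)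
  also have "\<dots> \<le> M * U0 + R0 + Fm" using M1 nn by (simp add: mult_right_mono)
  finally have B: "Rep_Fmod S D D' \<le> M * U0 + R0 + Fm" .
  let ?z = "\<bar>C_CZ S\<bar>" and ?r = "\<bar>C_R S\<bar>"
  have "C_R S * l \<le> ?r * l" using l by (intro mult_right_mono) auto
  moreover have "?z * Rep_Fact S D D' \<le> ?z * (M * u0 + Fa)" using A by (intro mult_left_mono) auto
  ultimately have C: "Rep_pact S D D' \<le> ?z * (M * u0 + Fa) + ?r * l"
    using Rep_pact_le[OF S assms(2,3) p p'] budget by linarith
  let ?K = "(1 + ?z + ?r) * (2 + M)"
  have K: "1 + M + ?z * M \<le> ?K" "1 + M \<le> ?K" "2 \<le> ?K" "1 \<le> ?K" "1 + ?z \<le> ?K" "?r \<le> ?K"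
  proof -
    have e: "?K = 2 + M + 2 * ?z + ?z * M + 2 * ?r + ?r * M" by (simp add: algebra_simps)
    have n: "0 \<le> ?z" "0 \<le> ?r" "0 \<le> ?z * M" "0 \<le> ?r * M" using M0 by simp_all
    show "1 + M + ?z * M \<le> ?K" "1 + M \<le> ?K" "2 \<le> ?K" "1 \<le> ?K" "1 + ?z \<le> ?K" "?r \<le> ?K"
      unfolding e using n M0 by linarith+
  qed
  \<comment> \<open>The velocity defect counts directly, through \<open>F_act\<close> with factor
    \<open>M\<close>, and again through the pressure with factor \<open>?z * M\<close>. The stress
    defect counts twice, directly and through \<open>F_mod\<close>; \<open>F_act\<close> leakage
    counts through the source and the pressure. \<open>?K\<close> dominates every
    coefficient.\<close>
  have "Err_rep S D D' \<le> (1 + M + ?z * M) * u0 + (1 + M) * U0 + 2 * R0 + 1 * E0 + 1 * h0 + 1 * P0 +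
      1 * Ph0 + 1 * T0 + (1 + ?z) * Fa + 1 * Fm + ?r * l"
    using A B C unfolding Err_rep_def vals[symmetric] by (simp add: algebra_simps)
  also have "\<dots> \<le> ?K * u0 + ?K * U0 + ?K * R0 + ?K * E0 + ?K * h0 + ?K * P0 +
      ?K * Ph0 + ?K * T0 + ?K * Fa + ?K * Fm + ?K * l"
    by (intro add_mono mult_right_mono K nn l)
  finally show ?thesis unfolding vals[symmetric] Fs[symmetric] by (simp add: distrib_left)
qed

section \<open>Gauge shifts, domination by the component norms, and the total estimate\<close>

lemma vel_shift: "gauge \<zeta> \<Longrightarrow> vel (shift D \<zeta>) = vel D"
  by (simp add: gauge_def shift_def)

text \<open>A gauge has identically zero velocity, so the velocity is literally unchanged and its
  weak gradient survives; the other coordinates stay in their spaces under subtraction.\<close>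

lemma sharp_pkg_shift:
  assumes "sharp_pkg D" "gauge \<zeta>"
  shows "sharp_pkg (shift D \<zeta>)"
proof -
  have "coords_ok D" "coords_ok \<zeta>" using assms by (auto simp: sharp_pkg_def gauge_def)
  then have "coords_ok (shift D \<zeta>)"
    by (auto simp: coords_ok_def shift_def intro!: Lsp_diff(1))
  then show ?thesis using assms vel_shift[OF assms(2), of D] by (simp add: sharp_pkg_def)
qed

lemma functionals_okD:
  assumes "functionals_ok S Fn" "sharp_pkg D"
  shows "0 \<le> fn_core Fn D" "0 \<le> fn_win Fn D"
    "sharp_norm Fn D + Leak_gradu S D + Leak_u S D + Leak_p S D \<le> dom_win1 S * fn_win Fn D"
    "sharp_norm Fn D + Err_gs_win S Fn D \<le> dom_win2 S * fn_win Fn D"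
    "Xsrc F \<Longrightarrow> 0 \<le> fn_leak_prs Fn F"
    "sharp_pkg D' \<Longrightarrow> 0 \<le> fn_edge Fn D D'"
    "sharp_pkg D' \<Longrightarrow> chain_rep_norm S Fn D D' \<le> dom_edge1 S * fn_edge Fn D D'"
    "sharp_pkg D' \<Longrightarrow> chain_rep_norm S Fn D D' + Err_gs_win S Fn D + Err_gs_win S Fn D' +
          Err_gs_chain S Fn D D' \<le> dom_edge2 S * fn_edge Fn D D'"
  using assms unfolding functionals_ok_def by blast+

lemma sharp_norm_nonneg:
  assumes "functionals_ok S Fn" "sharp_pkg D"
  shows "0 \<le> sharp_norm Fn D"
  using functionals_okD(1)[OF assms] by (simp add: sharp_norm_def)

lemma Err_gs_win_nonneg: "data_ok S \<Longrightarrow> 0 \<le> Err_gs_win S Fn D"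
  unfolding Err_gs_win_def data_ok_def
  by (intro add_nonneg_nonneg sum_nonneg mult_nonneg_nonneg) (auto simp: Gate_def Slack_def less_imp_le)

text \<open>The window norm is used twice, for pressure and localization through
  \<open>dom_win1\<close> and for gate/slack through \<open>dom_win2\<close>, which is why the two
  constants add. Nonnegativity of the remaining summands isolates each needed part of a dominated
  sum.\<close>

lemma window_residual_le:
  assumes S: "data_ok S" and Fn: "functionals_ok S Fn" and D: "sharp_pkg D"
    and M: "L3_norm (vel D) + L3_norm (mod_vel D) \<le> M"
    and c: "0 \<le> c" "Err_loc S D \<le> c * (1 + M)\<^sup>2 * (Leak_gradu S D + Leak_u S D + Leak_p S D)"
  shows "Err_prs S D + Err_loc S D + Err_gs_win S Fn D
    \<le> ((\<bar>C_CZ S\<bar> * (1 + M) + c * (1 + M)\<^sup>2) * dom_win1 S + dom_win2 S) * fn_win Fn D"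
proof -
  let ?w = "dom_win1 S * fn_win Fn D"
  have M0: "0 \<le> M" using M Lnorm_nonneg[of 3 Q1 "vel D"] Lnorm_nonneg[of 3 Q1 "mod_vel D"] by linarith
  have leak: "0 \<le> Leak_gradu S D" "0 \<le> Leak_u S D" "0 \<le> Leak_p S D"
    by (simp_all add: Leak_gradu_def Leak_u_def Leak_p_def)
  note f = functionals_okD[OF Fn D] and sn = sharp_norm_nonneg[OF Fn D]
  have "Err_prs S D \<le> \<bar>C_CZ S\<bar> * (1 + M) * sharp_norm Fn D"
  proof (rule order_trans[OF Err_prs_le[OF S _ M]])
    show "coords_ok D" using D by (simp add: sharp_pkg_def)
    show "\<bar>C_CZ S\<bar> * (1 + M) * (L3_norm (\<lambda>z. vel D z - mod_vel D z) + Xsrc_norm (stress D) +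
      Xsrc_norm (E_F D) + Lnorm 3 (cyl (Bl 1 - Bl (3/4))) (vel D)) \<le> \<bar>C_CZ S\<bar> * (1 + M) * sharp_norm Fn D"
      unfolding sharp_norm_def using f(1) M0 by (intro mult_left_mono) auto
  qed
  also have "\<dots> \<le> \<bar>C_CZ S\<bar> * (1 + M) * ?w"
    using M0 f(3) leak by (intro mult_left_mono) auto
  finally have 1: "Err_prs S D \<le> \<bar>C_CZ S\<bar> * (1 + M) * ?w" .
  have "Err_loc S D \<le> c * (1 + M)\<^sup>2 * ?w"
    using c f(3) sn by (intro order_trans[OF c(2)] mult_left_mono) auto
  moreover have "Err_gs_win S Fn D \<le> dom_win2 S * fn_win Fn D" using f(4) sn by linarith
  ultimately show ?thesis using 1 by (simp add: algebra_simps)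
qed

text \<open>The bracket in \<open>rep\<close> is \<open>chain_rep_norm\<close> without its two
  \<open>sharp_norm\<close> terms. The gate/slack chain part is isolated from the second domination
  inequality by dropping nonnegative summands.\<close>

lemma edge_residual_le:
  assumes S: "data_ok S" and Fn: "functionals_ok S Fn" and D: "sharp_pkg D" and D': "sharp_pkg D'" and K: "0 \<le> K"
    and rep: "Err_rep S D D' \<le> K *
    (Rep_u S D D' + Rep_U S D D' + Rep_R S D D' + Rep_E S D D' + Rep_harm S D D' +
     Rep_Pi S D D' + Rep_Phi S D D' + Rep_T S D D' + Leak_F S D + Leak_Fmod S D + fn_leak_prs Fn (F_act D))"
  shows "Err_rep S D D' + Err_gs_chain S Fn D D' \<le> (K * dom_edge1 S + dom_edge2 S) * fn_edge Fn D D'"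
proof -
  have sn: "0 \<le> sharp_norm Fn D" "0 \<le> sharp_norm Fn D'"
    using sharp_norm_nonneg[OF Fn D] sharp_norm_nonneg[OF Fn D'] .
  have l: "0 \<le> fn_leak_prs Fn (F_act D)"
    using functionals_okD(5)[OF Fn D] D by (simp add: sharp_pkg_def coords_ok_def)
  have "Err_rep S D D' \<le> K * chain_rep_norm S Fn D D'"
    unfolding chain_rep_norm_def using sn K by (intro order_trans[OF rep] mult_left_mono) auto
  also have "\<dots> \<le> K * (dom_edge1 S * fn_edge Fn D D')"
    using functionals_okD(7)[OF Fn D D'] K by (rule mult_left_mono)
  finally have 1: "Err_rep S D D' \<le> K * (dom_edge1 S * fn_edge Fn D D')" .
  have "0 \<le> chain_rep_norm S Fn D D'"
    unfolding chain_rep_norm_def using sn l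
    by (simp add: Rep_u_def Rep_U_def Rep_R_def Rep_E_def Rep_harm_def Rep_Pi_def Rep_Phi_def
        Rep_T_def Leak_F_def Leak_Fmod_def)
  then have "Err_gs_chain S Fn D D' \<le> dom_edge2 S * fn_edge Fn D D'"
    using functionals_okD(8)[OF Fn D D'] Err_gs_win_nonneg[OF S, of Fn D] Err_gs_win_nonneg[OF S, of Fn D'] by linarith
  with 1 show ?thesis by (simp add: algebra_simps)
qed

text \<open>\<open>C\<close> is quantified before the functionals, the gauge class, the chain and
  \<open>\<delta>\<close>, so it can depend only on \<open>S\<close>, \<open>K\<close> and its
  argument \<open>M_U\<close>; the domination constants are fields of \<open>S\<close>.\<close>

theorem theorem5p1:
  fixes S :: "('pi::real_normed_vector, 'phi::real_normed_vector,
      'tt::real_normed_vector, 'a) fixed_data"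
    and K :: nat
  assumes "data_ok S"
  shows "\<exists>C :: real \<Rightarrow> real. \<forall>M_U
    (Fn :: ('pi, 'phi, 'tt, 's::real_normed_vector, 'a) functionals)
    (G :: (nat \<Rightarrow> ('pi, 'phi, 'tt, 's) pkg) set)
    (D :: nat \<Rightarrow> ('pi, 'phi, 'tt, 's) pkg) \<zeta> \<delta> E.
    functionals_ok S Fn \<longrightarrow>
    gauge_class K G \<longrightarrow>
    (\<forall>k\<le>K. sharp_pkg (D k)) \<longrightarrow>
    \<zeta> \<in> G \<longrightarrow>
    E = shift_chain D \<zeta> \<longrightarrow>
    \<comment> \<open>amplitude\<close>
    (\<forall>k\<le>K. L3_norm (vel (D k)) + L3_norm (mod_vel (E k)) \<le> M_U) \<longrightarrow>
    (\<forall>k<K. L3_norm (vel (D (Suc k))) + L3_norm (rp_u (maps S) (vel (D k))) +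
       L3_norm (mod_vel (E (Suc k))) + L3_norm (rp_U (maps S) (mod_vel (E k))) \<le> M_U) \<longrightarrow>
    \<comment> \<open>source and pressure realization\<close>
    (\<forall>k\<le>K.
       ae_eq Q1 (F_act (E k)) (\<lambda>z. cut_eta S (fst z) *\<^sub>R outer (vel (D k) z) (vel (D k) z)) \<and>
       ae_eq Q1 (F_mod (E k)) (\<lambda>z. cut_eta S (fst z) *\<^sub>R
          (outer (mod_vel (E k) z) (mod_vel (E k) z) + stress (E k) z)) \<and>
       ae_eq (cyl (Bl (1/2))) (p_act (E k)) (RR (riesz S) (F_act (E k)))) \<longrightarrow>
    \<comment> \<open>pressure-intertwining budget\<close>
    (\<forall>k<K. Yprs_norm (\<lambda>z. RR (riesz S) (rp_src (maps S) (F_act (E k))) z -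
         rp_prs (maps S) (RR (riesz S) (F_act (E k))) z)
       \<le> C_R S * fn_leak_prs Fn (F_act (E k))) \<longrightarrow>
    \<comment> \<open>near-minimizer\<close>
    comp_norm Fn K E \<le> comp_dist Fn K D G + \<delta> \<longrightarrow>
    Err_comp S Fn K E \<le> C M_U * comp_dist Fn K D G + C M_U * \<delta>"
proof -
  obtain c where c: "0 \<le> c" "\<And>(P :: ('pi, 'phi, 'tt, 's) pkg) M.
    sharp_pkg P \<Longrightarrow> L3_norm (vel P) \<le> M \<Longrightarrow>
    Err_loc S P \<le> c * (1 + M)\<^sup>2 * (Leak_gradu S P + Leak_u S P + Leak_p S P)"
    using Err_loc_le[OF assms] by metis
  define k where "k M = (1 + \<bar>C_CZ S\<bar> + \<bar>C_R S\<bar>) * (2 + M)" for M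
  \<comment> \<open>The sum of the window and the edge constant: both are nonnegative for
    \<open>M \<ge> 0\<close>, so the sum bounds each, and one factor can be pulled out of both
    sums.\<close>
  define C where "C M = ((\<bar>C_CZ S\<bar> * (1 + M) + c * (1 + M)\<^sup>2) * dom_win1 S + dom_win2 S) +
    (k M * dom_edge1 S + dom_edge2 S)" for M
  have dom: "0 \<le> dom_win1 S" "0 \<le> dom_win2 S" "0 \<le> dom_edge1 S" "0 \<le> dom_edge2 S"
    using assms by (auto simp: data_ok_def)
  show ?thesis
  proof (intro exI[of _ C] allI impI)
    fix M Fn G D \<zeta> \<delta> E
    assume Fn: "functionals_ok S (Fn :: ('pi, 'phi, 'tt, 's, 'a) functionals)"
      and G: "gauge_class K G" and D: "\<forall>k\<le>K. sharp_pkg (D k)" and \<zeta>: "\<zeta> \<in> G"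
      and E: "E = shift_chain D \<zeta>"
      and amp: "\<forall>k\<le>K. L3_norm (vel (D k)) + L3_norm (mod_vel (E k)) \<le> M"
      and amp': "\<forall>k<K. L3_norm (vel (D (Suc k))) + L3_norm (rp_u (maps S) (vel (D k))) +
        L3_norm (mod_vel (E (Suc k))) + L3_norm (rp_U (maps S) (mod_vel (E k))) \<le> M"
      and real: "\<forall>k\<le>K.
       ae_eq Q1 (F_act (E k)) (\<lambda>z. cut_eta S (fst z) *\<^sub>R outer (vel (D k) z) (vel (D k) z)) \<and>
       ae_eq Q1 (F_mod (E k)) (\<lambda>z. cut_eta S (fst z) *\<^sub>R
          (outer (mod_vel (E k) z) (mod_vel (E k) z) + stress (E k) z)) \<and>
       ae_eq (cyl (Bl (1/2))) (p_act (E k)) (RR (riesz S) (F_act (E k)))"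
      and budget: "\<forall>k<K. Yprs_norm (\<lambda>z. RR (riesz S) (rp_src (maps S) (F_act (E k))) z -
         rp_prs (maps S) (RR (riesz S) (F_act (E k))) z) \<le> C_R S * fn_leak_prs Fn (F_act (E k))"
      and near: "comp_norm Fn K E \<le> comp_dist Fn K D G + \<delta>"
    have gauge: "gauge (\<zeta> k)" if "k \<le> K" for k using G \<zeta> that by (auto simp: gauge_class_def)
    have vel: "vel (E k) = vel (D k)" and sharp: "sharp_pkg (E k)" if "k \<le> K" for k
      using vel_shift[OF gauge[OF that]] sharp_pkg_shift[OF _ gauge[OF that]] D that
      by (simp_all add: E shift_chain_def)
    \<comment> \<open>The amplitude bound at index 0 forces \<open>M\<close> to be nonnegative. This
      gives \<open>0 \<le> C M\<close>, by which the near-minimizer inequality is multiplied at the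
      end.\<close>
    have M0: "0 \<le> M"
      using amp Lnorm_nonneg[of 3 Q1 "vel (D 0)"] Lnorm_nonneg[of 3 Q1 "mod_vel (E 0)"]
      by (meson add_nonneg_nonneg le0 order_trans)
    have k0: "0 \<le> k M" using M0 by (simp add: k_def)
    have W: "((\<bar>C_CZ S\<bar> * (1 + M) + c * (1 + M)\<^sup>2) * dom_win1 S + dom_win2 S) \<le> C M"
      and X: "k M * dom_edge1 S + dom_edge2 S \<le> C M" and C0: "0 \<le> C M"
      using M0 k0 c(1) dom by (simp_all add: C_def)
    have "Err_prs S (E j) + Err_loc S (E j) + Err_gs_win S Fn (E j) \<le> C M * fn_win Fn (E j)" if j: "j \<le> K" for j
    proof -
      have m: "L3_norm (vel (E j)) + L3_norm (mod_vel (E j)) \<le> M" using amp j by (simp add: vel)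
      then have "L3_norm (vel (E j)) \<le> M" using Lnorm_nonneg[of 3 Q1 "mod_vel (E j)"] by linarith
      from window_residual_le[OF assms Fn sharp[OF j] m c(1) c(2)[OF sharp[OF j] this]]
      show ?thesis
        using mult_right_mono[OF W functionals_okD(2)[OF Fn sharp[OF j]]] by linarith
    qed
    then have 1: "(\<Sum>j\<le>K. Err_prs S (E j) + Err_loc S (E j) + Err_gs_win S Fn (E j)) \<le> (\<Sum>j\<le>K. C M * fn_win Fn (E j))"
      by (intro sum_mono) auto
    have "Err_rep S (E j) (E (Suc j)) + Err_gs_chain S Fn (E j) (E (Suc j)) \<le> C M * fn_edge Fn (E j) (E (Suc j))"
      if j: "j < K" for j
    proof -
      have le: "j \<le> K" "Suc j \<le> K" using j by auto
      note s = sharp[OF le(1)] and s' = sharp[OF le(2)]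
      have co: "coords_ok (E j)" "coords_ok (E (Suc j))" using s s' by (simp_all add: sharp_pkg_def)
      have l: "0 \<le> fn_leak_prs Fn (F_act (E j))"
        using functionals_okD(5)[OF Fn s] co(1) by (simp add: coords_ok_def)
      have "Err_rep S (E j) (E (Suc j)) \<le> k M * (Rep_u S (E j) (E (Suc j)) + Rep_U S (E j) (E (Suc j)) +
          Rep_R S (E j) (E (Suc j)) + Rep_E S (E j) (E (Suc j)) + Rep_harm S (E j) (E (Suc j)) +
          Rep_Pi S (E j) (E (Suc j)) + Rep_Phi S (E j) (E (Suc j)) + Rep_T S (E j) (E (Suc j)) +
          Leak_F S (E j) + Leak_Fmod S (E j) + fn_leak_prs Fn (F_act (E j)))"
        unfolding k_def using amp' real budget j le
        by (intro Err_rep_le assms co l) (simp_all add: vel)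
      from edge_residual_le[OF assms Fn s s' k0 this]
      show ?thesis using mult_right_mono[OF X functionals_okD(6)[OF Fn s s']] by linarith
    qed
    then have 2: "(\<Sum>j<K. Err_rep S (E j) (E (Suc j)) + Err_gs_chain S Fn (E j) (E (Suc j))) \<le>
        (\<Sum>j<K. C M * fn_edge Fn (E j) (E (Suc j)))"
      by (intro sum_mono) auto
    have "Err_comp S Fn K E \<le> C M * comp_norm Fn K E"
      using add_mono[OF 1 2] by (simp add: Err_comp_def comp_norm_def sum_distrib_left distrib_left)
    also have "\<dots> \<le> C M * (comp_dist Fn K D G + \<delta>)" using near C0 by (rule mult_left_mono)
    finally show "Err_comp S Fn K E \<le> C M * comp_dist Fn K D G + C M * \<delta>" by (simp add: distrib_left)
  qed
qed

end
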